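(* Let $k, n$ be positive integers such that $k-2n$ is a positive multiple of $q-1$ and $n \leq p^{v_p(k-n)}$, where $v_p$ denotes the $p$-adic valuation. Then the series \[ f_{k,n} := \sum_{a \in A_+} a^{k-n}\, G_n(t_a) \] converges for $z \in \Omega$ with $|z|_i > 1$, and it is (the restriction of) an element of $S_{k,m}(\mathrm{GL}_2(A))$, where $m \equiv n \pmod{q-1}$.
   Context: Let $p$ be a prime and $q=p^e$. Let $A=\mathbb{F}_q[T]$ and let $A_+$ be its set of monic elements. Let $K_\infty=\mathbb{F}_q((1/T))$, let $\mathbb{C}_\infty$ be the completion of an algebraic closure of $K_\infty$, and let $\Omega=\mathbb{C}_\infty\setminus K_\infty$ be the Drinfeld upper half plane, on which $\mathrm{GL}_2(A)$ acts by Möbius transformations. For $z \in \mathbb{C}_\infty$ put $|z|_i=\inf_{x\in K_\infty}|z-x|$. Fix a period $\widetilde{\pi}$ of the Carlitz module, so that the Carlitz exponential is $e_{\widetilde{\pi}A}(z)=z\prod_{0\neq\lambda\in\widetilde{\pi}A}(1-z/\lambda)$. Put $t(z)=1/e_{\widetilde{\pi}A}(\widetilde{\pi}z)$ and, for $a\in A_+$, $t_a(z)=t(az)$. For $n\ge 1$, $G_n(X)\in\mathbb{C}_\infty[X]$ is the $n$-th Goss polynomial of the lattice $\widetilde{\pi}A$, i.e. the polynomial satisfying $G_n(t(z))=\sum_{b\in A}(\widetilde{\pi}z+\widetilde{\pi}b)^{-n}$ for all $z\in\Omega$. For an integer $k\ge 0$ and a class $m \in \mathbb{Z}/(q-1)$,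 a Drinfeld modular form of weight $k$ and type $m$ for $\mathrm{GL}_2(A)$ is a rigid analytic function $f:\Omega\to\mathbb{C}_\infty$ satisfying \[ f\!\left(\tfrac{az+b}{cz+d}\right)=(ad-bc)^{-m}(cz+d)^k f(z)\quad\text{for all }\begin{pmatrix}a&b\\c&d\end{pmatrix}\in\mathrm{GL}_2(A), \] which is holomorphic at infinity, i.e. has an expansion $f=\sum_{i\ge0}a_i t^i$ valid for $|z|_i$ sufficiently large. These forms make up the space $M_{k,m}(\mathrm{GL}_2(A))$. The subspace $S_{k,m}(\mathrm{GL}_2(A))$ of cusp forms consists of those $f$ with $a_0=0$. *)

theory Defs
  imports "HOL-Analysis.Analysis" "HOL-Computational_Algebra.Computational_Algebra"
    "HOL-Number_Theory.Cong"
begin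

text \<open>Fields with a non-archimedean absolute value \<open>vabs\<close>, with the metric it induces.
  (The constant \<open>norm\<close> is tied to real normed vector spaces.)\<close>

class nonarch_field = field + metric_space +
  fixes vabs :: "'a \<Rightarrow> real"
  assumes dist_vabs: "dist x y = vabs (x - y)"
    and vabs_mult: "vabs (x * y) = vabs x * vabs y"
    and vabs_add: "vabs (x + y) \<le> max (vabs x) (vabs y)"

text \<open>
  Throughout, \<open>'a\<close> is the finite field with \<open>q = CARD('a)\<close> elements, \<open>A = 'a poly\<close>, and
  \<open>K\<^sub>\<infinity> = 'a fls\<close> with the variable \<open>fls_X\<close> of the Laurent series standing for \<open>1/T\<close>, so that
  \<open>T\<close> is \<open>fls_X_inv\<close> and the absolute value with \<open>\<bar>T\<bar> = q\<close> is \<open>q powi (- fls_subdegree x)\<close>.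
  The field \<open>\<complex>\<^sub>\<infinity>\<close> is a type \<open>'c\<close> together with an embedding \<open>\<iota>\<close> of \<open>K\<^sub>\<infinity>\<close>.
\<close>

definition algebraic_elements ::
    "('a::{finite,field} fls \<Rightarrow> 'c::nonarch_field) \<Rightarrow> 'c set" where
  "algebraic_elements \<iota> = {z. \<exists>P :: 'a fls poly. P \<noteq> 0 \<and> poly (map_poly \<iota> P) z = 0}"

text \<open>
  \<open>'c\<close> is the completion of an algebraic closure of \<open>K\<^sub>\<infinity>\<close>: it is complete (by its sort), its
  absolute value extends that of \<open>K\<^sub>\<infinity>\<close>, and the elements algebraic over \<open>K\<^sub>\<infinity>\<close> form an
  algebraically closed and dense subfield. This determines \<open>'c\<close> and \<open>\<iota>\<close> up to isometric
  isomorphism.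
\<close>

definition is_C_infinity ::
    "('a::{finite,field} fls \<Rightarrow> 'c::{nonarch_field,complete_space}) \<Rightarrow> bool" where
  "is_C_infinity \<iota> \<longleftrightarrow>
     \<iota> 1 = 1 \<and> (\<forall>x y. \<iota> (x + y) = \<iota> x + \<iota> y) \<and> (\<forall>x y. \<iota> (x * y) = \<iota> x * \<iota> y) \<and>
     (\<forall>x. x \<noteq> 0 \<longrightarrow> vabs (\<iota> x) = real CARD('a) powi (- fls_subdegree x)) \<and>
     (\<forall>P. degree P > 0 \<and> (\<forall>i. coeff P i \<in> algebraic_elements \<iota>) \<longrightarrow>
        (\<exists>z \<in> algebraic_elements \<iota>. poly P z = 0)) \<and>
     closure (algebraic_elements \<iota>) = UNIV"

definition emb :: "('a::{finite,field} fls \<Rightarrow> 'c) \<Rightarrow> 'a poly \<Rightarrow> 'c" where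
  "emb \<iota> a = \<iota> (poly (map_poly fls_const a) fls_X_inv)"

definition A_plus :: "'a::{finite,field} poly set" where
  "A_plus = {a. lead_coeff a = 1}"

definition Omega :: "('a::{finite,field} fls \<Rightarrow> 'c) \<Rightarrow> 'c set" where
  "Omega \<iota> = UNIV - range \<iota>"

definition imag_abs :: "('a::{finite,field} fls \<Rightarrow> 'c::nonarch_field) \<Rightarrow> 'c \<Rightarrow> real" where
  "imag_abs \<iota> z = (INF x. vabs (z - \<iota> x))"

text \<open>
  The exponential of the Carlitz module \<open>T \<mapsto> T + \<tau>\<close> is \<open>\<Sum>i. z ^ (q ^ i) / D i\<close>.
  A period is a generator of its kernel, which is an \<open>A\<close>-lattice of rank one.
\<close>

primrec carlitz_D :: "nat \<Rightarrow> 'a::{finite,field} poly" where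
  "carlitz_D 0 = 1"
| "carlitz_D (Suc i) = (monom 1 (CARD('a) ^ Suc i) - monom 1 1) * carlitz_D i ^ CARD('a)"

definition carlitz_exp :: "('a::{finite,field} fls \<Rightarrow> 'c::nonarch_field) \<Rightarrow> 'c \<Rightarrow> 'c" where
  "carlitz_exp \<iota> z = (\<Sum>i. z ^ (CARD('a) ^ i) / emb \<iota> (carlitz_D i))"

definition period_lattice :: "('a::{finite,field} fls \<Rightarrow> 'c::nonarch_field) \<Rightarrow> 'c \<Rightarrow> 'c set" where
  "period_lattice \<iota> \<pi> = range (\<lambda>a. \<pi> * emb \<iota> a)"

definition carlitz_period :: "('a::{finite,field} fls \<Rightarrow> 'c::nonarch_field) \<Rightarrow> 'c \<Rightarrow> bool" where
  "carlitz_period \<iota> \<pi> \<longleftrightarrow> \<pi> \<noteq> 0 \<and> {z. carlitz_exp \<iota> z = 0} = period_lattice \<iota> \<pi>"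

text \<open>The infinite product is the limit of the products over the finite sets of nonzero
  lattice points.\<close>

definition lattice_exp :: "'c::nonarch_field set \<Rightarrow> 'c \<Rightarrow> 'c" where
  "lattice_exp \<Lambda> z =
     z * Lim (finite_subsets_at_top (\<Lambda> - {0})) (\<lambda>S. \<Prod>w\<in>S. 1 - z / w)"

definition t_par :: "('a::{finite,field} fls \<Rightarrow> 'c::nonarch_field) \<Rightarrow> 'c \<Rightarrow> 'c \<Rightarrow> 'c" where
  "t_par \<iota> \<pi> z = 1 / lattice_exp (period_lattice \<iota> \<pi>) (\<pi> * z)"

definition goss_poly ::
    "('a::{finite,field} fls \<Rightarrow> 'c::nonarch_field) \<Rightarrow> 'c \<Rightarrow> nat \<Rightarrow> 'c poly" where
  "goss_poly \<iota> \<pi> n = (THE G. \<forall>z \<in> Omega \<iota>.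
     ((\<lambda>b. 1 / (\<pi> * z + \<pi> * emb \<iota> b) ^ n) has_sum poly G (t_par \<iota> \<pi> z)) UNIV)"

text \<open>
  \<open>\<Omega>\<close> is covered by the affinoids \<open>{z. \<bar>z\<bar>\<^sub>i \<ge> q\<^sup>-\<^sup>N, \<bar>z\<bar> \<le> q\<^sup>N}\<close>, and a function on \<open>\<Omega>\<close> is rigid
  analytic iff on each of them it is a uniform limit of rational functions without poles there.
\<close>

definition Omega_affinoid ::
    "('a::{finite,field} fls \<Rightarrow> 'c::nonarch_field) \<Rightarrow> nat \<Rightarrow> 'c set" where
  "Omega_affinoid \<iota> N =
     {z. imag_abs \<iota> z \<ge> 1 / real CARD('a) ^ N \<and> vabs z \<le> real CARD('a) ^ N}"

definition rigid_analytic ::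
    "('a::{finite,field} fls \<Rightarrow> 'c::nonarch_field) \<Rightarrow> ('c \<Rightarrow> 'c) \<Rightarrow> bool" where
  "rigid_analytic \<iota> f \<longleftrightarrow> (\<forall>N. \<forall>\<epsilon>>0. \<exists>P Q :: 'c poly.
     \<forall>z \<in> Omega_affinoid \<iota> N. poly Q z \<noteq> 0 \<and> vabs (f z - poly P z / poly Q z) < \<epsilon>)"

definition has_t_expansion ::
    "('a::{finite,field} fls \<Rightarrow> 'c::nonarch_field) \<Rightarrow> 'c \<Rightarrow> ('c \<Rightarrow> 'c) \<Rightarrow> (nat \<Rightarrow> 'c) \<Rightarrow> bool" where
  "has_t_expansion \<iota> \<pi> f c \<longleftrightarrow> (\<exists>R. \<forall>z \<in> Omega \<iota>. imag_abs \<iota> z > R \<longrightarrow>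
     (\<lambda>i. c i * t_par \<iota> \<pi> z ^ i) sums f z)"

text \<open>
  Modular forms are total functions on \<open>'c\<close>; their values outside \<open>\<Omega>\<close> are irrelevant.
  The class \<open>m\<close> modulo \<open>q - 1\<close> is given by any integer representing it.
\<close>

definition modular_forms ::
    "('a::{finite,field} fls \<Rightarrow> 'c::nonarch_field) \<Rightarrow> 'c \<Rightarrow> nat \<Rightarrow> int \<Rightarrow> ('c \<Rightarrow> 'c) set" where
  "modular_forms \<iota> \<pi> k m = {f. rigid_analytic \<iota> f \<and>
     (\<forall>M :: 'a poly ^ 2 ^ 2. invertible M \<longrightarrow> (\<forall>z \<in> Omega \<iota>.
        f ((emb \<iota> (M$1$1) * z + emb \<iota> (M$1$2)) / (emb \<iota> (M$2$1) * z + emb \<iota> (M$2$2))) =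
        emb \<iota> (det M) powi (- m) * (emb \<iota> (M$2$1) * z + emb \<iota> (M$2$2)) ^ k * f z)) \<and>
     (\<exists>c. has_t_expansion \<iota> \<pi> f c)}"

definition cusp_forms ::
    "('a::{finite,field} fls \<Rightarrow> 'c::nonarch_field) \<Rightarrow> 'c \<Rightarrow> nat \<Rightarrow> int \<Rightarrow> ('c \<Rightarrow> 'c) set" where
  "cusp_forms \<iota> \<pi> k m =
     {f \<in> modular_forms \<iota> \<pi> k m. \<exists>c. has_t_expansion \<iota> \<pi> f c \<and> c 0 = 0}"

definition f_summand ::
    "('a::{finite,field} fls \<Rightarrow> 'c::nonarch_field) \<Rightarrow> 'c \<Rightarrow> nat \<Rightarrow> nat \<Rightarrow> 'c \<Rightarrow> 'a poly \<Rightarrow> 'c" where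
  "f_summand \<iota> \<pi> k n z a =
     emb \<iota> a ^ (k - n) * poly (goss_poly \<iota> \<pi> n) (t_par \<iota> \<pi> (emb \<iota> a * z))"

end

theory Submission
  imports Defs
begin

text \<open>
  Since \<open>q - 1 = -1\<close> in \<open>\<complex>\<^sub>\<infinity>\<close>, the series is formally \<open>- \<pi>\<^sup>-\<^sup>n\<close> times the double
  series \<open>\<Sum> a\<^sup>k\<^sup>-\<^sup>n / (az + b)\<^sup>n\<close> over all \<open>(a, b) \<in> A\<^sup>2\<close>. Its terms grow, but grouped by
  the cosets of a fixed finite group of translations \<open>b \<mapsto> b + b'\<close> they tend to 0 uniformly on
  affinoids, because power sums over a finite additive group of \<open>N\<close> elements vanish in degrees
  below \<open>N - 1\<close>. So the double series defines a rigid analytic function on all of \<open>\<Omega>\<close>,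
  and it may be summed over any exhaustion of \<open>A\<^sup>2\<close> by sets stable under these translations.
  A matrix of \<open>GL\<^sub>2(A)\<close> permutes such exhaustions. It changes the summand by the expected factor
  and, as \<open>k - n\<close> is divisible by a power of \<open>p\<close> that is at least \<open>n\<close>, by a polynomial in
  \<open>(a, b)\<close> of degree \<open>k - 2n\<close>, whose sum vanishes again.
  The expansion at infinity comes from
  \<open>G\<^sub>n(t(az)) = a\<^sup>-\<^sup>n \<Sum>\<^sub>r G\<^sub>n(t(z + r/a))\<close>, with \<open>r\<close> running over the residues modulo \<open>a\<close>, and
  \<open>t(z + r/a) = t / (1 + t e(\<pi>r/a))\<close>.
\<close>

section \<open>Non-archimedean absolute values\<close>

text \<open>With y = az + b a summand can be as large as |y|^(k-2n), so the family over A^2 is not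
  summable and its terms cannot be rearranged at will. Hence limits of the double series run over
  unions of translation cosets, and the basic estimate treats all such sets outside a box at once.
  In a coset sum of y^(-n) the terms of degree 0 to k-2n of the binomial expansion cancel, which
  leaves size |y|^(-n-J) with J = k-2n+1. Multiplied by a^(k-n) this gives one factor 1/|y|, just
  enough for uniform convergence on affinoids. The condition on v_p(k-n) enters through the
  functional equation: it makes the error terms caused by a matrix polynomials rather than functions
  with poles. At infinity, the torsion points e(\<pi> r/a) form a group of q^(deg a) elements, so
  the summand of a contributes nothing to t^m for m \<le> deg a. Each coefficient is therefore a
  finite sum over a, and the growth of a^(k-n) is absorbed by taking |z|_i large. The exponential
  and the Goss polynomials of the lattice are obtained as limits of identities for finite additive
  groups, proved by interpolation.\<close>

lemma vabs_eq_dist: "vabs (x :: 'c::nonarch_field) = dist x 0"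
  by (simp add: dist_vabs)

lemma vabs_nonneg [simp]: "vabs (x :: 'c::nonarch_field) \<ge> 0"
  by (simp add: vabs_eq_dist)

lemma vabs_eq_0_iff [simp]: "vabs (x :: 'c::nonarch_field) = 0 \<longleftrightarrow> x = 0"
  by (simp add: vabs_eq_dist)

lemma vabs_0 [simp]: "vabs (0 :: 'c::nonarch_field) = 0"
  by simp

lemma vabs_pos_iff [simp]: "vabs (x :: 'c::nonarch_field) > 0 \<longleftrightarrow> x \<noteq> 0"
  by (simp add: vabs_eq_dist)

lemma vabs_le_0_iff [simp]: "vabs (x :: 'c::nonarch_field) \<le> 0 \<longleftrightarrow> x = 0"
  by (simp add: vabs_eq_dist)

lemma vabs_1 [simp]: "vabs (1 :: 'c::nonarch_field) = 1"
  using vabs_mult[of 1 "1 :: 'c"] by simp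

lemma vabs_minus [simp]: "vabs (- x :: 'c::nonarch_field) = vabs x"
  by (metis add.inverse_inverse diff_0 dist_commute dist_vabs diff_0_right)

lemma vabs_minus_commute: "vabs (x - y :: 'c::nonarch_field) = vabs (y - x)"
  by (metis dist_commute dist_vabs)

lemma vabs_diff: "vabs (x - y :: 'c::nonarch_field) \<le> max (vabs x) (vabs y)"
  using vabs_add[of x "- y"] by simp

lemma vabs_power: "vabs (x ^ n :: 'c::nonarch_field) = vabs x ^ n"
  by (induction n) (auto simp: vabs_mult)

lemma vabs_inverse: "vabs (inverse x :: 'c::nonarch_field) = inverse (vabs x)"
proof (cases "x = 0")
  case False
  then have "vabs x * vabs (inverse x) = 1"
    by (simp flip: vabs_mult)
  then show ?thesis
    by (simp add: inverse_unique)
qed auto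

lemma vabs_divide: "vabs (x / y :: 'c::nonarch_field) = vabs x / vabs y"
  by (simp add: divide_inverse vabs_mult vabs_inverse)

lemma vabs_prod: "vabs (prod f A :: 'c::nonarch_field) = (\<Prod>i\<in>A. vabs (f i))"
  by (induction A rule: infinite_finite_induct) (auto simp: vabs_mult)

lemma vabs_sum_le:
  assumes "\<And>i. i \<in> A \<Longrightarrow> vabs (f i :: 'c::nonarch_field) \<le> B" and "B \<ge> 0"
  shows "vabs (sum f A) \<le> B"
  using assms
proof (induction A rule: infinite_finite_induct)
  case (insert x A)
  then show ?case
    using vabs_add[of "f x" "sum f A"] by fastforce
qed auto

text \<open>The isosceles principle: writing \<open>x = (x + y) - y\<close>, the maximum in the
  ultrametric bound cannot be \<open>vabs y\<close>.\<close>

lemma vabs_add_eq_left: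
  assumes "vabs y < vabs (x :: 'c::nonarch_field)"
  shows "vabs (x + y) = vabs x"
proof (rule antisym)
  show "vabs (x + y) \<le> vabs x"
    using vabs_add[of x y] assms by simp
  show "vabs x \<le> vabs (x + y)"
    using vabs_diff[of "x + y" y] assms by simp
qed

lemma vabs_of_nat_le_1: "vabs (of_nat n :: 'c::nonarch_field) \<le> 1"
proof (induction n)
  case (Suc n)
  then show ?case
    using vabs_add[of 1 "of_nat n :: 'c"] by simp
qed auto

text \<open>Integer coefficients, in particular those of a binomial expansion, therefore never enter
  an estimate.\<close>

lemma vabs_of_int_le_1: "vabs (of_int n :: 'c::nonarch_field) \<le> 1"
  by (cases n rule: int_cases2) (simp_all add: vabs_of_nat_le_1)

section \<open>Continuity of the field operations\<close>

lemma tendsto_vabs_iff: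
  "(f \<longlongrightarrow> (l :: 'c::nonarch_field)) F \<longleftrightarrow> (\<forall>e>0. eventually (\<lambda>x. vabs (f x - l) < e) F)"
  by (simp add: tendsto_iff dist_vabs)

lemma tendsto_vabs_diff_0_iff:
  "(f \<longlongrightarrow> (l :: 'c::nonarch_field)) F \<longleftrightarrow> ((\<lambda>x. vabs (f x - l)) \<longlongrightarrow> 0) F"
  by (subst tendsto_dist_iff) (simp add: dist_vabs)

text \<open>Continuity of addition and, below, of multiplication opens the general limit rules,
  \<open>has_sum\<close> and \<open>sums\<close> to a type that is not a real normed space.\<close>

instance nonarch_field \<subseteq> topological_ab_group_add
proof
  fix a b :: 'a
  show "((\<lambda>x. fst x + snd x) \<longlongrightarrow> a + b) (nhds a \<times>\<^sub>F nhds b)"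
    unfolding tendsto_vabs_iff
  proof (intro allI impI)
    fix e :: real
    assume e: "e > 0"
    have "eventually (\<lambda>x. vabs (fst x - a) < e) (nhds a \<times>\<^sub>F nhds b)"
      using filterlim_fst[of "nhds a" "nhds b"] e unfolding tendsto_vabs_iff by blast
    moreover have "eventually (\<lambda>x. vabs (snd x - b) < e) (nhds a \<times>\<^sub>F nhds b)"
      using filterlim_snd[of "nhds b" "nhds a"] e unfolding tendsto_vabs_iff by blast
    ultimately show "eventually (\<lambda>x. vabs (fst x + snd x - (a + b)) < e) (nhds a \<times>\<^sub>F nhds b)"
    proof eventually_elim
      case (elim x)
      have eq: "fst x + snd x - (a + b) = (fst x - a) + (snd x - b)"
        by simp
      show ?case
        unfolding eq using vabs_add[of "fst x - a" "snd x - b"] elim by linarith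
    qed
  qed
  show "(uminus \<longlongrightarrow> - a) (nhds a)"
    unfolding tendsto_vabs_iff
  proof (intro allI impI)
    fix e :: real
    assume e: "e > 0"
    have "eventually (\<lambda>x. vabs (x - a) < e) (nhds a)"
      using filterlim_ident[of "nhds a"] e unfolding tendsto_vabs_iff by blast
    then show "eventually (\<lambda>x. vabs (- x - - a) < e) (nhds a)"
      by eventually_elim (simp add: vabs_minus_commute)
  qed
qed

instance nonarch_field \<subseteq> topological_semigroup_mult
proof
  fix a b :: 'a
  show "((\<lambda>x. fst x * snd x) \<longlongrightarrow> a * b) (nhds a \<times>\<^sub>F nhds b)"
    unfolding tendsto_vabs_iff
  proof (intro allI impI)
    fix e :: real
    assume e: "e > 0"
    \<comment> \<open>Of the three products into which the difference is split,
      \<open>d \<le> 1\<close> controls the quadratic one and the quotient the two linear ones. The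
      summand 1 keeps the denominator positive and yields \<open>d \<le> e\<close>.\<close>
    define d where "d = min 1 (e / (1 + vabs a + vabs b))"
    have pos: "1 + vabs a + vabs b > 0"
      by (metis add_nonneg_nonneg add_pos_nonneg vabs_nonneg zero_less_one)
    have d: "d > 0" "d \<le> 1"
      using e pos by (auto simp: d_def)
    have "d * (1 + vabs a + vabs b) \<le> e / (1 + vabs a + vabs b) * (1 + vabs a + vabs b)"
      using pos by (intro mult_right_mono) (auto simp: d_def)
    then have d3: "d * (1 + vabs a + vabs b) \<le> e"
      using pos by simp
    have da: "d * vabs a \<le> e" and db: "d * vabs b \<le> e" and d1: "d \<le> e"
      using d d3 mult_nonneg_nonneg[of d "vabs a"] mult_nonneg_nonneg[of d "vabs b"]
        vabs_nonneg[of a] vabs_nonneg[of b] unfolding distrib_left by linarith+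
    have "eventually (\<lambda>x. vabs (fst x - a) < d) (nhds a \<times>\<^sub>F nhds b)"
      using filterlim_fst[of "nhds a" "nhds b"] d unfolding tendsto_vabs_iff by blast
    moreover have "eventually (\<lambda>x. vabs (snd x - b) < d) (nhds a \<times>\<^sub>F nhds b)"
      using filterlim_snd[of "nhds b" "nhds a"] d unfolding tendsto_vabs_iff by blast
    ultimately show "eventually (\<lambda>x. vabs (fst x * snd x - a * b) < e) (nhds a \<times>\<^sub>F nhds b)"
    proof eventually_elim
      case (elim x)
      have eq: "fst x * snd x - a * b
          = (fst x - a) * (snd x - b) + ((fst x - a) * b + a * (snd x - b))"
        by (simp add: algebra_simps)
      have 1: "vabs ((fst x - a) * (snd x - b)) < e"
      proof -
        have "vabs (fst x - a) * vabs (snd x - b) \<le> vabs (fst x - a) * 1"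
          using elim d by (intro mult_left_mono) auto
        then show ?thesis
          using elim d1 by (simp add: vabs_mult)
      qed
      have 2: "vabs ((fst x - a) * b) < e"
      proof (cases "b = 0")
        case False
        then have "vabs (fst x - a) * vabs b < d * vabs b"
          using elim by (intro mult_strict_right_mono) auto
        then show ?thesis
          using db by (simp add: vabs_mult)
      qed (use e in auto)
      have 3: "vabs (a * (snd x - b)) < e"
      proof (cases "a = 0")
        case False
        then have "vabs (snd x - b) * vabs a < d * vabs a"
          using elim by (intro mult_strict_right_mono) auto
        then show ?thesis
          using da by (simp add: vabs_mult mult.commute)
      qed (use e in auto)
      show ?case
        unfolding eq
        using vabs_add[of "(fst x - a) * (snd x - b)" "(fst x - a) * b + a * (snd x - b)"]
          vabs_add[of "(fst x - a) * b" "a * (snd x - b)"] 1 2 3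
        by linarith
    qed
  qed
qed

instance nonarch_field \<subseteq> topological_comm_monoid_mult ..

lemma tendsto_vabs:
  assumes "(f \<longlongrightarrow> (l :: 'c::nonarch_field)) F"
  shows "((\<lambda>x. vabs (f x)) \<longlongrightarrow> vabs l) F"
  unfolding vabs_eq_dist by (intro tendsto_dist assms tendsto_const)

lemma tendsto_nonarch_inverse:
  assumes "(f \<longlongrightarrow> (l :: 'c::nonarch_field)) F" and "l \<noteq> 0"
  shows "((\<lambda>x. inverse (f x)) \<longlongrightarrow> inverse l) F"
proof -
  have "((\<lambda>x. vabs (f x - l) / (vabs (f x) * vabs l)) \<longlongrightarrow> 0 / (vabs l * vabs l)) F"
    using assms by (intro tendsto_intros tendsto_vabs) (auto simp: tendsto_vabs_diff_0_iff[symmetric])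
  then have lim: "((\<lambda>x. vabs (f x - l) / (vabs (f x) * vabs l)) \<longlongrightarrow> 0) F"
    by simp
  have "eventually (\<lambda>x. f x \<noteq> 0) F"
    using assms tendsto_imp_eventually_ne by blast
  then have "eventually (\<lambda>x. vabs (f x - l) / (vabs (f x) * vabs l) = vabs (inverse (f x) - inverse l)) F"
  proof eventually_elim
    case (elim x)
    have "inverse (f x) - inverse l = (l - f x) / (f x * l)"
      using elim assms by (simp add: field_simps)
    then show ?case
      by (simp add: vabs_divide vabs_mult vabs_minus_commute)
  qed
  with lim have "((\<lambda>x. vabs (inverse (f x) - inverse l)) \<longlongrightarrow> 0) F"
    by (rule Lim_transform_eventually)
  then show ?thesis
    by (simp add: tendsto_vabs_diff_0_iff)
qed

lemma tendsto_nonarch_divide: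
  assumes "(f \<longlongrightarrow> (l :: 'c::nonarch_field)) F" and "(g \<longlongrightarrow> m) F" and "m \<noteq> 0"
  shows "((\<lambda>x. f x / g x) \<longlongrightarrow> l / m) F"
  unfolding divide_inverse by (intro tendsto_mult tendsto_nonarch_inverse assms)

section \<open>Completeness, unconditional sums and exhaustions\<close>

lemma vabs_lim_le:
  assumes "(f \<longlongrightarrow> (l :: 'c::nonarch_field)) F" and "F \<noteq> bot" and "eventually (\<lambda>x. vabs (f x) \<le> B) F"
  shows "vabs l \<le> B"
  using tendsto_upperbound[OF tendsto_vabs[OF assms(1)]] assms by blast

text \<open>One reference index suffices: two terms within \<open>e\<close> of \<open>f M\<close>
  are within \<open>e\<close> of each other, as the ultrametric inequality costs no factor 2.
  Halving \<open>e\<close> serves only to pass from \<open>\<le>\<close> to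
  \<open><\<close>.\<close>

lemma nonarch_Cauchy_convergent:
  fixes f :: "nat \<Rightarrow> 'c::{nonarch_field,complete_space}"
  assumes "\<And>e. e > 0 \<Longrightarrow> \<exists>M. \<forall>m\<ge>M. vabs (f m - f M) \<le> e"
  shows "convergent f"
proof -
  have "Cauchy f"
  proof (rule metric_CauchyI)
    fix e :: real
    assume "e > 0"
    then obtain M where M: "\<forall>m\<ge>M. vabs (f m - f M) \<le> e / 2"
      using assms[of "e / 2"] by auto
    have "vabs (f m - f n) < e" if "m \<ge> M" "n \<ge> M" for m n
    proof -
      have eq: "f m - f n = (f m - f M) - (f n - f M)"
        by simp
      have "vabs (f m - f M) \<le> e / 2" "vabs (f n - f M) \<le> e / 2"
        using M that by auto
      then show ?thesis
        unfolding eq using vabs_diff[of "f m - f M" "f n - f M"] \<open>e > 0\<close> by linarith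
    qed
    then show "\<exists>M. \<forall>m\<ge>M. \<forall>n\<ge>M. dist (f m) (f n) < e"
      by (auto simp: dist_vabs)
  qed
  then show ?thesis
    by (rule Cauchy_convergent)
qed

text \<open>The same criterion for the net of finite subsets. Since \<open>f\<close> is any function
  of the finite set, it covers sums as well as the infinite product in
  \<open>lattice_exp\<close>.\<close>

lemma nonarch_Cauchy_finite_subsets:
  fixes f :: "'i set \<Rightarrow> 'c::{nonarch_field,complete_space}"
  assumes "\<And>e. e > 0 \<Longrightarrow> \<exists>X. finite X \<and> X \<subseteq> A \<and>
             (\<forall>Y. finite Y \<and> X \<subseteq> Y \<and> Y \<subseteq> A \<longrightarrow> vabs (f Y - f X) \<le> e)"
  shows "\<exists>l. (f \<longlongrightarrow> l) (finite_subsets_at_top A)"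
proof -
  let ?F = "filtermap f (finite_subsets_at_top A)"
  have "cauchy_filter ?F"
    unfolding cauchy_filter_metric_filtermap
  proof (intro allI impI)
    fix e :: real
    assume e: "e > 0"
    then obtain X where X: "finite X" "X \<subseteq> A"
      and XY: "\<forall>Y. finite Y \<and> X \<subseteq> Y \<and> Y \<subseteq> A \<longrightarrow> vabs (f Y - f X) \<le> e / 2"
      using assms[of "e / 2"] by auto
    define P where "P Y \<longleftrightarrow> finite Y \<and> X \<subseteq> Y \<and> Y \<subseteq> A" for Y
    have "eventually P (finite_subsets_at_top A)"
      unfolding eventually_finite_subsets_at_top P_def using X by blast
    moreover have "dist (f Y) (f Z) < e" if "P Y" "P Z" for Y Z
    proof -
      have eq: "f Y - f Z = (f Y - f X) - (f Z - f X)"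
        by simp
      have "vabs (f Y - f X) \<le> e / 2" "vabs (f Z - f X) \<le> e / 2"
        using XY that by (auto simp: P_def)
      then show ?thesis
        unfolding dist_vabs eq using vabs_diff[of "f Y - f X" "f Z - f X"] e by linarith
    qed
    ultimately show "\<exists>P. eventually P (finite_subsets_at_top A) \<and>
        (\<forall>Y Z. P Y \<and> P Z \<longrightarrow> dist (f Y) (f Z) < e)"
      by blast
  qed
  moreover have "complete (UNIV :: 'c set)"
    by (simp add: complete_UNIV)
  ultimately have "\<exists>l. ?F \<le> nhds l"
    by (rule cauchy_filter_complete_converges) (auto simp: filtermap_bot_iff)
  then show ?thesis
    by (simp add: filterlim_def)
qed

text \<open>In a complete ultrametric field terms tending to 0 already give unconditional
  convergence: what is added to the sum of the large terms is bounded by its largest term.\<close>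

lemma nonarch_summable_on:
  fixes f :: "'i \<Rightarrow> 'c::{nonarch_field,complete_space}"
  assumes "\<And>e. e > 0 \<Longrightarrow> finite {i \<in> A. vabs (f i) > e}"
  shows "f summable_on A"
  unfolding summable_on_def has_sum_def
proof (rule nonarch_Cauchy_finite_subsets)
  fix e :: real
  assume e: "e > 0"
  let ?X = "{i \<in> A. vabs (f i) > e}"
  have "vabs (sum f Y - sum f ?X) \<le> e" if "finite Y" "?X \<subseteq> Y" "Y \<subseteq> A" for Y
  proof -
    have "sum f Y - sum f ?X = sum f (Y - ?X)"
      using that assms[OF e] by (simp add: sum_diff)
    also have "vabs \<dots> \<le> e"
      using that e by (intro vabs_sum_le) force+
    finally show ?thesis .
  qed
  then show "\<exists>X. finite X \<and> X \<subseteq> A \<and>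
      (\<forall>Y. finite Y \<and> X \<subseteq> Y \<and> Y \<subseteq> A \<longrightarrow> vabs (sum f Y - sum f X) \<le> e)"
    using assms[OF e] by (intro exI[of _ ?X]) auto
qed

text \<open>Turns an unconditional sum or product into a limit along one convenient exhaustion, such
  as the polynomials of bounded degree.\<close>

lemma filterlim_exhaustion:
  assumes "\<And>D. finite (W D)" and "\<And>D. W D \<subseteq> A"
    and "\<And>x. x \<in> A \<Longrightarrow> eventually (\<lambda>D. x \<in> W D) F"
  shows "filterlim W (finite_subsets_at_top A) F"
  unfolding filterlim_finite_subsets_at_top
proof (intro allI impI)
  fix X
  assume X: "finite X \<and> X \<subseteq> A"
  then have "eventually (\<lambda>D. \<forall>x\<in>X. x \<in> W D) F"
    using assms(3) by (intro eventually_ball_finite) auto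
  then show "eventually (\<lambda>D. finite (W D) \<and> X \<subseteq> W D \<and> W D \<subseteq> A) F"
    using assms(1,2) by (auto elim!: eventually_mono)
qed

text \<open>The coefficient of \<open>u ^ i\<close> in \<open>(1 + u) ^ (-n)\<close>, built by
  repeated convolution with the geometric series of \<open>1 / (1 + u)\<close>. Being an integer, it
  has absolute value at most 1 in every ultrametric field.\<close>

primrec neg_binom :: "nat \<Rightarrow> nat \<Rightarrow> int" where
  "neg_binom 0 i = (if i = 0 then 1 else 0)"
| "neg_binom (Suc n) i = (\<Sum>l\<le>i. (-1) ^ (i - l) * neg_binom n l)"

text \<open>The coefficient form of
  \<open>(1 + u) * (1 + u) ^ (-(n + 1)) = (1 + u) ^ (-n)\<close>.\<close>

lemma neg_binom_Suc_Suc: "neg_binom (Suc n) (Suc i) + neg_binom (Suc n) i = neg_binom n (Suc i)"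
proof -
  have "(\<Sum>l\<le>i. (-1) ^ (Suc i - l) * neg_binom n l) = - (\<Sum>l\<le>i. (-1) ^ (i - l) * neg_binom n l)"
    unfolding sum_negf[symmetric] by (intro sum.cong) (auto simp: Suc_diff_le)
  then show ?thesis
    by simp
qed

text \<open>Multiplication by \<open>1 + u\<close>, which has absolute value 1, turns the truncation
  for \<open>Suc n\<close> into the one for \<open>n\<close> up to one boundary term of degree
  \<open>Suc L\<close>; so the error bound survives induction on \<open>n\<close>.\<close>

lemma neg_binom_expansion:
  fixes u :: "'c::nonarch_field"
  assumes "vabs u < 1"
  shows "vabs ((\<Sum>i\<le>L. of_int (neg_binom n i) * u ^ i) - 1 / (1 + u) ^ n) \<le> vabs u ^ Suc L"
proof (induction n)
  case 0
  have "(\<Sum>i\<le>L. of_int (neg_binom 0 i) * u ^ i) = (\<Sum>i\<in>{0}. of_int (neg_binom 0 i) * u ^ i)"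
    by (intro sum.mono_neutral_right) auto
  then show ?case
    by simp
next
  case (Suc n)
  let ?P = "\<lambda>n L. \<Sum>i\<le>L. of_int (neg_binom n i) * u ^ i :: 'c"
  have u: "vabs (1 + u) = 1"
    using vabs_add_eq_left[of u 1] assms by simp
  then have u0: "1 + u \<noteq> 0"
    by fastforce
  have step: "(1 + u) * ?P (Suc n) M = ?P n M + of_int (neg_binom (Suc n) M) * u ^ Suc M" for M
  proof (induction M)
    case (Suc M)
    have "(1 + u) * ?P (Suc n) (Suc M)
        = ?P n M + of_int (neg_binom (Suc n) M) * u ^ Suc M
          + (1 + u) * (of_int (neg_binom (Suc n) (Suc M)) * u ^ Suc M)"
      using Suc.IH by (simp add: distrib_left del: neg_binom.simps)
    also have "\<dots> = ?P n M + of_int (neg_binom (Suc n) (Suc M) + neg_binom (Suc n) M) * u ^ Suc M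
          + of_int (neg_binom (Suc n) (Suc M)) * u ^ Suc (Suc M)"
      by (simp add: algebra_simps del: neg_binom.simps)
    finally show ?case
      by (simp add: neg_binom_Suc_Suc del: neg_binom.simps)
  qed (simp add: algebra_simps)
  have "?P (Suc n) L - 1 / (1 + u) ^ Suc n
      = ((1 + u) * ?P (Suc n) L - 1 / (1 + u) ^ n) / (1 + u)"
    using u0 by (simp add: diff_divide_distrib mult.commute del: neg_binom.simps)
  also have "vabs \<dots> = vabs ((?P n L - 1 / (1 + u) ^ n) + of_int (neg_binom (Suc n) L) * u ^ Suc L)"
    unfolding step by (simp add: vabs_divide u algebra_simps del: neg_binom.simps)
  also have "\<dots> \<le> vabs u ^ Suc L"
  proof -
    have "vabs (of_int (neg_binom (Suc n) L) * u ^ Suc L) \<le> 1 * vabs u ^ Suc L"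
      unfolding vabs_mult vabs_power by (intro mult_right_mono vabs_of_int_le_1) auto
    then show ?thesis
      using vabs_add[of "?P n L - 1 / (1 + u) ^ n" "of_int (neg_binom (Suc n) L) * u ^ Suc L"] Suc.IH
      by linarith
  qed
  finally show ?case .
qed

section \<open>Finite additive subgroups of a field\<close>

definition fin_subgroup :: "'c::ab_group_add set \<Rightarrow> bool" where
  "fin_subgroup W \<longleftrightarrow> finite W \<and> 0 \<in> W \<and> (\<forall>x\<in>W. \<forall>y\<in>W. x - y \<in> W)"

lemma fin_subgroupD:
  assumes "fin_subgroup W"
  shows "finite W" "0 \<in> W" "x \<in> W \<Longrightarrow> y \<in> W \<Longrightarrow> x - y \<in> W" "x \<in> W \<Longrightarrow> - x \<in> W"
    "x \<in> W \<Longrightarrow> y \<in> W \<Longrightarrow> x + y \<in> W"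
proof -
  show *: "finite W" "0 \<in> W" "x \<in> W \<Longrightarrow> y \<in> W \<Longrightarrow> x - y \<in> W" for x y
    using assms by (auto simp: fin_subgroup_def)
  show **: "x \<in> W \<Longrightarrow> - x \<in> W" for x
    using *(2) *(3)[of 0 x] by simp
  show "x \<in> W \<Longrightarrow> y \<in> W \<Longrightarrow> x + y \<in> W"
    using *(3)[of x "- y"] **[of y] by simp
qed

lemma fin_subgroup_card_pos: "fin_subgroup W \<Longrightarrow> card W > 0"
  by (metis card_gt_0_iff empty_iff fin_subgroupD(1,2))

lemma degree_prod_monic_linear:
  "degree (\<Prod>a\<in>A. [:f a, 1 :: 'c::field:]) = card A"
  by (subst degree_prod_eq_sum_degree) auto

lemma coeff_prod_monic_linear:
  "coeff (\<Prod>a\<in>A. [:f a, 1 :: 'c::field:]) (card A) = 1"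
  using lead_coeff_prod[of "\<lambda>a. [:f a, 1 :: 'c:]" A] by (simp add: degree_prod_monic_linear)

text \<open>The basis polynomials of Lagrange interpolation on a group all have the same
  normalising factor.\<close>

lemma subgroup_lagrange:
  fixes W :: "'c::field set"
  assumes W: "fin_subgroup W" and "degree P < card W"
  shows "smult (\<Prod>u\<in>W-{0}. - u) P = (\<Sum>w\<in>W. smult (poly P w) (\<Prod>w'\<in>W-{w}. [:- w', 1:]))"
proof (rule poly_eqI_degree)
  note [simp] = fin_subgroupD(1)[OF W]
  fix x
  assume x: "x \<in> W"
  have "(\<Prod>w'\<in>W-{x}. x - w') = (\<Prod>u\<in>W-{0}. - u)"
    by (rule prod.reindex_bij_witness[of _ "\<lambda>u. x + u" "\<lambda>w'. w' - x"])
      (use x in \<open>auto intro: fin_subgroupD[OF W]\<close>)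
  moreover have "(\<Sum>w\<in>W. poly P w * (\<Prod>w'\<in>W-{w}. x - w'))
      = (\<Sum>w\<in>{x}. poly P w * (\<Prod>w'\<in>W-{w}. x - w'))"
    using x by (intro sum.mono_neutral_right) auto
  ultimately show "poly (smult (\<Prod>u\<in>W-{0}. - u) P) x
      = poly (\<Sum>w\<in>W. smult (poly P w) (\<Prod>w'\<in>W-{w}. [:- w', 1:])) x"
    by (simp add: poly_sum poly_prod)
next
  show "degree (smult (\<Prod>u\<in>W-{0}. - u) P) < card W"
    using assms(2) degree_smult_le[of _ P] by (rule le_less_trans[rotated])
next
  have "degree (\<Sum>w\<in>W. smult (poly P w) (\<Prod>w'\<in>W-{w}. [:- w', 1:])) \<le> card W - 1"
  proof (rule degree_sum_le)
    fix w
    assume "w \<in> W"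
    then show "degree (smult (poly P w) (\<Prod>w'\<in>W-{w}. [:- w', 1:])) \<le> card W - 1"
      using degree_smult_le[of "poly P w" "\<Prod>w'\<in>W-{w}. [:- w', 1:]"] fin_subgroupD(1)[OF W]
      by (simp add: degree_prod_monic_linear)
  qed (use fin_subgroupD(1)[OF W] in auto)
  then show "degree (\<Sum>w\<in>W. smult (poly P w) (\<Prod>w'\<in>W-{w}. [:- w', 1:])) < card W"
    using fin_subgroup_card_pos[OF W] by linarith
qed

text \<open>Compare coefficients of degree \<open>card W - 1\<close> in the interpolation formula:
  every basis polynomial is monic of that degree, while the left-hand side has smaller
  degree.\<close>

lemma subgroup_sum_poly_eq_0:
  fixes W :: "'c::field set"
  assumes W: "fin_subgroup W" and deg: "degree P + 1 < card W"
  shows "(\<Sum>w\<in>W. poly P w) = 0"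
proof -
  have c: "coeff (\<Prod>w'\<in>W-{w}. [:- w', 1:]) (card W - 1) = 1" if "w \<in> W" for w
    using that coeff_prod_monic_linear[of uminus "W - {w}"] fin_subgroupD(1)[OF W] by simp
  have "0 = coeff (smult (\<Prod>u\<in>W-{0}. - u) P) (card W - 1)"
    using deg by (simp add: coeff_eq_0)
  also have "\<dots> = (\<Sum>w\<in>W. poly P w * coeff (\<Prod>w'\<in>W-{w}. [:- w', 1:]) (card W - 1))"
    using deg by (subst subgroup_lagrange[OF W]) (auto simp: coeff_sum)
  also have "\<dots> = (\<Sum>w\<in>W. poly P w)"
    using c by (intro sum.cong) auto
  finally show ?thesis
    by simp
qed

lemma subgroup_sum_power_eq_0:
  fixes W :: "'c::field set"
  assumes W: "fin_subgroup W" and deg: "i + 1 < card W"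
  shows "(\<Sum>w\<in>W. (z + w) ^ i) = 0"
proof -
  have "degree ([:z, 1:] ^ i) = i"
    by (simp add: degree_power_eq)
  then show ?thesis
    using subgroup_sum_poly_eq_0[OF W, of "[:z, 1:] ^ i"] deg by (simp add: poly_power)
qed

text \<open>The exponential function of the finite lattice \<open>W\<close>. It is normalised to
  have linear coefficient 1, unlike the monic product of the \<open>z - w\<close>, so that it
  converges when \<open>W\<close> exhausts an infinite lattice.\<close>

definition fin_exp :: "'c::field set \<Rightarrow> 'c \<Rightarrow> 'c" where
  "fin_exp W z = z * (\<Prod>w\<in>W-{0}. 1 - z / w)"

definition fin_exp_poly :: "'c::field set \<Rightarrow> 'c poly" where
  "fin_exp_poly W = [:0, 1:] * (\<Prod>w\<in>W-{0}. [:1, - 1 / w:])"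

lemma poly_fin_exp_poly: "poly (fin_exp_poly W) z = fin_exp W z"
  by (simp add: fin_exp_poly_def fin_exp_def poly_prod)

lemma coeff_fin_exp_poly_0: "coeff (fin_exp_poly W) 0 = 0"
  by (simp add: fin_exp_poly_def mult_pCons_left)

lemma degree_fin_exp_poly:
  assumes "fin_subgroup W"
  shows "degree (fin_exp_poly W) = card W"
proof -
  have "degree (\<Prod>w\<in>W-{0}. [:1, - 1 / w:]) = card W - 1"
    using fin_subgroupD(1,2)[OF assms] by (subst degree_prod_eq_sum_degree) auto
  moreover have "(\<Prod>w\<in>W-{0}. [:1, - 1 / w:]) \<noteq> 0"
    using fin_subgroupD(1)[OF assms] by simp
  ultimately show ?thesis
    using fin_subgroup_card_pos[OF assms]
    unfolding fin_exp_poly_def by (subst degree_mult_eq) auto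
qed

lemma fin_exp_conv_prod:
  fixes W :: "'c::field set"
  assumes W: "fin_subgroup W"
  shows "fin_exp W z * (\<Prod>u\<in>W-{0}. - u) = (\<Prod>w\<in>W. z - w)"
proof -
  have "(\<Prod>w\<in>W-{0}. 1 - z / w) * (\<Prod>u\<in>W-{0}. - u) = (\<Prod>w\<in>W-{0}. z - w)"
    unfolding prod.distrib[symmetric] by (intro prod.cong) (auto simp: field_simps)
  then show ?thesis
    using prod.remove[OF fin_subgroupD(1,2)[OF W], of "\<lambda>w. z - w"]
    by (simp add: fin_exp_def mult.assoc)
qed

lemma subgroup_const_nonzero:
  assumes "fin_subgroup (W :: 'c::field set)"
  shows "(\<Prod>u\<in>W-{0}. - u) \<noteq> 0"
  using fin_subgroupD(1)[OF assms] by simp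

text \<open>The partial fraction decomposition of \<open>1 / fin_exp W z\<close>: interpolate the
  constant polynomial 1 and divide by the product of all \<open>z - w\<close>.\<close>

lemma sum_inverse_eq_inverse_fin_exp:
  fixes W :: "'c::field set"
  assumes W: "fin_subgroup W" and z: "\<And>w. w \<in> W \<Longrightarrow> z + w \<noteq> 0"
  shows "(\<Sum>w\<in>W. 1 / (z + w)) = 1 / fin_exp W z" and "fin_exp W z \<noteq> 0"
proof -
  let ?c = "\<Prod>u\<in>W-{0}. - u"
  have z': "z - w \<noteq> 0" if "w \<in> W" for w
    using z[OF fin_subgroupD(4)[OF W that]] by simp
  have nz: "(\<Prod>w\<in>W. z - w) \<noteq> 0"
    using z' fin_subgroupD(1)[OF W] by simp
  then show "fin_exp W z \<noteq> 0"
    unfolding fin_exp_conv_prod[OF W, symmetric] by auto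
  have "poly (smult ?c 1) z = (\<Sum>w\<in>W. \<Prod>w'\<in>W-{w}. z - w')"
    using subgroup_lagrange[OF W, of 1] fin_subgroup_card_pos[OF W] by (simp add: poly_sum poly_prod)
  then have "?c = (\<Sum>w\<in>W. \<Prod>w'\<in>W-{w}. z - w')"
    by simp
  also have "\<dots> = (\<Sum>w\<in>W. (\<Prod>w\<in>W. z - w) * (1 / (z - w)))"
  proof (intro sum.cong refl)
    fix w
    assume "w \<in> W"
    then show "(\<Prod>w'\<in>W-{w}. z - w') = (\<Prod>w\<in>W. z - w) * (1 / (z - w))"
      using prod.remove[OF fin_subgroupD(1)[OF W], of w "\<lambda>w. z - w"] z'[of w] by simp
  qed
  also have "\<dots> = (\<Prod>w\<in>W. z - w) * (\<Sum>w\<in>W. 1 / (z - w))"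
    by (simp add: sum_distrib_left)
  also have "(\<Sum>w\<in>W. 1 / (z - w)) = (\<Sum>w\<in>W. 1 / (z + w))"
    by (rule sum.reindex_bij_witness[of _ uminus uminus]) (auto intro: fin_subgroupD[OF W])
  finally have eq: "?c = fin_exp W z * ?c * (\<Sum>w\<in>W. 1 / (z + w))"
    unfolding fin_exp_conv_prod[OF W] .
  have cancel: "s = 1 / e" if "c = e * c * s" "c \<noteq> 0" "e \<noteq> 0" for c e s :: 'c
  proof -
    have "c * (e * s) = e * c * s"
      by (simp only: mult_ac)
    also have "\<dots> = c * 1"
      using that(1)[symmetric] by simp
    finally show ?thesis
      using that(2,3) by (simp add: field_simps)
  qed
  show "(\<Sum>w\<in>W. 1 / (z + w)) = 1 / fin_exp W z"
    by (rule cancel[OF eq subgroup_const_nonzero[OF W] \<open>fin_exp W z \<noteq> 0\<close>])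
qed

lemma fin_exp_eq_0:
  assumes "fin_subgroup W" and "w \<in> W"
  shows "fin_exp W w = 0"
  using fin_subgroupD(1)[OF assms(1)] assms(2) by (auto simp: fin_exp_def)

text \<open>Up to the factor \<open>?c\<close> both sides are monic polynomials in \<open>z\<close>
  of degree \<open>card W\<close>, so it suffices to compare them on \<open>W\<close>. There
  \<open>fin_exp W z\<close> vanishes, and translation by an element of \<open>W\<close> permutes
  the factors of the other product.\<close>

lemma fin_exp_add:
  fixes W :: "'c::field set"
  assumes W: "fin_subgroup W"
  shows "fin_exp W (z + x) = fin_exp W z + fin_exp W x"
proof -
  let ?c = "\<Prod>u\<in>W-{0}. - u"
  define P where "P = (\<Prod>w\<in>W. [:x - w, 1:])"
  define Q where "Q = (\<Prod>w\<in>W. [:- w, 1:])"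
  have pos: "card W > 0"
    by (rule fin_subgroup_card_pos[OF W])
  have polyQ: "poly Q y = fin_exp W y * ?c" for y
    unfolding fin_exp_conv_prod[OF W] by (simp add: Q_def poly_prod)
  have polyP: "poly P y = fin_exp W (y + x) * ?c" for y
    unfolding fin_exp_conv_prod[OF W] by (simp add: P_def poly_prod algebra_simps)
  have "P = Q + [:fin_exp W x * ?c:]"
  proof (rule poly_eqI_degree_lead_coeff[where n = "card W" and A = W])
    show "coeff P (card W) = coeff (Q + [:fin_exp W x * ?c:]) (card W)"
      using pos unfolding P_def Q_def by (simp add: coeff_prod_monic_linear coeff_pCons split: nat.splits)
    show "degree P \<le> card W"
      by (simp add: P_def degree_prod_monic_linear)
    show "degree (Q + [:fin_exp W x * ?c:]) \<le> card W"
      by (rule degree_add_le) (simp_all add: Q_def degree_prod_monic_linear)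
  next
    fix w
    assume w: "w \<in> W"
    have "fin_exp W (w + x) * ?c = (\<Prod>w'\<in>W. x - w')"
      unfolding fin_exp_conv_prod[OF W]
      by (rule prod.reindex_bij_witness[of _ "\<lambda>w'. w' + w" "\<lambda>w'. w' - w"])
        (use w in \<open>auto intro: fin_subgroupD[OF W] simp: algebra_simps\<close>)
    then show "poly P w = poly (Q + [:fin_exp W x * ?c:]) w"
      by (simp add: polyP polyQ fin_exp_eq_0[OF W w] fin_exp_conv_prod[OF W])
  qed auto
  then have "poly P z = poly (Q + [:fin_exp W x * ?c:]) z"
    by simp
  then have "fin_exp W (z + x) * ?c = (fin_exp W z + fin_exp W x) * ?c"
    by (simp add: polyP polyQ distrib_right)
  then show ?thesis
    using subgroup_const_nonzero[OF W] by simp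
qed

text \<open>Newton's identities for the numbers \<open>1 / (z + w)\<close>: multiply
  \<open>e\<^sub>W (z + w) = e\<^sub>W z\<close> by \<open>(z + w)\<^sup>-\<^sup>n\<close> and sum over \<open>w\<close>; the nonnegative powers drop out.\<close>

lemma sum_inverse_power_recursion:
  fixes W :: "'c::field set"
  assumes W: "fin_subgroup W" and z: "\<And>w. w \<in> W \<Longrightarrow> z + w \<noteq> 0" and n: "n \<ge> 2"
  shows "(\<Sum>w\<in>W. 1 / (z + w) ^ n)
    = 1 / fin_exp W z * (\<Sum>i=1..<n. coeff (fin_exp_poly W) i * (\<Sum>w\<in>W. 1 / (z + w) ^ (n - i)))"
proof -
  let ?M = "card W + n" and ?c = "coeff (fin_exp_poly W)"
  let ?S = "\<lambda>i. \<Sum>w\<in>W. (z + w) ^ i / (z + w) ^ n"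
  have e: "fin_exp W z = (\<Sum>i\<le>?M. ?c i * (z + w) ^ i)" if "w \<in> W" for w
  proof -
    have "fin_exp W z = poly (fin_exp_poly W) (z + w)"
      using fin_exp_add[OF W, of z w] fin_exp_eq_0[OF W that] by (simp add: poly_fin_exp_poly)
    also have "\<dots> = (\<Sum>i\<le>?M. ?c i * (z + w) ^ i)"
      unfolding poly_altdef degree_fin_exp_poly[OF W]
      by (intro sum.mono_neutral_left) (auto simp: coeff_eq_0 degree_fin_exp_poly[OF W])
    finally show ?thesis .
  qed
  have "fin_exp W z * (\<Sum>w\<in>W. 1 / (z + w) ^ n) = (\<Sum>w\<in>W. (\<Sum>i\<le>?M. ?c i * (z + w) ^ i) / (z + w) ^ n)"
    unfolding sum_distrib_left by (intro sum.cong) (simp_all add: e[symmetric])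
  also have "\<dots> = (\<Sum>i\<le>?M. ?c i * ?S i)"
    unfolding sum_divide_distrib sum_distrib_left by (subst sum.swap) simp
  also have "\<dots> = (\<Sum>i=1..<n. ?c i * ?S i)"
  proof (intro sum.mono_neutral_right ballI)
    fix i
    assume i: "i \<in> {..?M} - {1..<n}"
    show "?c i * ?S i = 0"
    proof (cases "i = 0 \<or> i > card W")
      case True
      then show ?thesis
        by (auto simp: coeff_fin_exp_poly_0 coeff_eq_0 degree_fin_exp_poly[OF W])
    next
      case False
      with i have i': "i \<ge> n" "i \<le> card W"
        by auto
      have "?S i = (\<Sum>w\<in>W. (z + w) ^ (i - n))"
        using z i' by (intro sum.cong) (auto simp: power_diff)
      \<comment> \<open>Here \<open>n \<ge> 2\<close> matters: it excludes the exponent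
        \<open>card W - 1\<close>, the first for which the power sum need not vanish.\<close>
      also have "\<dots> = 0"
        using i' n by (intro subgroup_sum_power_eq_0[OF W]) auto
      finally show ?thesis
        by simp
    qed
  qed auto
  also have "\<dots> = (\<Sum>i=1..<n. ?c i * (\<Sum>w\<in>W. 1 / (z + w) ^ (n - i)))"
  proof (intro sum.cong refl arg_cong2[where f = "(*)"])
    fix i w
    assume "i \<in> {1..<n}" and "w \<in> W"
    then show "(z + w) ^ i / (z + w) ^ n = 1 / (z + w) ^ (n - i)"
      using z[of w] by (simp add: power_diff)
  qed
  finally show ?thesis
    using sum_inverse_eq_inverse_fin_exp(2)[OF W z] by (simp add: field_simps)
qed

section \<open>Polynomials and Laurent series inside \<open>\<complex>\<^sub>\<infinity>\<close>\<close>

definition below :: "nat \<Rightarrow> 'a::{finite,field} poly set" where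
  "below D = {a. a = 0 \<or> degree a < D}"

lemma zero_in_below [simp]: "0 \<in> below D"
  by (simp add: below_def)

lemma below_mono: "D \<le> E \<Longrightarrow> below D \<subseteq> below E"
  by (auto simp: below_def)

lemma below_add: "a \<in> below D \<Longrightarrow> b \<in> below D \<Longrightarrow> a + b \<in> below D"
  unfolding below_def using degree_add_less[of a D b] by auto

lemma below_diff: "a \<in> below D \<Longrightarrow> b \<in> below D \<Longrightarrow> a - b \<in> below D"
  unfolding below_def using degree_diff_less[of a D b] by auto

lemma below_smult: "a \<in> below D \<Longrightarrow> smult c a \<in> below D"
  unfolding below_def using degree_smult_le[of c a] by auto

lemma below_mult: "a \<in> below D \<Longrightarrow> b \<in> below (Suc E) \<Longrightarrow> a * b \<in> below (D + E)"
  unfolding below_def using degree_mult_le[of a b] by auto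

lemma below_Suc_degree: "a \<in> below (Suc (degree a))"
  by (simp add: below_def)

lemma below_Suc: "below (Suc D) = (\<lambda>(c, p). pCons c p) ` (UNIV \<times> below D)"
proof (intro equalityI subsetI)
  fix a :: "'a poly"
  assume a: "a \<in> below (Suc D)"
  obtain c p where "a = pCons c p"
    by (cases a)
  with a show "a \<in> (\<lambda>(c, p). pCons c p) ` (UNIV \<times> below D)"
    by (auto simp: below_def image_iff split: if_splits)
qed (auto simp: below_def degree_pCons_eq_if split: if_splits)

lemma finite_below [simp]: "finite (below D)"
proof (induction D)
  case 0
  then show ?case
    by (simp add: below_def)
next
  case (Suc D)
  then show ?case
    unfolding below_Suc by (intro finite_imageI finite_cartesian_product) auto
qed

lemma card_below: "card (below D :: 'a::{finite,field} poly set) = CARD('a) ^ D"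
proof (induction D)
  case 0
  then show ?case
    by (simp add: below_def)
next
  case (Suc D)
  have "inj_on (\<lambda>(c, p). pCons c p) (UNIV \<times> below D)"
    by (auto simp: inj_on_def)
  then show ?case
    unfolding below_Suc by (subst card_image) (simp_all add: card_cartesian_product Suc)
qed

lemma eventually_in_below: "eventually (\<lambda>D. a \<in> below D) sequentially"
  unfolding eventually_sequentially
  by (rule exI[of _ "Suc (degree a)"]) (use below_mono below_Suc_degree in blast)

section \<open>Characteristic and power identities of the finite field\<close>

lemma card_finite_field_ge_2: "CARD('a::{finite,field}) \<ge> 2"
  using card_mono[of "UNIV :: 'a set" "{0, 1}"] by simp

lemma of_nat_card_finite_field: "of_nat CARD('a::{finite,field}) = (0 :: 'a)"
proof -
  have "(\<Sum>x\<in>UNIV. x + 1 :: 'a) = (\<Sum>x\<in>UNIV. x)"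
    by (rule sum.reindex_bij_witness[of _ "\<lambda>x. x - 1" "\<lambda>x. x + 1"]) auto
  then show ?thesis
    by (simp add: sum.distrib)
qed

lemma finite_field_power_card_minus_1:
  fixes x :: "'a::{finite,field}"
  assumes "x \<noteq> 0"
  shows "x ^ (CARD('a) - 1) = 1"
proof -
  have "(\<Prod>y\<in>UNIV-{0}. x * y) = (\<Prod>y\<in>UNIV-{0}. y)"
    by (rule prod.reindex_bij_witness[of _ "\<lambda>y. y / x" "\<lambda>y. x * y"]) (use assms in auto)
  then have "x ^ (CARD('a) - 1) * (\<Prod>y\<in>UNIV-{0}. y) = 1 * (\<Prod>y\<in>UNIV-{0}. y)"
    by (simp add: prod.distrib)
  moreover have "(\<Prod>y\<in>UNIV-{0}. y :: 'a) \<noteq> 0"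
    by simp
  ultimately show ?thesis
    by (metis mult_right_cancel)
qed

locale C_infinity =
  fixes \<iota> :: "'a::{finite,field} fls \<Rightarrow> 'c::{nonarch_field,complete_space}"
    and q :: real
  assumes is_C_infinity: "is_C_infinity \<iota>"
    and q_def: "q = real CARD('a)"
begin

lemma q_ge_2: "q \<ge> 2"
  using card_finite_field_ge_2[where 'a = 'a] by (simp add: q_def)

lemma q_pos [simp]: "q > 0"
  using q_ge_2 by linarith

lemma q_nonneg [simp]: "q \<ge> 0"
  using q_ge_2 by linarith

lemma q_gt_1 [simp]: "q > 1"
  using q_ge_2 by linarith

lemma \<iota>_1 [simp]: "\<iota> 1 = 1" and \<iota>_add: "\<iota> (x + y) = \<iota> x + \<iota> y"
  and \<iota>_mult: "\<iota> (x * y) = \<iota> x * \<iota> y"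
  and vabs_\<iota>: "x \<noteq> 0 \<Longrightarrow> vabs (\<iota> x) = q powi (- fls_subdegree x)"
  using is_C_infinity unfolding is_C_infinity_def q_def by auto

lemma \<iota>_0 [simp]: "\<iota> 0 = 0"
proof -
  have "\<iota> 0 + \<iota> 0 = \<iota> 0 + 0"
    using \<iota>_add[of 0 0] by simp
  then show ?thesis
    by (rule add_left_imp_eq)
qed

lemma \<iota>_minus: "\<iota> (- x) = - \<iota> x"
  using \<iota>_add[of x "- x"] by (simp add: eq_neg_iff_add_eq_0 add.commute)

lemma \<iota>_diff: "\<iota> (x - y) = \<iota> x - \<iota> y"
  using \<iota>_add[of x "- y"] by (simp add: \<iota>_minus)

lemma \<iota>_eq_0_iff [simp]: "\<iota> x = 0 \<longleftrightarrow> x = 0"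
proof (cases "x = 0")
  case False
  then have "vabs (\<iota> x) > 0"
    unfolding vabs_\<iota>[OF False] by simp
  then show ?thesis
    using False by auto
qed auto

lemma \<iota>_inverse: "\<iota> (inverse x) = inverse (\<iota> x)"
proof (cases "x = 0")
  case False
  then show ?thesis
    using \<iota>_mult[of x "inverse x"] by (simp add: inverse_unique)
qed auto

lemma \<iota>_divide: "\<iota> (x / y) = \<iota> x / \<iota> y"
  by (simp add: divide_inverse \<iota>_mult \<iota>_inverse)

lemma \<iota>_of_nat: "\<iota> (of_nat n) = of_nat n"
  by (induction n) (auto simp: \<iota>_add)

lemma \<iota>_power: "\<iota> (x ^ n) = \<iota> x ^ n"
  by (induction n) (auto simp: \<iota>_mult)

section \<open>The embedding of \<open>A\<close> and its absolute value\<close>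

lemma emb_pCons: "emb \<iota> (pCons c p) = \<iota> (fls_const c) + \<iota> fls_X_inv * emb \<iota> p"
  by (simp add: emb_def map_poly_pCons \<iota>_add \<iota>_mult)

lemma emb_0 [simp]: "emb \<iota> 0 = 0"
  by (simp add: emb_def)

lemma emb_1 [simp]: "emb \<iota> 1 = 1"
  by (simp add: one_pCons emb_pCons)

lemma emb_const: "emb \<iota> [:c:] = \<iota> (fls_const c)"
  by (simp add: emb_pCons)

lemma emb_add: "emb \<iota> (a + b) = emb \<iota> a + emb \<iota> b"
proof (induction a b rule: poly_induct2)
  case (pCons a p b q)
  then show ?case
    by (simp add: emb_pCons \<iota>_add algebra_simps flip: fls_plus_const)
qed auto

lemma emb_minus: "emb \<iota> (- a) = - emb \<iota> a"
  using emb_add[of a "- a"] by (simp add: eq_neg_iff_add_eq_0 add.commute)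

lemma emb_diff: "emb \<iota> (a - b) = emb \<iota> a - emb \<iota> b"
  using emb_add[of a "- b"] by (simp add: emb_minus)

lemma emb_smult: "emb \<iota> (smult c a) = \<iota> (fls_const c) * emb \<iota> a"
  by (induction a) (auto simp: emb_pCons \<iota>_mult algebra_simps simp flip: fls_const_mult_const)

lemma emb_mult: "emb \<iota> (a * b) = emb \<iota> a * emb \<iota> b"
  by (induction a) (auto simp: emb_pCons mult_pCons_left emb_add emb_smult algebra_simps)

text \<open>In the Horner form \<open>c + T * p\<close> with \<open>p \<noteq> 0\<close> the second
  summand has absolute value above 1 and dominates the constant.\<close>

lemma vabs_emb:
  assumes "a \<noteq> 0"
  shows "vabs (emb \<iota> a) = q ^ degree a"
  using assms
proof (induction a)
  case (pCons c p)
  have c: "vabs (\<iota> (fls_const c)) \<le> 1"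
    by (cases "c = 0") (auto simp: vabs_\<iota>)
  show ?case
  proof (cases "p = 0")
    case True
    then show ?thesis
      using pCons by (simp add: emb_pCons vabs_\<iota>)
  next
    case False
    then have "vabs (\<iota> fls_X_inv * emb \<iota> p) = q ^ Suc (degree p)"
      using pCons by (simp add: vabs_mult vabs_\<iota>)
    moreover have "q ^ Suc (degree p) > 1"
      by (rule one_less_power) auto
    ultimately show ?thesis
      using False c vabs_add_eq_left[of "\<iota> (fls_const c)" "\<iota> fls_X_inv * emb \<iota> p"]
      by (simp add: emb_pCons add.commute)
  qed
qed auto

lemma emb_eq_0_iff [simp]: "emb \<iota> a = 0 \<longleftrightarrow> a = 0"
  using vabs_emb[of a] by (metis emb_0 power_eq_0_iff q_pos less_irrefl vabs_0)

lemma inj_emb: "inj (emb \<iota>)"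
  by (rule injI) (metis emb_diff emb_eq_0_iff right_minus_eq)

lemma vabs_emb_ge_1: "a \<noteq> 0 \<Longrightarrow> vabs (emb \<iota> a) \<ge> 1"
  using q_ge_2 by (simp add: vabs_emb)

lemma in_below_iff: "a \<in> below D \<longleftrightarrow> vabs (emb \<iota> a) < q ^ D"
  by (cases "a = 0") (auto simp: below_def vabs_emb)

lemma fin_subgroup_below:
  assumes "s \<noteq> 0"
  shows "fin_subgroup ((\<lambda>a. s * emb \<iota> a) ` below D)"
    and "card ((\<lambda>a. s * emb \<iota> a) ` below D) = CARD('a) ^ D"
proof -
  have "s * emb \<iota> a - s * emb \<iota> b = s * emb \<iota> (a - b)" for a b
    by (simp add: emb_diff right_diff_distrib)
  then show "fin_subgroup ((\<lambda>a. s * emb \<iota> a) ` below D)"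
    unfolding fin_subgroup_def using below_diff by (fastforce simp: image_iff)
  have "inj_on (\<lambda>a. s * emb \<iota> a) (below D)"
    using assms inj_emb by (auto simp: inj_on_def inj_def)
  then show "card ((\<lambda>a. s * emb \<iota> a) ` below D) = CARD('a) ^ D"
    by (simp add: card_image card_below)
qed

lemma sum_below_power_eq_0:
  assumes "i + 1 < CARD('a) ^ j"
  shows "(\<Sum>a\<in>below j. (z + emb \<iota> a) ^ i) = 0"
proof -
  have "(\<Sum>w\<in>(\<lambda>a. 1 * emb \<iota> a) ` below j. (z + w) ^ i) = 0"
    using assms fin_subgroup_below[of 1 j] by (intro subgroup_sum_power_eq_0) simp_all
  then show ?thesis
    using inj_emb by (subst (asm) sum.reindex) (auto simp: inj_on_def inj_def)
qed

lemma of_nat_card_eq_0: "of_nat CARD('a) = (0 :: 'c)"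
proof -
  have "(of_nat CARD('a) :: 'c) = \<iota> (fls_const (of_nat CARD('a)))"
    by (simp only: fls_of_nat[symmetric] \<iota>_of_nat)
  then show ?thesis
    by (simp add: of_nat_card_finite_field)
qed

lemma CHAR_eq:
  assumes "prime p" and "CARD('a) = p ^ e"
  shows "CHAR('c) = p"
proof -
  have "CHAR('c) dvd p ^ e"
    using of_nat_card_eq_0 assms(2) by (simp only: of_nat_eq_0_iff_char_dvd)
  moreover have "CHAR('c) > 0"
    using calculation assms(1) by (metis gr0I dvd_0_left_iff power_not_zero not_prime_0)
  then have "prime CHAR('c)"
    by (rule prime_CHAR_semidom)
  ultimately show ?thesis
    using assms(1) by (metis prime_dvd_power primes_dvd_imp_eq)
qed

text \<open>The absolute value of a difference of Laurent series records the first index at which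
  their coefficients differ.\<close>

lemma vabs_\<iota>_less_imp_coeff_eq:
  assumes "vabs (\<iota> (x - y)) < 1 / q ^ n" and "i \<le> int n"
  shows "fls_nth x i = fls_nth y i"
proof (cases "x = y")
  case False
  then have "q powi (- fls_subdegree (x - y)) < q powi (- int n)"
    using assms(1) vabs_\<iota>[of "x - y"] by (simp add: power_int_minus field_simps)
  then have "int n < fls_subdegree (x - y)"
    using power_int_increasing[of "- int n" "- fls_subdegree (x - y)" q] q_ge_2 by fastforce
  then have "fls_nth (x - y) i = 0"
    using assms(2) by (intro fls_eq0_below_subdegree) auto
  then show ?thesis
    by simp
qed auto

section \<open>Distance from the embedded Laurent series, affinoids and linear forms\<close>

lemma Omega_add:
  assumes "z \<in> Omega \<iota>"
  shows "z + \<iota> x \<in> Omega \<iota>"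
proof -
  have "z + \<iota> x \<noteq> \<iota> y" for y
  proof
    assume "z + \<iota> x = \<iota> y"
    then have "z = \<iota> (y - x)"
      by (simp add: \<iota>_diff algebra_simps)
    then show False
      using assms by (auto simp: Omega_def)
  qed
  then show ?thesis
    by (auto simp: Omega_def)
qed

lemma imag_abs_le: "imag_abs \<iota> z \<le> vabs (z - \<iota> x)"
  unfolding imag_abs_def by (rule cINF_lower) (auto intro!: bdd_belowI[of _ 0])

lemma imag_abs_le_add: "imag_abs \<iota> z \<le> vabs (z + \<iota> x)"
  using imag_abs_le[of z "- x"] by (simp add: \<iota>_minus)

text \<open>A point at distance 0 from \<open>K\<^sub>\<infinity>\<close> is the image of the Laurent series that
  the approximations determine coefficient by coefficient.\<close>

lemma imag_abs_pos:
  assumes "z \<in> Omega \<iota>"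
  shows "imag_abs \<iota> z > 0"
proof (rule ccontr)
  assume "\<not> imag_abs \<iota> z > 0"
  then have "\<exists>x. vabs (z - \<iota> x) < 1 / q ^ n" for n
    unfolding imag_abs_def
    using cINF_less_iff[of UNIV "\<lambda>x. vabs (z - \<iota> x)" "1 / q ^ n"]
    by (smt (verit) UNIV_not_empty bdd_belowI2 divide_pos_pos q_pos vabs_nonneg zero_less_power)
  then obtain X where X: "vabs (z - \<iota> (X n)) < 1 / q ^ n" for n
    by metis
  have mono: "1 / q ^ m \<le> 1 / q ^ n" if "n \<le> m" for m n
    using that q_ge_2 by (intro divide_left_mono power_increasing) auto
  have coeff: "fls_nth (X m) i = fls_nth (X n) i" if "i \<le> int n" "n \<le> m" for m n i
  proof (rule vabs_\<iota>_less_imp_coeff_eq)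
    have "\<iota> (X m - X n) = (z - \<iota> (X n)) - (z - \<iota> (X m))"
      by (simp add: \<iota>_diff)
    then show "vabs (\<iota> (X m - X n)) < 1 / q ^ n"
      using vabs_diff[of "z - \<iota> (X n)" "z - \<iota> (X m)"] X[of n] X[of m] mono[OF that(2)] by simp
  qed fact
  \<comment> \<open>For negative \<open>i\<close> the index \<open>nat i\<close> is 0, so all these
    coefficients come from \<open>X 0\<close>. This is consistent with \<open>coeff\<close> at
    \<open>n = 0\<close>, and it bounds the support of \<open>x\<close> from below.\<close>
  define x where "x = Abs_fls (\<lambda>i. fls_nth (X (nat i)) i)"
  have nth: "fls_nth x i = fls_nth (X (nat i)) i" for i
    unfolding x_def
  proof (rule nth_Abs_fls_lower_bound)
    show "\<forall>k<min 0 (fls_subdegree (X 0)). fls_nth (X (nat k)) k = 0"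
      by auto
  qed
  have "vabs (z - \<iota> x) \<le> 1 / q ^ n" for n
  proof -
    have "fls_nth (x - X n) i = 0" if "i \<le> int n" for i
      using that coeff[of i "nat i" n] coeff[of i n "nat i"] by (cases "i \<ge> 0") (auto simp: nth)
    then have "vabs (\<iota> (x - X n)) \<le> 1 / q ^ n"
    proof (cases "x = X n")
      case False
      then have "fls_subdegree (x - X n) > int n"
        using \<open>\<And>i. i \<le> int n \<Longrightarrow> fls_nth (x - X n) i = 0\<close>
        by (intro fls_subdegree_greaterI) auto
      then have "q powi (- fls_subdegree (x - X n)) \<le> q powi (- int n)"
        using q_ge_2 by (intro power_int_increasing) auto
      then show ?thesis
        using False vabs_\<iota>[of "x - X n"] by (simp add: power_int_minus field_simps)
    qed auto
    moreover have eq: "z - \<iota> x = (z - \<iota> (X n)) - \<iota> (x - X n)"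
      by (simp add: \<iota>_diff)
    ultimately show ?thesis
      unfolding eq using vabs_diff[of "z - \<iota> (X n)" "\<iota> (x - X n)"] X[of n] by linarith
  qed
  moreover have "(\<lambda>n. 1 / q ^ n) \<longlonglongrightarrow> 0"
    using LIMSEQ_inverse_realpow_zero[OF q_gt_1] by (simp add: inverse_eq_divide)
  ultimately have "vabs (z - \<iota> x) \<le> 0"
    by (metis LIMSEQ_le_const)
  then have "vabs (z - \<iota> x) = 0"
    using vabs_nonneg[of "z - \<iota> x"] by linarith
  then have "z = \<iota> x"
    by simp
  then show False
    using assms by (auto simp: Omega_def)
qed

text \<open>After division by \<open>a\<close> the form becomes \<open>z + b/a\<close> with
  \<open>b/a\<close> in the image of \<iota>, hence of absolute value at least
  \<open>imag_abs \<iota> z\<close>.\<close>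

lemma vabs_linear_form_ge: "vabs (emb \<iota> a) * imag_abs \<iota> z \<le> vabs (emb \<iota> a * z + emb \<iota> b)"
proof (cases "a = 0")
  case False
  obtain x where x: "emb \<iota> b / emb \<iota> a = \<iota> x"
    by (metis emb_def \<iota>_divide)
  have "emb \<iota> a * z + emb \<iota> b = emb \<iota> a * (z + \<iota> x)"
    unfolding x[symmetric] using False by (simp add: distrib_left)
  then show ?thesis
    by (simp add: vabs_mult mult_left_mono imag_abs_le_add)
qed auto

lemma affinoid_in_Omega:
  assumes "z \<in> Omega_affinoid \<iota> N"
  shows "z \<in> Omega \<iota>"
proof -
  have "z \<noteq> \<iota> x" for x
  proof
    assume "z = \<iota> x"
    then have "imag_abs \<iota> z \<le> 0"
      using imag_abs_le[of z x] by simp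
    moreover have "1 / q ^ N \<le> imag_abs \<iota> z"
      using assms by (simp add: Omega_affinoid_def q_def)
    moreover have "0 < 1 / q ^ N"
      by simp
    ultimately show False
      by linarith
  qed
  then show ?thesis
    by (auto simp: Omega_def)
qed

lemma Omega_in_affinoid:
  assumes "z \<in> Omega \<iota>"
  obtains N where "z \<in> Omega_affinoid \<iota> N"
proof -
  obtain n where n: "q ^ n > 1 / imag_abs \<iota> z"
    using real_arch_pow[OF q_gt_1] by blast
  obtain m where m: "q ^ m > vabs z"
    using real_arch_pow[OF q_gt_1] by blast
  have "q ^ n \<le> q ^ max n m" "q ^ m \<le> q ^ max n m"
    using q_ge_2 by (auto intro!: power_increasing)
  then have N: "q ^ max n m > 1 / imag_abs \<iota> z" "q ^ max n m > vabs z"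
    using n m by linarith+
  then have "1 / q ^ max n m \<le> imag_abs \<iota> z"
    using imag_abs_pos[OF assms] by (simp add: field_simps)
  then show ?thesis
    using N(2) that[of "max n m"] by (simp add: Omega_affinoid_def q_def)
qed

text \<open>On an affinoid \<open>az + b\<close> is bounded below by the larger of \<open>a\<close>
  and \<open>b\<close>, with constants depending on \<open>N\<close> alone. The bound for
  \<open>b\<close> follows from the one for \<open>a\<close> through
  \<open>b = (az + b) - az\<close>; this uniformity underlies all later estimates.\<close>

lemma affinoid_linear_form_bounds:
  assumes "z \<in> Omega_affinoid \<iota> N"
  shows "vabs (emb \<iota> a) \<le> q ^ N * vabs (emb \<iota> a * z + emb \<iota> b)"
    and "vabs (emb \<iota> b) \<le> q ^ (2 * N) * vabs (emb \<iota> a * z + emb \<iota> b)"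
proof -
  let ?y = "emb \<iota> a * z + emb \<iota> b"
  have z: "1 / q ^ N \<le> imag_abs \<iota> z" "vabs z \<le> q ^ N"
    using assms by (auto simp: Omega_affinoid_def q_def)
  have "vabs (emb \<iota> a) * (1 / q ^ N) \<le> vabs (emb \<iota> a) * imag_abs \<iota> z"
    using z by (intro mult_left_mono) auto
  also have "\<dots> \<le> vabs ?y"
    by (rule vabs_linear_form_ge)
  finally show a: "vabs (emb \<iota> a) \<le> q ^ N * vabs ?y"
    by (simp add: field_simps)
  have "vabs (emb \<iota> a * z) \<le> (q ^ N * vabs ?y) * q ^ N"
    unfolding vabs_mult using a z order_trans[OF vabs_nonneg a] by (intro mult_mono) auto
  also have "\<dots> = q ^ (2 * N) * vabs ?y"
    by (simp add: power_add mult_2)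
  finally have "vabs (emb \<iota> a * z) \<le> q ^ (2 * N) * vabs ?y" .
  moreover have "1 * vabs ?y \<le> q ^ (2 * N) * vabs ?y"
    using q_ge_2 by (intro mult_right_mono one_le_power) auto
  ultimately show "vabs (emb \<iota> b) \<le> q ^ (2 * N) * vabs ?y"
    using vabs_diff[of ?y "emb \<iota> a * z"] by simp
qed

lemma linear_form_nonzero:
  assumes "z \<in> Omega \<iota>" and "(a, b) \<noteq> (0, 0)"
  shows "emb \<iota> a * z + emb \<iota> b \<noteq> 0"
proof
  assume eq: "emb \<iota> a * z + emb \<iota> b = 0"
  obtain N where "z \<in> Omega_affinoid \<iota> N"
    using Omega_in_affinoid assms(1) by blast
  from affinoid_linear_form_bounds(1)[OF this, where a = a and b = b]
    affinoid_linear_form_bounds(2)[OF this, where a = a and b = b] have "a = 0 \<and> b = 0"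
    unfolding eq by simp
  then show False
    using assms(2) by simp
qed

end

section \<open>The lattice exponential and Goss polynomials\<close>

lemma coeff_mult_linear_factor:
  "coeff (P * [:1, c :: 'c::comm_ring_1:]) i = coeff P i + c * (if i = 0 then 0 else coeff P (i - 1))"
  by (subst mult.commute) (simp add: mult_pCons_left coeff_pCons split: nat.split)

text \<open>Up to sign the coefficient is the elementary symmetric function of degree
  \<open>i\<close> in the numbers \<open>1 / w\<close>.\<close>

lemma vabs_coeff_prod_le:
  fixes S :: "'c::nonarch_field set"
  assumes "finite S" and "\<And>w. w \<in> S \<Longrightarrow> vabs w \<ge> \<rho>" and \<rho>: "\<rho> > 0"
  shows "vabs (coeff (\<Prod>w\<in>S. [:1, - 1 / w:]) i) \<le> (1 / \<rho>) ^ i"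
  using assms(1,2)
proof (induction S arbitrary: i rule: finite_induct)
  case empty
  then show ?case
    using \<rho> by (cases i) auto
next
  case (insert w S)
  let ?P = "\<Prod>w\<in>S. [:1, - 1 / w:]"
  have "vabs (- 1 / w * (if i = 0 then 0 else coeff ?P (i - 1))) \<le> (1 / \<rho>) ^ i"
  proof (cases i)
    case (Suc l)
    have "1 / vabs w * vabs (coeff ?P l) \<le> 1 / \<rho> * (1 / \<rho>) ^ l"
      using insert \<rho> by (intro mult_mono frac_le) auto
    then show ?thesis
      by (simp add: Suc vabs_mult vabs_divide)
  qed (use \<rho> in auto)
  moreover have "vabs (coeff ?P i) \<le> (1 / \<rho>) ^ i"
    using insert by blast
  moreover have "(\<Prod>w\<in>insert w S. [:1, - 1 / w:]) = ?P * [:1, - 1 / w:]"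
    using insert.hyps by (simp add: mult.commute)
  ultimately show ?case
    using vabs_add[of "coeff ?P i" "- 1 / w * (if i = 0 then 0 else coeff ?P (i - 1))"]
    by (simp only: coeff_mult_linear_factor)
qed

text \<open>Every monomial that survives in the difference contains some \<open>1 / w\<close> with
  \<open>w \<in> S\<close>, which improves one factor \<open>1 / \<rho>\<close> to
  \<open>1 / R\<close>.\<close>

lemma vabs_coeff_prod_diff_le:
  fixes S :: "'c::nonarch_field set"
  assumes "finite S" and "finite S0" and "S \<inter> S0 = {}"
    and "\<And>w. w \<in> S0 \<Longrightarrow> vabs w \<ge> \<rho>" and "\<And>w. w \<in> S \<Longrightarrow> vabs w \<ge> R"
    and \<rho>: "\<rho> > 0" and R: "R \<ge> \<rho>"
  shows "vabs (coeff (\<Prod>w\<in>S \<union> S0. [:1, - 1 / w:]) i - coeff (\<Prod>w\<in>S0. [:1, - 1 / w:]) i)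
    \<le> \<rho> / R * (1 / \<rho>) ^ i"
  using assms(1-5)
proof (induction S arbitrary: i rule: finite_induct)
  case empty
  then show ?case
    using \<rho> R by simp
next
  case (insert w S)
  let ?P = "\<Prod>w\<in>S \<union> S0. [:1, - 1 / w:]" and ?Q = "\<Prod>w\<in>S0. [:1, - 1 / w:]"
  let ?c = "- 1 / w * (if i = 0 then 0 else coeff ?P (i - 1))"
  have 1: "vabs ?c \<le> \<rho> / R * (1 / \<rho>) ^ i"
  proof (cases i)
    case (Suc l)
    have "vabs (coeff ?P l) \<le> (1 / \<rho>) ^ l"
      using insert R \<rho> by (intro vabs_coeff_prod_le) (auto intro: order_trans[OF R])
    then have "1 / vabs w * vabs (coeff ?P l) \<le> 1 / R * (1 / \<rho>) ^ l"
      using insert \<rho> R by (intro mult_mono frac_le) auto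
    then show ?thesis
      using \<rho> by (simp add: Suc vabs_mult vabs_divide)
  qed (use \<rho> R in auto)
  have 2: "vabs (coeff ?P i - coeff ?Q i) \<le> \<rho> / R * (1 / \<rho>) ^ i"
    using insert by auto
  have "(\<Prod>w\<in>insert w S \<union> S0. [:1, - 1 / w:]) = ?P * [:1, - 1 / w:]"
    using insert.hyps insert.prems by (simp add: mult.commute)
  then have eq: "coeff (\<Prod>w\<in>insert w S \<union> S0. [:1, - 1 / w:]) i - coeff ?Q i
      = (coeff ?P i - coeff ?Q i) + ?c"
    by (simp only: coeff_mult_linear_factor) simp
  show ?case
    unfolding eq using vabs_add[of "coeff ?P i - coeff ?Q i" ?c] 1 2 by linarith
qed

text \<open>The deviation from 1 is governed by the worst factor and does not grow with the number
  of factors.\<close>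

lemma vabs_prod_minus_1_le:
  fixes S :: "'c::nonarch_field set"
  assumes "finite S" and "\<And>w. w \<in> S \<Longrightarrow> vabs w \<ge> R" and R: "R > 0" "R \<ge> vabs z"
  shows "vabs ((\<Prod>w\<in>S. 1 - z / w) - 1) \<le> vabs z / R"
  using assms(1,2)
proof (induction S rule: finite_induct)
  case empty
  then show ?case
    using R by simp
next
  case (insert w S)
  let ?P = "\<Prod>w\<in>S. 1 - z / w"
  have IH: "vabs (?P - 1) \<le> vabs z / R"
    using insert by auto
  also have "\<dots> \<le> 1"
    using R by (simp add: divide_le_eq)
  finally have "vabs (?P - 1) \<le> 1" .
  then have P: "vabs ?P \<le> 1"
    using vabs_add[of "?P - 1" 1] by simp
  have "vabs z / vabs w * vabs ?P \<le> vabs z / R * 1"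
    using insert R P by (intro mult_mono frac_le) auto
  then have 1: "vabs (z / w * ?P) \<le> vabs z / R"
    by (simp add: vabs_mult vabs_divide)
  have eq: "(\<Prod>w\<in>insert w S. 1 - z / w) - 1 = (?P - 1) - z / w * ?P"
    using insert.hyps by (simp add: algebra_simps)
  show ?case
    unfolding eq using vabs_diff[of "?P - 1" "z / w * ?P"] IH 1 by linarith
qed

locale period_scale = C_infinity \<iota> q
  for \<iota> :: "'a::{finite,field} fls \<Rightarrow> 'c::{nonarch_field,complete_space}" and q :: real +
  fixes \<pi> :: 'c
  assumes period_nonzero: "\<pi> \<noteq> 0"
begin

abbreviation \<Lambda> :: "'c set" where "\<Lambda> \<equiv> period_lattice \<iota> \<pi>"

definition \<Lambda>_below :: "nat \<Rightarrow> 'c set" where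
  "\<Lambda>_below D = (\<lambda>a. \<pi> * emb \<iota> a) ` below D"

lemma fin_subgroup_\<Lambda>_below: "fin_subgroup (\<Lambda>_below D)"
  unfolding \<Lambda>_below_def using fin_subgroup_below period_nonzero by blast

lemma finite_\<Lambda>_below [simp]: "finite (\<Lambda>_below D)"
  by (simp add: \<Lambda>_below_def)

lemma \<Lambda>_below_subset: "\<Lambda>_below D \<subseteq> \<Lambda>"
  by (auto simp: \<Lambda>_below_def period_lattice_def)

lemma \<Lambda>_below_mono: "D \<le> E \<Longrightarrow> \<Lambda>_below D \<subseteq> \<Lambda>_below E"
  unfolding \<Lambda>_below_def using below_mono by blast

lemma eventually_in_\<Lambda>_below: "w \<in> \<Lambda> \<Longrightarrow> eventually (\<lambda>D. w \<in> \<Lambda>_below D) sequentially"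
  unfolding \<Lambda>_below_def period_lattice_def
  using eventually_in_below by (fastforce elim: eventually_mono)

lemma sum_\<Lambda>_below: "(\<Sum>w\<in>\<Lambda>_below D. f w) = (\<Sum>a\<in>below D. f (\<pi> * emb \<iota> a))"
proof -
  have "inj_on (\<lambda>a. \<pi> * emb \<iota> a) (below D)"
    using period_nonzero inj_emb by (auto simp: inj_on_def inj_def)
  then show ?thesis
    unfolding \<Lambda>_below_def by (simp add: sum.reindex)
qed

lemma vabs_\<Lambda>_ge: "w \<in> \<Lambda> \<Longrightarrow> w \<noteq> 0 \<Longrightarrow> vabs w \<ge> vabs \<pi>"
  unfolding period_lattice_def
  by (auto simp: vabs_mult intro!: mult_le_cancel_left1[THEN iffD2] vabs_emb_ge_1)

lemma vabs_\<Lambda>_not_below_ge: "w \<in> \<Lambda> \<Longrightarrow> w \<notin> \<Lambda>_below D \<Longrightarrow> vabs w \<ge> vabs \<pi> * q ^ D"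
proof -
  assume "w \<in> \<Lambda>" "w \<notin> \<Lambda>_below D"
  then obtain a where "w = \<pi> * emb \<iota> a" "a \<notin> below D"
    unfolding period_lattice_def \<Lambda>_below_def by blast
  then show ?thesis
    by (simp add: in_below_iff vabs_mult mult_left_mono)
qed

lemma exists_power_q_ge: "\<exists>D0. \<forall>D\<ge>D0. B \<le> vabs \<pi> * q ^ D"
proof -
  obtain D0 where D0: "q ^ D0 > B / vabs \<pi>"
    using real_arch_pow[OF q_gt_1] by blast
  have "B \<le> vabs \<pi> * q ^ D" if "D \<ge> D0" for D
  proof -
    have "q ^ D0 \<le> q ^ D"
      using that q_ge_2 by (intro power_increasing) auto
    with D0 have "B / vabs \<pi> \<le> q ^ D"
      by linarith
    then show ?thesis
      using period_nonzero by (simp add: field_simps)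
  qed
  then show ?thesis
    by blast
qed

text \<open>The \<open>Lim\<close> in \<open>lattice_exp\<close> is meaningful only once the net of
  finite products converges. Then it may be evaluated along the groups
  \<open>\<Lambda>_below D\<close>, where the identities for finite groups apply.\<close>

lemma lattice_exp_limit: "(\<lambda>D. fin_exp (\<Lambda>_below D) z) \<longlonglongrightarrow> lattice_exp \<Lambda> z"
proof -
  let ?f = "\<lambda>S. \<Prod>w\<in>S. 1 - z / w"
  have "\<exists>l. (?f \<longlongrightarrow> l) (finite_subsets_at_top (\<Lambda> - {0}))"
  proof (rule nonarch_Cauchy_finite_subsets)
    fix \<epsilon> :: real
    assume \<epsilon>: "\<epsilon> > 0"
    \<comment> \<open>Beyond \<open>D0\<close> the additional factors multiply to absolute value at
      most 1, so \<open>B\<close> bounds the later partial products. \<open>D1\<close> then makes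
      \<open>B\<close> times the remaining deviation from 1 at most \<epsilon>.\<close>
    obtain D0 where D0: "\<forall>D\<ge>D0. vabs z + 1 \<le> vabs \<pi> * q ^ D"
      using exists_power_q_ge by blast
    define B where "B = vabs (?f (\<Lambda>_below D0 - {0}))"
    obtain D1 where D1: "\<forall>D\<ge>D1. vabs z * B / \<epsilon> \<le> vabs \<pi> * q ^ D"
      using exists_power_q_ge by blast
    define D where "D = max D0 D1"
    let ?X = "\<Lambda>_below D - {0}"
    have split: "?f Y = ?f (\<Lambda>_below E - {0}) * ?f (Y - (\<Lambda>_below E - {0}))"
      if "finite Y" "\<Lambda>_below E - {0} \<subseteq> Y" for Y E
      using prod.subset_diff[OF that(2,1), of "\<lambda>w. 1 - z / w"] by (simp add: mult.commute)
    have near: "vabs (?f (Y - (\<Lambda>_below E - {0})) - 1) \<le> vabs z / (vabs \<pi> * q ^ E)"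
      if "finite Y" "Y \<subseteq> \<Lambda> - {0}" "E \<ge> D0" for Y E
      using that D0 period_nonzero
      by (intro vabs_prod_minus_1_le) (auto intro!: vabs_\<Lambda>_not_below_ge dest!: spec[of _ E])
    have "vabs (?f (?X - (\<Lambda>_below D0 - {0})) - 1) \<le> vabs z / (vabs \<pi> * q ^ D0)"
      using \<Lambda>_below_subset by (intro near) auto
    also have "\<dots> \<le> 1"
      using D0[rule_format, of D0] vabs_nonneg[of z] by (subst divide_le_eq_1) linarith
    finally have "vabs (?f (?X - (\<Lambda>_below D0 - {0}))) \<le> 1"
      using vabs_add[of "?f (?X - (\<Lambda>_below D0 - {0})) - 1" 1] by simp
    then have B: "vabs (?f ?X) \<le> B"
      using \<Lambda>_below_mono[of D0 D]
      by (subst split[where E = D0]) (auto simp: vabs_mult B_def D_def mult_left_le)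
    have "vabs (?f Y - ?f ?X) \<le> \<epsilon>" if "finite Y" "?X \<subseteq> Y" "Y \<subseteq> \<Lambda> - {0}" for Y
    proof -
      have "?f Y - ?f ?X = ?f ?X * (?f (Y - ?X) - 1)"
        using split[OF that(1,2)] by (simp add: algebra_simps)
      also have "vabs \<dots> \<le> B * (vabs z / (vabs \<pi> * q ^ D))"
        unfolding vabs_mult using near[OF that(1,3), of D] B by (intro mult_mono) (auto simp: D_def B_def)
      also have "\<dots> \<le> \<epsilon>"
      proof -
        have "vabs z * B / \<epsilon> \<le> vabs \<pi> * q ^ D"
          using D1 by (simp add: D_def)
        then show ?thesis
          using \<epsilon> period_nonzero by (simp add: field_simps)
      qed
      finally show ?thesis .
    qed
    then show "\<exists>X. finite X \<and> X \<subseteq> \<Lambda> - {0} \<and>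
        (\<forall>Y. finite Y \<and> X \<subseteq> Y \<and> Y \<subseteq> \<Lambda> - {0} \<longrightarrow> vabs (?f Y - ?f X) \<le> \<epsilon>)"
      using \<Lambda>_below_subset by (intro exI[of _ ?X]) auto
  qed
  then obtain l where l: "(?f \<longlongrightarrow> l) (finite_subsets_at_top (\<Lambda> - {0}))"
    by blast
  have "Lim (finite_subsets_at_top (\<Lambda> - {0})) ?f = l"
    by (rule tendsto_Lim[OF _ l]) simp
  moreover have "filterlim (\<lambda>D. \<Lambda>_below D - {0}) (finite_subsets_at_top (\<Lambda> - {0})) sequentially"
    using \<Lambda>_below_subset eventually_in_\<Lambda>_below by (intro filterlim_exhaustion) (auto elim!: eventually_mono)
  then have "(\<lambda>D. ?f (\<Lambda>_below D - {0})) \<longlonglongrightarrow> l"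
    by (rule filterlim_compose[OF l])
  ultimately show ?thesis
    unfolding fin_exp_def lattice_exp_def by (auto intro!: tendsto_mult)
qed

lemma lattice_exp_add: "lattice_exp \<Lambda> (z + x) = lattice_exp \<Lambda> z + lattice_exp \<Lambda> x"
proof (rule LIMSEQ_unique[OF lattice_exp_limit])
  show "(\<lambda>D. fin_exp (\<Lambda>_below D) (z + x)) \<longlonglongrightarrow> lattice_exp \<Lambda> z + lattice_exp \<Lambda> x"
    unfolding fin_exp_add[OF fin_subgroup_\<Lambda>_below] by (intro tendsto_add lattice_exp_limit)
qed

lemma lattice_exp_0 [simp]: "lattice_exp \<Lambda> 0 = 0"
  by (simp add: lattice_exp_def)

lemma lattice_exp_diff: "lattice_exp \<Lambda> (z - x) = lattice_exp \<Lambda> z - lattice_exp \<Lambda> x"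
  using lattice_exp_add[of "z - x" x] by simp

text \<open>Nonzero lattice points are at least as large as \<pi>, so every factor
  \<open>1 - x / w\<close> is a unit. With additivity this makes \<open>lattice_exp\<close> an
  isometry on the open disc, which separates values of \<open>t\<close> and torsion points later
  on.\<close>

lemma vabs_lattice_exp_small:
  assumes "vabs x < vabs \<pi>"
  shows "vabs (lattice_exp \<Lambda> x) = vabs x"
proof -
  have "vabs (fin_exp (\<Lambda>_below D) x) = vabs x" for D
  proof -
    have "vabs (1 - x / w) = 1" if "w \<in> \<Lambda>_below D - {0}" for w
    proof -
      have "vabs \<pi> \<le> vabs w"
        using that \<Lambda>_below_subset by (intro vabs_\<Lambda>_ge) auto
      then have "vabs (- (x / w)) < vabs (1 :: 'c)"
        using assms that by (simp add: vabs_divide)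
      then show ?thesis
        using vabs_add_eq_left[of "- (x / w)" 1] by simp
    qed
    then show ?thesis
      by (simp add: fin_exp_def vabs_mult vabs_prod)
  qed
  then show ?thesis
    using tendsto_vabs[OF lattice_exp_limit[of x]] by (simp add: LIMSEQ_const_iff)
qed

lemma vabs_translate_ge: "vabs \<pi> * imag_abs \<iota> z \<le> vabs (\<pi> * z + \<pi> * emb \<iota> b)"
proof -
  have "vabs (\<pi> * z + \<pi> * emb \<iota> b) = vabs \<pi> * vabs (emb \<iota> 1 * z + emb \<iota> b)"
    by (simp add: vabs_mult flip: distrib_left)
  then show ?thesis
    using vabs_linear_form_ge[of 1 z b] by (simp add: mult_left_mono)
qed

lemma translate_nonzero:
  assumes "z \<in> Omega \<iota>"
  shows "\<pi> * z + \<pi> * emb \<iota> b \<noteq> 0"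
  using linear_form_nonzero[OF assms, of 1 b] period_nonzero by (simp flip: distrib_left)

lemma translate_nonzero_\<Lambda>_below:
  assumes "z \<in> Omega \<iota>" and "w \<in> \<Lambda>_below D"
  shows "\<pi> * z + w \<noteq> 0"
  using assms translate_nonzero by (auto simp: \<Lambda>_below_def)

lemma sum_inverse_below:
  assumes "z \<in> Omega \<iota>"
  shows "(\<Sum>b\<in>below D. 1 / (\<pi> * z + \<pi> * emb \<iota> b)) = 1 / fin_exp (\<Lambda>_below D) (\<pi> * z)"
    and "fin_exp (\<Lambda>_below D) (\<pi> * z) \<noteq> 0"
  using sum_inverse_eq_inverse_fin_exp[OF fin_subgroup_\<Lambda>_below translate_nonzero_\<Lambda>_below[OF assms]]
  by (simp_all add: sum_\<Lambda>_below)

text \<open>The partial fraction sum turns a bound on its terms into a lower bound for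
  \<open>fin_exp\<close> that is uniform in \<open>D\<close>; so the limit cannot vanish on
  \<open>Omega \<iota>\<close>.\<close>

lemma vabs_sum_inverse_below_le:
  assumes "z \<in> Omega \<iota>"
  shows "vabs (1 / fin_exp (\<Lambda>_below D) (\<pi> * z)) \<le> 1 / (vabs \<pi> * imag_abs \<iota> z)"
proof -
  have pos: "vabs \<pi> * imag_abs \<iota> z > 0"
    using imag_abs_pos[OF assms] period_nonzero by simp
  have "vabs (1 / (\<pi> * z + \<pi> * emb \<iota> b)) \<le> 1 / (vabs \<pi> * imag_abs \<iota> z)" for b
    unfolding vabs_divide vabs_1 using vabs_translate_ge[of z b] pos
    by (intro frac_le) auto
  then show ?thesis
    unfolding sum_inverse_below[OF assms, symmetric] using pos by (intro vabs_sum_le) auto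
qed

lemma lattice_exp_nonzero:
  assumes "z \<in> Omega \<iota>"
  shows "lattice_exp \<Lambda> (\<pi> * z) \<noteq> 0"
proof -
  have pos: "vabs \<pi> * imag_abs \<iota> z > 0"
    using imag_abs_pos[OF assms] period_nonzero by simp
  have "vabs \<pi> * imag_abs \<iota> z \<le> vabs (fin_exp (\<Lambda>_below D) (\<pi> * z))" for D
    using vabs_sum_inverse_below_le[OF assms, of D] sum_inverse_below(2)[OF assms, of D] pos
    by (simp add: vabs_divide field_simps)
  then have "vabs \<pi> * imag_abs \<iota> z \<le> vabs (lattice_exp \<Lambda> (\<pi> * z))"
    by (intro tendsto_lowerbound[OF tendsto_vabs[OF lattice_exp_limit]]) auto
  then show ?thesis
    using pos by auto
qed

lemma t_par_limit:
  assumes "z \<in> Omega \<iota>"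
  shows "(\<lambda>D. 1 / fin_exp (\<Lambda>_below D) (\<pi> * z)) \<longlonglongrightarrow> t_par \<iota> \<pi> z"
  unfolding t_par_def
  by (intro tendsto_nonarch_divide tendsto_const lattice_exp_limit lattice_exp_nonzero assms)

lemma vabs_t_par_le:
  assumes "z \<in> Omega \<iota>"
  shows "vabs (t_par \<iota> \<pi> z) \<le> 1 / (vabs \<pi> * imag_abs \<iota> z)"
  using vabs_sum_inverse_below_le[OF assms]
  by (intro vabs_lim_le[OF t_par_limit[OF assms]]) auto

text \<open>The coefficients of the power series of the lattice exponential, which are the input of
  the recursion for Goss polynomials.\<close>

definition exp_coeff :: "nat \<Rightarrow> 'c" where
  "exp_coeff i = lim (\<lambda>D. coeff (fin_exp_poly (\<Lambda>_below D)) i)"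

lemma exp_coeff_limit: "(\<lambda>D. coeff (fin_exp_poly (\<Lambda>_below D)) i) \<longlonglongrightarrow> exp_coeff i"
  unfolding exp_coeff_def convergent_LIMSEQ_iff[symmetric]
proof (cases i)
  case 0
  then show "convergent (\<lambda>D. coeff (fin_exp_poly (\<Lambda>_below D)) i)"
    by (simp add: coeff_fin_exp_poly_0 convergent_const)
next
  case (Suc l)
  let ?P = "\<lambda>D. \<Prod>w\<in>\<Lambda>_below D - {0}. [:1, - 1 / w:]"
  have coeff: "coeff (fin_exp_poly (\<Lambda>_below D)) i = coeff (?P D) l" for D
    by (simp add: Suc fin_exp_poly_def mult_pCons_left)
  show "convergent (\<lambda>D. coeff (fin_exp_poly (\<Lambda>_below D)) i)"
  proof (rule nonarch_Cauchy_convergent)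
    fix \<epsilon> :: real
    assume \<epsilon>: "\<epsilon> > 0"
    obtain M where "\<forall>D\<ge>M. vabs \<pi> * (1 / vabs \<pi>) ^ l / \<epsilon> \<le> vabs \<pi> * q ^ D"
      using exists_power_q_ge by blast
    then have M: "vabs \<pi> / (vabs \<pi> * q ^ M) * (1 / vabs \<pi>) ^ l \<le> \<epsilon>"
      using \<epsilon> period_nonzero by (auto dest!: spec[of _ M] simp: field_simps)
    have "vabs (coeff (?P m) l - coeff (?P M) l) \<le> \<epsilon>" if "m \<ge> M" for m
    proof -
      have eq: "\<Lambda>_below m - {0} = (\<Lambda>_below m - \<Lambda>_below M) \<union> (\<Lambda>_below M - {0})"
        using \<Lambda>_below_mono[OF that] fin_subgroupD(2)[OF fin_subgroup_\<Lambda>_below] by auto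
      have "vabs (coeff (?P m) l - coeff (?P M) l) \<le> vabs \<pi> / (vabs \<pi> * q ^ M) * (1 / vabs \<pi>) ^ l"
        unfolding eq using \<Lambda>_below_subset period_nonzero q_ge_2
        by (intro vabs_coeff_prod_diff_le)
          (auto intro!: vabs_\<Lambda>_ge vabs_\<Lambda>_not_below_ge mult_le_cancel_left1[THEN iffD2] one_le_power)
      then show ?thesis
        using M by linarith
    qed
    then show "\<exists>M. \<forall>m\<ge>M. vabs (coeff (fin_exp_poly (\<Lambda>_below m)) i
        - coeff (fin_exp_poly (\<Lambda>_below M)) i) \<le> \<epsilon>"
      unfolding coeff by blast
  qed
qed

section \<open>Existence and uniqueness of Goss polynomials\<close>

lemma inverse_power_summable:
  assumes z: "z \<in> Omega \<iota>" and n: "n \<ge> 1"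
  shows "(\<lambda>b. 1 / (\<pi> * z + \<pi> * emb \<iota> b) ^ n) summable_on UNIV"
proof (rule nonarch_summable_on)
  fix \<epsilon> :: real
  assume \<epsilon>: "\<epsilon> > 0"
  obtain D where D: "max (max 1 (1 / \<epsilon>)) (vabs (\<pi> * z) + 1) \<le> vabs \<pi> * q ^ D"
    using exists_power_q_ge by blast
  have "b \<in> below D" if "vabs (1 / (\<pi> * z + \<pi> * emb \<iota> b) ^ n) > \<epsilon>" for b
  proof (rule ccontr)
    assume "b \<notin> below D"
    then have "vabs \<pi> * q ^ D \<le> vabs (\<pi> * emb \<iota> b)"
      by (simp add: in_below_iff vabs_mult mult_left_mono)
    moreover from this have "vabs (\<pi> * emb \<iota> b + \<pi> * z) = vabs (\<pi> * emb \<iota> b)"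
      using D by (intro vabs_add_eq_left) linarith
    ultimately have ge: "max 1 (1 / \<epsilon>) \<le> vabs (\<pi> * z + \<pi> * emb \<iota> b)"
      using D by (simp add: add.commute)
    then have "1 / \<epsilon> \<le> vabs (\<pi> * z + \<pi> * emb \<iota> b) ^ n"
      using self_le_power[of "vabs (\<pi> * z + \<pi> * emb \<iota> b)" n] n by linarith
    moreover have "vabs (\<pi> * z + \<pi> * emb \<iota> b) ^ n > 0"
      using ge by (intro zero_less_power) linarith
    ultimately have "1 / vabs (\<pi> * z + \<pi> * emb \<iota> b) ^ n \<le> \<epsilon>"
      using \<epsilon> by (simp add: field_simps)
    then show False
      using that by (simp add: vabs_divide vabs_power)
  qed
  then have "{b \<in> UNIV. vabs (1 / (\<pi> * z + \<pi> * emb \<iota> b) ^ n) > \<epsilon>} \<subseteq> below D"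
    by blast
  then show "finite {b \<in> UNIV. vabs (1 / (\<pi> * z + \<pi> * emb \<iota> b) ^ n) > \<epsilon>}"
    by (rule finite_subset) simp
qed

lemma inverse_power_limit:
  assumes "((\<lambda>b. 1 / (\<pi> * z + \<pi> * emb \<iota> b) ^ n) has_sum l) UNIV"
  shows "(\<lambda>D. \<Sum>b\<in>below D. 1 / (\<pi> * z + \<pi> * emb \<iota> b) ^ n) \<longlonglongrightarrow> l"
  using assms unfolding has_sum_def
  by (rule filterlim_compose) (intro filterlim_exhaustion eventually_in_below, auto)

text \<open>Goss's recursion, with G_n equal to X times the sum of the \<open>exp_coeff i\<close>
  multiples of G_(n-i), is the limit over \<open>D\<close> of Newton's identities for
  \<open>\<Lambda>_below D\<close>. The vanishing constant term is carried along because it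
  ultimately makes the form cuspidal.\<close>

lemma goss_poly_exists:
  assumes "n \<ge> 1"
  shows "\<exists>G. coeff G 0 = 0 \<and> (\<forall>z\<in>Omega \<iota>.
    ((\<lambda>b. 1 / (\<pi> * z + \<pi> * emb \<iota> b) ^ n) has_sum poly G (t_par \<iota> \<pi> z)) UNIV)"
    (is "\<exists>G. ?goss n G")
  using assms
proof (induction n rule: less_induct)
  case (less n)
  let ?S = "\<lambda>n z D. \<Sum>b\<in>below D. 1 / (\<pi> * z + \<pi> * emb \<iota> b) ^ n"
  \<comment> \<open>Summability is known independently, so the value of the unconditional sum may be
    read off along the exhaustion by \<open>below D\<close>.\<close>
  have from_limit: "?goss n G" if "coeff G 0 = 0" and lim: "\<And>z. z \<in> Omega \<iota> \<Longrightarrow> ?S n z \<longlonglongrightarrow> poly G (t_par \<iota> \<pi> z)" for G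
  proof (intro conjI ballI that(1))
    fix z
    assume z: "z \<in> Omega \<iota>"
    obtain l where l: "((\<lambda>b. 1 / (\<pi> * z + \<pi> * emb \<iota> b) ^ n) has_sum l) UNIV"
      using inverse_power_summable[OF z] less.prems by (auto simp: summable_on_def)
    then show "((\<lambda>b. 1 / (\<pi> * z + \<pi> * emb \<iota> b) ^ n) has_sum poly G (t_par \<iota> \<pi> z)) UNIV"
      using LIMSEQ_unique[OF inverse_power_limit[OF l] lim[OF z]] by simp
  qed
  show ?case
  proof (cases "n = 1")
    case True
    have "?S n z \<longlonglongrightarrow> poly [:0, 1:] (t_par \<iota> \<pi> z)" if "z \<in> Omega \<iota>" for z
      using t_par_limit[OF that] by (simp add: True sum_inverse_below[OF that])
    then have "?goss n [:0, 1:]"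
      by (intro from_limit) simp_all
    then show ?thesis
      by blast
  next
    case False
    with less.prems have n: "n \<ge> 2"
      by simp
    have "\<exists>G. 1 \<le> m \<and> m < n \<longrightarrow> ?goss m G" for m
      using less.IH[of m] by blast
    then obtain G where G: "\<And>m. 1 \<le> m \<Longrightarrow> m < n \<Longrightarrow> ?goss m (G m)"
      by metis
    let ?H = "[:0, 1:] * (\<Sum>i=1..<n. smult (exp_coeff i) (G (n - i)))"
    have "?S n z \<longlonglongrightarrow> poly ?H (t_par \<iota> \<pi> z)" if z: "z \<in> Omega \<iota>" for z
    proof -
      have "?S n z D = 1 / fin_exp (\<Lambda>_below D) (\<pi> * z) *
          (\<Sum>i=1..<n. coeff (fin_exp_poly (\<Lambda>_below D)) i * ?S (n - i) z D)" for D
        using sum_inverse_power_recursion[OF fin_subgroup_\<Lambda>_below translate_nonzero_\<Lambda>_below[OF z] n]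
        by (simp add: sum_\<Lambda>_below)
      moreover have "(\<lambda>D. 1 / fin_exp (\<Lambda>_below D) (\<pi> * z) *
          (\<Sum>i=1..<n. coeff (fin_exp_poly (\<Lambda>_below D)) i * ?S (n - i) z D))
          \<longlonglongrightarrow> t_par \<iota> \<pi> z * (\<Sum>i=1..<n. exp_coeff i * poly (G (n - i)) (t_par \<iota> \<pi> z))"
        using G z by (intro tendsto_mult tendsto_sum t_par_limit exp_coeff_limit inverse_power_limit) auto
      ultimately show ?thesis
        by (simp add: poly_sum)
    qed
    then have "?goss n ?H"
      by (intro from_limit) (simp_all add: mult_pCons_left)
    then show ?thesis
      by blast
  qed
qed

text \<open>Needed for the \<open>THE\<close> in \<open>goss_poly\<close>: a polynomial is
  determined by infinitely many values. The points are translates of \<open>z\<close> by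
  \<open>\<iota> (x l)\<close>, whose images under \<open>lattice_exp\<close> have pairwise
  different absolute values.\<close>

lemma infinite_t_par_values:
  assumes "z \<in> Omega \<iota>"
  shows "infinite (t_par \<iota> \<pi> ` Omega \<iota>)"
proof -
  define x where "x l = (fls_X ^ Suc l :: 'a fls)" for l
  have x: "vabs (\<iota> (x l)) = 1 / q ^ Suc l" for l
  proof -
    have nz: "x l \<noteq> 0" and deg: "fls_subdegree (x l) = int (Suc l)"
      by (simp_all add: x_def)
    show ?thesis
      unfolding vabs_\<iota>[OF nz] deg by (simp only: power_int_minus power_int_of_nat inverse_eq_divide)
  qed
  have e: "vabs (lattice_exp \<Lambda> (\<pi> * \<iota> (x l))) = vabs \<pi> / q ^ Suc l" for l
  proof -
    have "1 < q ^ Suc l"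
      by (rule one_less_power) auto
    then have "vabs (\<pi> * \<iota> (x l)) < vabs \<pi>"
      unfolding vabs_mult x using period_nonzero by (simp add: field_simps)
    then show ?thesis
      by (simp add: vabs_lattice_exp_small vabs_mult x)
  qed
  have \<Omega>: "z + \<iota> (x l) \<in> Omega \<iota>" for l
    by (rule Omega_add[OF assms])
  have "inj (\<lambda>l. t_par \<iota> \<pi> (z + \<iota> (x l)))"
  proof (rule injI)
    fix l m
    assume "t_par \<iota> \<pi> (z + \<iota> (x l)) = t_par \<iota> \<pi> (z + \<iota> (x m))"
    then have "lattice_exp \<Lambda> (\<pi> * (z + \<iota> (x l))) = lattice_exp \<Lambda> (\<pi> * (z + \<iota> (x m)))"
      by (simp add: t_par_def lattice_exp_nonzero \<Omega>)
    then have "lattice_exp \<Lambda> (\<pi> * \<iota> (x l)) = lattice_exp \<Lambda> (\<pi> * \<iota> (x m))"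
      by (simp add: distrib_left lattice_exp_add)
    then have "vabs \<pi> / q ^ Suc l = vabs \<pi> / q ^ Suc m"
      by (simp only: e[symmetric])
    then have "q ^ Suc l = q ^ Suc m"
      using period_nonzero by (simp del: power_Suc)
    then show "l = m"
      using power_inject_exp[OF q_gt_1, of "Suc l" "Suc m"] by (simp only:)
  qed
  then have "infinite (range (\<lambda>l. t_par \<iota> \<pi> (z + \<iota> (x l))))"
    by (rule range_inj_infinite)
  moreover have "range (\<lambda>l. t_par \<iota> \<pi> (z + \<iota> (x l))) \<subseteq> t_par \<iota> \<pi> ` Omega \<iota>"
    using \<Omega> by blast
  ultimately show ?thesis
    using infinite_super by blast
qed

text \<open>The point \<open>z\<close> also shows that \<open>Omega \<iota>\<close> is nonempty; the
  uniqueness behind \<open>THE\<close>, and with it the statement on the constant coefficient, rests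
  on that.\<close>

lemma goss_poly_spec:
  assumes "z \<in> Omega \<iota>" and "n \<ge> 1"
  shows "coeff (goss_poly \<iota> \<pi> n) 0 = 0"
    and "((\<lambda>b. 1 / (\<pi> * z + \<pi> * emb \<iota> b) ^ n)
    has_sum poly (goss_poly \<iota> \<pi> n) (t_par \<iota> \<pi> z)) UNIV"
proof -
  let ?goss = "\<lambda>G. \<forall>z\<in>Omega \<iota>.
    ((\<lambda>b. 1 / (\<pi> * z + \<pi> * emb \<iota> b) ^ n) has_sum poly G (t_par \<iota> \<pi> z)) UNIV"
  obtain G where G0: "coeff G 0 = 0" and G: "?goss G"
    using goss_poly_exists[OF assms(2)] by blast
  have uniq: "H = G" if "?goss H" for H
  proof (rule ccontr)
    assume "H \<noteq> G"
    then have "finite {t. poly (H - G) t = 0}"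
      by (intro poly_roots_finite) simp
    moreover have "t_par \<iota> \<pi> ` Omega \<iota> \<subseteq> {t. poly (H - G) t = 0}"
    proof (rule image_subsetI, rule CollectI)
      fix x
      assume "x \<in> Omega \<iota>"
      then show "poly (H - G) (t_par \<iota> \<pi> x) = 0"
        using G that has_sum_unique by fastforce
    qed
    ultimately show False
      using infinite_t_par_values[OF assms(1)] finite_subset by blast
  qed
  have "goss_poly \<iota> \<pi> n = G"
    unfolding goss_poly_def by (rule the_equality, rule G, rule uniq)
  then show "coeff (goss_poly \<iota> \<pi> n) 0 = 0" and "((\<lambda>b. 1 / (\<pi> * z + \<pi> * emb \<iota> b) ^ n)
      has_sum poly (goss_poly \<iota> \<pi> n) (t_par \<iota> \<pi> z)) UNIV"
    using G0 bspec[OF G assms(1)] by simp_all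
qed

lemma goss_poly_limit:
  assumes "z \<in> Omega \<iota>" and "n \<ge> 1"
  shows "(\<lambda>D. \<Sum>b\<in>below D. 1 / (\<pi> * z + \<pi> * emb \<iota> b) ^ n) \<longlonglongrightarrow> poly (goss_poly \<iota> \<pi> n) (t_par \<iota> \<pi> z)"
  by (rule inverse_power_limit[OF goss_poly_spec(2)[OF assms]])

end

section \<open>Summation over cosets\<close>

text \<open>Cosets of \<open>H\<close> are removed from \<open>U\<close> one at a time.
  \<open>Z\<close> is just a set containing 0 and closed under addition, so that it can be a ball
  \<open>{x. vabs x \<le> \<epsilon>}\<close> as well as \<open>{0}\<close>.\<close>

lemma sum_stable_in:
  fixes g :: "'g::ab_group_add \<Rightarrow> 'c::comm_monoid_add"
  assumes H: "fin_subgroup H" and "finite U"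
    and "\<And>u h. u \<in> U \<Longrightarrow> h \<in> H \<Longrightarrow> u + h \<in> U"
    and "\<And>u. u \<in> U \<Longrightarrow> (\<Sum>h\<in>H. g (u + h)) \<in> Z"
    and Z: "0 \<in> Z" "\<And>x y. x \<in> Z \<Longrightarrow> y \<in> Z \<Longrightarrow> x + y \<in> Z"
  shows "sum g U \<in> Z"
  using assms(2-4)
proof (induction U rule: finite_psubset_induct)
  case (psubset U)
  show ?case
  proof (cases "U = {}")
    case False
    then obtain u where u: "u \<in> U"
      by blast
    define C where "C = (\<lambda>h. u + h) ` H"
    have C: "C \<subseteq> U" "u \<in> C"
      using psubset.prems(1) u fin_subgroupD(2)[OF H] by (auto simp: C_def intro!: image_eqI[of _ _ 0])
    have "v + h \<in> U - C" if "v \<in> U - C" "h \<in> H" for v h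
    proof -
      have "v + h \<notin> C"
      proof
        assume "v + h \<in> C"
        then obtain h' where "h' \<in> H" "v + h = u + h'"
          by (auto simp: C_def)
        then have "v = u + (h' - h)" "h' - h \<in> H"
          using that(2) fin_subgroupD(3)[OF H] by (auto simp: algebra_simps)
        then show False
          using that(1) by (auto simp: C_def)
      qed
      then show ?thesis
        using psubset.prems(1) that by blast
    qed
    then have "sum g (U - C) \<in> Z"
      using C u psubset.prems(2) by (intro psubset.IH) auto
    moreover have "sum g C = (\<Sum>h\<in>H. g (u + h))"
      unfolding C_def by (subst sum.reindex) (auto simp: inj_on_def)
    then have "sum g C \<in> Z"
      using psubset.prems(2)[OF u] by simp
    moreover have "sum g U = sum g (U - C) + sum g C"
      using C(1) psubset.hyps by (rule sum.subset_diff)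
    ultimately show ?thesis
      using Z(2) by simp
  qed (use Z in auto)
qed

text \<open>Finite unions of cosets of \<open>{0} \<times> below j\<close>. Translations act on the
  second coordinate only, because power sums are taken over \<open>b\<close> at fixed
  \<open>a\<close>.\<close>

definition stable :: "nat \<Rightarrow> ('a::{finite,field} poly \<times> 'a poly) set \<Rightarrow> bool" where
  "stable j U \<longleftrightarrow> finite U \<and> (\<forall>u\<in>U. \<forall>b\<in>below j. u + (0, b) \<in> U)"

lemma stable_times: "j \<le> E \<Longrightarrow> finite A \<Longrightarrow> stable j (A \<times> below E)"
  unfolding stable_def using below_mono[of j E] below_add by fastforce

lemma stable_diff:
  fixes U V :: "('a::{finite,field} poly \<times> 'a poly) set"
  assumes "stable j U" and "stable j V"
  shows "stable j (U - V)"
  unfolding stable_def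
proof (intro conjI ballI)
  show "finite (U - V)"
    using assms(1) by (simp add: stable_def)
  fix u :: "'a poly \<times> 'a poly" and b :: "'a poly"
  assume u: "u \<in> U - V" and b: "b \<in> below j"
  have "u + (0, b) \<notin> V"
  proof
    assume "u + (0, b) \<in> V"
    moreover have "- b \<in> below j"
      using b by (auto simp: below_def)
    ultimately have "u + (0, b) + (0, - b) \<in> V"
      using assms(2) by (simp only: stable_def)
    then show False
      using u by (simp add: add.assoc plus_prod_def)
  qed
  then show "u + (0, b) \<in> U - V"
    using assms(1) u b by (auto simp: stable_def)
qed

lemma sum_stable_in_below:
  fixes g :: "'a::{finite,field} poly \<times> 'a poly \<Rightarrow> 'c::comm_monoid_add"
  assumes "stable j U" and "\<And>a b. (a, b) \<in> U \<Longrightarrow> (\<Sum>b'\<in>below j. g (a, b + b')) \<in> Z"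
    and "0 \<in> Z" "\<And>x y. x \<in> Z \<Longrightarrow> y \<in> Z \<Longrightarrow> x + y \<in> Z"
  shows "sum g U \<in> Z"
proof (rule sum_stable_in[where H = "Pair 0 ` below j"])
  show "fin_subgroup (Pair (0 :: 'a poly) ` below j :: ('a poly \<times> 'a poly) set)"
    unfolding fin_subgroup_def using below_diff by (auto simp: zero_prod_def)
  show "(\<Sum>h\<in>Pair 0 ` below j. g (u + h)) \<in> Z" if "u \<in> U" for u
    using assms(2)[of "fst u" "snd u"] that
    by (subst sum.reindex) (auto simp: inj_on_def plus_prod_def)
qed (use assms in \<open>auto simp: stable_def\<close>)

definition deg_box :: "nat \<Rightarrow> ('a::{finite,field} poly \<times> 'a poly) set" where
  "deg_box D = below D \<times> below D"

lemma finite_deg_box [simp]: "finite (deg_box D)"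
  by (simp add: deg_box_def)

lemma deg_box_mono: "D \<le> E \<Longrightarrow> deg_box D \<subseteq> deg_box E"
  unfolding deg_box_def using below_mono by blast

lemma stable_deg_box: "j \<le> D \<Longrightarrow> stable j (deg_box D)"
  unfolding deg_box_def by (intro stable_times) auto

section \<open>The double series\<close>

locale double_series = period_scale \<iota> q \<pi>
  for \<iota> :: "'a::{finite,field} fls \<Rightarrow> 'c::{nonarch_field,complete_space}" and q :: real and \<pi> :: 'c +
  fixes k n :: nat
  assumes n_pos: "n > 0" and k_gt: "k > 2 * n"
begin

text \<open>The pair \<open>(0, 0)\<close> contributes 0, since the numerator is
  \<open>0 ^ (k - n)\<close> with \<open>k > n\<close>.\<close>

definition summand :: "'c \<Rightarrow> 'a poly \<times> 'a poly \<Rightarrow> 'c" where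
  "summand z = (\<lambda>(a, b). emb \<iota> a ^ (k - n) / (emb \<iota> a * z + emb \<iota> b) ^ n)"

text \<open>\<open>J\<close> has two roles: it is the degree of the first surviving term in the
  binomial expansion of a coset sum, and \<open>below J\<close> is a group large enough, by
  \<open>J < q ^ J\<close>, for all earlier terms to cancel.\<close>

definition J :: nat where "J = k - 2 * n + 1"

lemma J_less_card_power: "k - 2 * n + 1 < CARD('a) ^ J"
proof -
  have "J < 2 ^ J"
    by (rule less_exp)
  also have "\<dots> \<le> CARD('a) ^ J"
    by (intro power_mono card_finite_field_ge_2) auto
  finally show ?thesis
    by (simp add: J_def)
qed

text \<open>Expand \<open>(y + b)\<^sup>-\<^sup>n\<close> in powers of \<open>b / y\<close>: up to degree \<open>k - 2n\<close> the power sums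
  over \<open>b\<close> vanish.\<close>

lemma vabs_coset_sum_le:
  assumes y: "vabs y \<ge> q ^ J"
  shows "vabs (\<Sum>b\<in>below J. 1 / (y + emb \<iota> b) ^ n) \<le> 1 / vabs y ^ n * (q ^ J / vabs y) ^ J"
proof -
  let ?L = "k - 2 * n"
  let ?P = "\<lambda>u. \<Sum>i\<le>?L. of_int (neg_binom n i) * u ^ i :: 'c"
  have y_pos: "vabs y > 0"
    using y zero_less_power[OF q_pos, of J] by linarith
  then have y0: "y \<noteq> 0"
    by auto
  have "(\<Sum>b\<in>below J. ?P (emb \<iota> b / y))
      = (\<Sum>i\<le>?L. of_int (neg_binom n i) / y ^ i * (\<Sum>b\<in>below J. (0 + emb \<iota> b) ^ i))"
    unfolding sum_distrib_left by (subst sum.swap) (simp add: power_divide)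
  also have "\<dots> = 0"
  proof (intro sum.neutral ballI)
    fix i
    assume "i \<in> {..?L}"
    then have "(\<Sum>b\<in>below J. (0 + emb \<iota> b) ^ i) = 0"
      using J_less_card_power by (intro sum_below_power_eq_0) auto
    then show "of_int (neg_binom n i) / y ^ i * (\<Sum>b\<in>below J. (0 + emb \<iota> b) ^ i) = 0"
      by simp
  qed
  finally have P0: "(\<Sum>b\<in>below J. ?P (emb \<iota> b / y)) = 0" .
  have le: "vabs (\<Sum>b\<in>below J. ?P (emb \<iota> b / y) - 1 / (1 + emb \<iota> b / y) ^ n) \<le> (q ^ J / vabs y) ^ J"
  proof (rule vabs_sum_le)
    fix b :: "'a poly"
    assume "b \<in> below J"
    then have b: "vabs (emb \<iota> b) < q ^ J"
      by (simp add: in_below_iff)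
    with y have "vabs (emb \<iota> b) < vabs y"
      by linarith
    then have "vabs (emb \<iota> b / y) < 1"
      using y_pos by (simp add: vabs_divide)
    then have "vabs (?P (emb \<iota> b / y) - 1 / (1 + emb \<iota> b / y) ^ n) \<le> vabs (emb \<iota> b / y) ^ Suc ?L"
      by (rule neg_binom_expansion)
    also have "\<dots> \<le> (q ^ J / vabs y) ^ Suc ?L"
      using b y_pos by (intro power_mono) (auto simp: vabs_divide divide_right_mono)
    finally show "vabs (?P (emb \<iota> b / y) - 1 / (1 + emb \<iota> b / y) ^ n) \<le> (q ^ J / vabs y) ^ J"
      by (simp add: J_def)
  qed (use y_pos in auto)
  have "1 / (y + emb \<iota> b) ^ n = - 1 / y ^ n * (?P (emb \<iota> b / y) - 1 / (1 + emb \<iota> b / y) ^ n)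
      + 1 / y ^ n * ?P (emb \<iota> b / y)" for b
  proof -
    have "y + emb \<iota> b = y * (1 + emb \<iota> b / y)"
      using y0 by (simp add: distrib_left)
    then have "1 / (y + emb \<iota> b) ^ n = 1 / y ^ n * (1 / (1 + emb \<iota> b / y) ^ n)"
      by (simp add: power_mult_distrib)
    then show ?thesis
      by (simp add: algebra_simps)
  qed
  then have "(\<Sum>b\<in>below J. 1 / (y + emb \<iota> b) ^ n)
      = - 1 / y ^ n * (\<Sum>b\<in>below J. ?P (emb \<iota> b / y) - 1 / (1 + emb \<iota> b / y) ^ n)
        + 1 / y ^ n * (\<Sum>b\<in>below J. ?P (emb \<iota> b / y))"
    by (simp only: sum.distrib sum_distrib_left)
  also have "\<dots> = - 1 / y ^ n * (\<Sum>b\<in>below J. ?P (emb \<iota> b / y) - 1 / (1 + emb \<iota> b / y) ^ n)"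
    by (simp only: P0) simp
  finally have "vabs (\<Sum>b\<in>below J. 1 / (y + emb \<iota> b) ^ n)
      = 1 / vabs y ^ n * vabs (\<Sum>b\<in>below J. ?P (emb \<iota> b / y) - 1 / (1 + emb \<iota> b / y) ^ n)"
    by (simp only: vabs_mult vabs_divide vabs_power vabs_minus vabs_1)
  then show ?thesis
    using mult_left_mono[OF le, of "1 / vabs y ^ n"] by simp
qed

text \<open>Outside a large box \<open>az + b\<close> is uniformly large on the affinoid, and a
  coset sum is bounded by a constant over its absolute value. \<open>R\<close> is chosen before
  \<open>z\<close> and \<open>U\<close>.\<close>

lemma vabs_stable_sum_le:
  assumes "\<epsilon> > 0"
  shows "\<exists>R. \<forall>z\<in>Omega_affinoid \<iota> N. \<forall>U. stable J U \<and> U \<inter> deg_box R = {} \<longrightarrow> vabs (sum (summand z) U) \<le> \<epsilon>"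
proof -
  \<comment> \<open>With \<open>Y = vabs (az + b)\<close> a coset sum is at most
    \<open>(q ^ N * Y) ^ (k - n) / Y ^ n * (q ^ J / Y) ^ J\<close>. The exponent of \<open>Y\<close>
    is \<open>k - 2n - J = -1\<close>, and \<open>C\<close> collects the rest.\<close>
  define C where "C = q ^ (N * (k - n)) * q ^ (J * J)"
  have C: "C > 0"
    by (simp add: C_def)
  obtain s0 where s0: "q ^ s0 > C / \<epsilon>"
    using real_arch_pow[OF q_gt_1] by blast
  define s where "s = max s0 J"
  \<comment> \<open>The part \<open>2 * N\<close> pays for the constant in
    \<open>affinoid_linear_form_bounds\<close>, so that \<open>vabs (az + b) \<ge> q ^ s\<close> for
    pairs outside the box.\<close>
  define R where "R = 2 * N + s"
  have "q ^ s0 \<le> q ^ s"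
    using q_ge_2 by (intro power_increasing) (auto simp: s_def)
  with s0 have "C / \<epsilon> \<le> q ^ s"
    by linarith
  then have s: "C / q ^ s \<le> \<epsilon>"
    using assms by (simp add: field_simps)
  have "vabs (sum (summand z) U) \<le> \<epsilon>"
    if z: "z \<in> Omega_affinoid \<iota> N" and U: "stable J U" "U \<inter> deg_box R = {}" for z U
  proof -
    have "sum (summand z) U \<in> {x. vabs x \<le> \<epsilon>}"
    proof (rule sum_stable_in_below[OF U(1)])
      fix a b
      assume "(a, b) \<in> U"
      then have "(a, b) \<notin> deg_box R"
        using U(2) by blast
      then have ab: "vabs (emb \<iota> a) \<ge> q ^ R \<or> vabs (emb \<iota> b) \<ge> q ^ R"
        by (auto simp: deg_box_def in_below_iff not_less)
      define y where "y = emb \<iota> a * z + emb \<iota> b"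
      define Y where "Y = vabs y"
      have a: "vabs (emb \<iota> a) \<le> q ^ N * Y" and b: "vabs (emb \<iota> b) \<le> q ^ (2 * N) * Y"
        using affinoid_linear_form_bounds[OF z] by (auto simp: Y_def y_def)
      have "q ^ N * Y \<le> q ^ (2 * N) * Y"
        using q_ge_2 by (intro mult_right_mono power_increasing) (auto simp: Y_def)
      with a b ab have "q ^ R \<le> q ^ (2 * N) * Y"
        by linarith
      then have Ys: "q ^ s \<le> Y"
        by (simp add: R_def power_add)
      have "q ^ J \<le> q ^ s"
        using q_ge_2 by (intro power_increasing) (auto simp: s_def)
      with Ys have YJ: "q ^ J \<le> Y"
        by linarith
      have Y: "Y > 0"
        using YJ zero_less_power[OF q_pos, of J] by linarith
      have "(\<Sum>b'\<in>below J. summand z (a, b + b'))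
          = emb \<iota> a ^ (k - n) * (\<Sum>b'\<in>below J. 1 / (y + emb \<iota> b') ^ n)"
        unfolding sum_distrib_left by (simp add: summand_def y_def emb_add add.assoc)
      also have "vabs \<dots> \<le> (q ^ N * Y) ^ (k - n) * (1 / Y ^ n * (q ^ J / Y) ^ J)"
        unfolding vabs_mult vabs_power using vabs_coset_sum_le[of y] YJ a Y
        by (intro mult_mono power_mono) (auto simp: Y_def)
      also have "\<dots> = C / Y"
      proof -
        have "k - n + 1 = n + J"
          using k_gt by (simp add: J_def)
        then have "Y ^ (k - n) * Y = Y ^ n * Y ^ J"
          by (metis Suc_eq_plus1 power_Suc2 power_add)
        then have "Y ^ (k - n) / (Y ^ n * Y ^ J) = 1 / Y"
          using Y by (simp add: frac_eq_eq)
        moreover have "(q ^ N * Y) ^ (k - n) * (1 / Y ^ n * (q ^ J / Y) ^ J)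
            = C * (Y ^ (k - n) / (Y ^ n * Y ^ J))"
          by (simp add: C_def power_mult_distrib power_divide flip: power_mult)
        ultimately show ?thesis
          by simp
      qed
      also have "\<dots> \<le> C / q ^ s"
        using C Ys by (intro divide_left_mono) (auto intro!: mult_pos_pos Y)
      finally show "(\<Sum>b'\<in>below J. summand z (a, b + b')) \<in> {x. vabs x \<le> \<epsilon>}"
        using s by simp
    next
      fix x y :: 'c
      assume "x \<in> {x. vabs x \<le> \<epsilon>}" "y \<in> {x. vabs x \<le> \<epsilon>}"
      then show "x + y \<in> {x. vabs x \<le> \<epsilon>}"
        using vabs_add[of x y] by simp
    qed (use assms in auto)
    then show ?thesis
      by simp
  qed
  then show ?thesis
    by blast
qed

definition total :: "'c \<Rightarrow> 'c" where
  "total z = lim (\<lambda>D. sum (summand z) (deg_box D))"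

lemma vabs_sum_diff_deg_box_le:
  assumes "\<epsilon> > 0"
  shows "\<exists>R. \<forall>z\<in>Omega_affinoid \<iota> N. \<forall>U. stable J U \<and> deg_box R \<subseteq> U \<longrightarrow>
    vabs (sum (summand z) U - sum (summand z) (deg_box R)) \<le> \<epsilon>"
proof -
  obtain R0 where R0: "\<And>z U. z \<in> Omega_affinoid \<iota> N \<Longrightarrow> stable J U \<Longrightarrow> U \<inter> deg_box R0 = {} \<Longrightarrow>
      vabs (sum (summand z) U) \<le> \<epsilon>"
    using vabs_stable_sum_le[OF assms] by blast
  \<comment> \<open>With \<open>R \<ge> J\<close> the box itself is stable, and so is its complement
    in \<open>U\<close>.\<close>
  define R where "R = max R0 J"
  have "vabs (sum (summand z) U - sum (summand z) (deg_box R)) \<le> \<epsilon>"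
    if z: "z \<in> Omega_affinoid \<iota> N" and U: "stable J U" "deg_box R \<subseteq> U" for z U
  proof -
    have "sum (summand z) U - sum (summand z) (deg_box R) = sum (summand z) (U - deg_box R)"
      using U by (simp add: sum_diff stable_def)
    also have "vabs \<dots> \<le> \<epsilon>"
    proof (rule R0[OF z])
      show "stable J (U - deg_box R)"
        using U(1) by (intro stable_diff stable_deg_box) (auto simp: R_def)
      show "(U - deg_box R) \<inter> deg_box R0 = {}"
        using deg_box_mono[of R0 R] by (auto simp: R_def)
    qed
    finally show ?thesis .
  qed
  then show ?thesis
    by blast
qed

lemma total_limit:
  assumes "z \<in> Omega \<iota>"
  shows "(\<lambda>D. sum (summand z) (deg_box D)) \<longlonglongrightarrow> total z"
  unfolding total_def convergent_LIMSEQ_iff[symmetric]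
proof (rule nonarch_Cauchy_convergent)
  fix \<epsilon> :: real
  assume \<epsilon>: "\<epsilon> > 0"
  obtain N where z: "z \<in> Omega_affinoid \<iota> N"
    using Omega_in_affinoid[OF assms] .
  obtain R where R: "\<And>U. stable J U \<Longrightarrow> deg_box R \<subseteq> U \<Longrightarrow>
      vabs (sum (summand z) U - sum (summand z) (deg_box R)) \<le> \<epsilon>"
    using vabs_sum_diff_deg_box_le[OF \<epsilon>] z by blast
  have le: "vabs (sum (summand z) (deg_box D) - sum (summand z) (deg_box R)) \<le> \<epsilon>" if "D \<ge> max R J" for D
    using that by (intro R stable_deg_box deg_box_mono) auto
  have "vabs (sum (summand z) (deg_box D) - sum (summand z) (deg_box (max R J))) \<le> \<epsilon>" if "D \<ge> max R J" for D
  proof -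
    have eq: "sum (summand z) (deg_box D) - sum (summand z) (deg_box (max R J))
        = (sum (summand z) (deg_box D) - sum (summand z) (deg_box R))
          - (sum (summand z) (deg_box (max R J)) - sum (summand z) (deg_box R))"
      by simp
    show ?thesis
      unfolding eq
      using vabs_diff[of "sum (summand z) (deg_box D) - sum (summand z) (deg_box R)"
          "sum (summand z) (deg_box (max R J)) - sum (summand z) (deg_box R)"] le[of D] le[of "max R J"] that
      by linarith
  qed
  then show "\<exists>M. \<forall>D\<ge>M. vabs (sum (summand z) (deg_box D) - sum (summand z) (deg_box M)) \<le> \<epsilon>"
    by blast
qed

text \<open>Uniformity in \<open>z\<close> gives rigid analyticity; uniformity in \<open>U\<close>
  gives the freedom to compute \<open>total\<close> along any stable exhaustion.\<close>

lemma vabs_sum_diff_total_le: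
  assumes "\<epsilon> > 0"
  shows "\<exists>R. \<forall>z\<in>Omega_affinoid \<iota> N. \<forall>U. stable J U \<and> deg_box R \<subseteq> U \<longrightarrow>
    vabs (sum (summand z) U - total z) \<le> \<epsilon>"
proof -
  obtain R where R: "\<And>z U. z \<in> Omega_affinoid \<iota> N \<Longrightarrow> stable J U \<Longrightarrow> deg_box R \<subseteq> U \<Longrightarrow>
      vabs (sum (summand z) U - sum (summand z) (deg_box R)) \<le> \<epsilon>"
    using vabs_sum_diff_deg_box_le[OF assms] by blast
  have "vabs (sum (summand z) U - total z) \<le> \<epsilon>"
    if z: "z \<in> Omega_affinoid \<iota> N" and U: "stable J U" "deg_box R \<subseteq> U" for z U
  proof (rule vabs_lim_le)
    show "(\<lambda>D. sum (summand z) U - sum (summand z) (deg_box D)) \<longlonglongrightarrow> sum (summand z) U - total z"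
      by (intro tendsto_diff tendsto_const total_limit affinoid_in_Omega[OF z])
    show "\<forall>\<^sub>F D in sequentially. vabs (sum (summand z) U - sum (summand z) (deg_box D)) \<le> \<epsilon>"
    proof (rule eventually_sequentiallyI[of "max R J"])
      fix D
      assume D: "D \<ge> max R J"
      have "vabs (sum (summand z) (deg_box D) - sum (summand z) (deg_box R)) \<le> \<epsilon>"
        using D by (intro R z stable_deg_box deg_box_mono) auto
      moreover have eq: "sum (summand z) U - sum (summand z) (deg_box D)
          = (sum (summand z) U - sum (summand z) (deg_box R))
            - (sum (summand z) (deg_box D) - sum (summand z) (deg_box R))"
        by simp
      ultimately show "vabs (sum (summand z) U - sum (summand z) (deg_box D)) \<le> \<epsilon>"
        unfolding eq
        using vabs_diff[of "sum (summand z) U - sum (summand z) (deg_box R)"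
            "sum (summand z) (deg_box D) - sum (summand z) (deg_box R)"] R[OF z U] by linarith
    qed
  qed simp
  then show ?thesis
    by blast
qed

section \<open>From the double series to the series over monic polynomials\<close>

lemma scaled_in_Omega:
  assumes "z \<in> Omega \<iota>" and "a \<noteq> 0"
  shows "emb \<iota> a * z \<in> Omega \<iota>"
proof -
  have "emb \<iota> a * z \<noteq> \<iota> x" for x
  proof
    assume "emb \<iota> a * z = \<iota> x"
    then have "z = \<iota> x / emb \<iota> a"
      using assms(2) by (simp add: field_simps)
    then show False
      using assms(1) by (auto simp: Omega_def emb_def simp flip: \<iota>_divide)
  qed
  then show ?thesis
    by (auto simp: Omega_def)
qed

text \<open>At fixed \<open>a \<noteq> 0\<close> the sum over \<open>b\<close> converges by itself,
  being the Goss sum at the point \<open>az\<close>; \<open>\<pi> ^ n\<close> accounts for the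
  scaling of the lattice.\<close>

lemma f_summand_limit:
  assumes "z \<in> Omega \<iota>" and "a \<noteq> 0"
  shows "(\<lambda>E. (\<Sum>b\<in>below E. summand z (a, b)) / \<pi> ^ n) \<longlonglongrightarrow> f_summand \<iota> \<pi> k n z a"
proof -
  have "(\<lambda>E. emb \<iota> a ^ (k - n) * (\<Sum>b\<in>below E. 1 / (\<pi> * (emb \<iota> a * z) + \<pi> * emb \<iota> b) ^ n))
      \<longlonglongrightarrow> f_summand \<iota> \<pi> k n z a"
    unfolding f_summand_def
    using goss_poly_limit[OF scaled_in_Omega[OF assms], of n] n_pos by (intro tendsto_mult) auto
  moreover have "emb \<iota> a ^ (k - n) * (\<Sum>b\<in>below E. 1 / (\<pi> * (emb \<iota> a * z) + \<pi> * emb \<iota> b) ^ n)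
      = (\<Sum>b\<in>below E. summand z (a, b)) / \<pi> ^ n" for E
    unfolding sum_distrib_left sum_divide_distrib
    by (intro sum.cong refl) (simp add: summand_def mult.commute power_mult_distrib flip: distrib_left)
  ultimately show ?thesis
    by simp
qed

text \<open>A slice \<open>{a} \<times> below E\<close> is stable for \<open>E \<ge> J\<close> and
  avoids \<open>deg_box R\<close> once \<open>a \<notin> below R\<close>; so the terms tend to
  0.\<close>

lemma f_summand_summable:
  assumes z: "z \<in> Omega \<iota>"
  shows "f_summand \<iota> \<pi> k n z summable_on A_plus"
proof (rule nonarch_summable_on)
  fix \<epsilon> :: real
  assume \<epsilon>: "\<epsilon> > 0"
  obtain N where N: "z \<in> Omega_affinoid \<iota> N"
    using Omega_in_affinoid[OF z] .
  have "\<epsilon> * vabs \<pi> ^ n > 0"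
    using \<epsilon> period_nonzero by simp
  then obtain R where R: "\<And>U. stable J U \<Longrightarrow> U \<inter> deg_box R = {} \<Longrightarrow>
      vabs (sum (summand z) U) \<le> \<epsilon> * vabs \<pi> ^ n"
    using vabs_stable_sum_le N by blast
  have "vabs (f_summand \<iota> \<pi> k n z a) \<le> \<epsilon>" if "a \<notin> below R" for a
  proof (rule vabs_lim_le[OF f_summand_limit[OF z]])
    show "a \<noteq> 0"
      using that by auto
    show "\<forall>\<^sub>F E in sequentially. vabs ((\<Sum>b\<in>below E. summand z (a, b)) / \<pi> ^ n) \<le> \<epsilon>"
    proof (rule eventually_sequentiallyI[of J])
      fix E
      assume "E \<ge> J"
      then have "vabs (sum (summand z) ({a} \<times> below E)) \<le> \<epsilon> * vabs \<pi> ^ n"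
        using that by (intro R stable_times) (auto simp: deg_box_def)
      then have "vabs (\<Sum>b\<in>below E. summand z (a, b)) \<le> \<epsilon> * vabs \<pi> ^ n"
        by (simp add: sum.cartesian_product' )
      then show "vabs ((\<Sum>b\<in>below E. summand z (a, b)) / \<pi> ^ n) \<le> \<epsilon>"
        using period_nonzero by (simp add: vabs_divide vabs_power divide_le_eq)
    qed
  qed simp
  then have "{a \<in> A_plus. vabs (f_summand \<iota> \<pi> k n z a) > \<epsilon>} \<subseteq> below R"
    by force
  then show "finite {a \<in> A_plus. vabs (f_summand \<iota> \<pi> k n z a) > \<epsilon>}"
    by (rule finite_subset) simp
qed

end

lemma (in C_infinity) \<iota>_const_power_card_minus_1:
  assumes "c \<noteq> 0" and "(CARD('a) - 1) dvd i"
  shows "\<iota> (fls_const c) ^ i = 1"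
proof -
  from assms(2) obtain l where "i = (CARD('a) - 1) * l"
    by (elim dvdE)
  then have "c ^ i = 1"
    using finite_field_power_card_minus_1[OF assms(1)] by (simp add: power_mult)
  then have "\<iota> (fls_const c ^ i) = 1"
    by (simp flip: fls_const_power)
  then show ?thesis
    by (simp add: \<iota>_power)
qed

locale twisted_double_series = double_series \<iota> q \<pi> k n
  for \<iota> :: "'a::{finite,field} fls \<Rightarrow> 'c::{nonarch_field,complete_space}" and q :: real
    and \<pi> :: 'c and k n :: nat +
  assumes weight_dvd: "(CARD('a) - 1) dvd (k - 2 * n)"
begin

text \<open>The summand is homogeneous of degree \<open>k - 2n\<close>, and
  \<open>c ^ (k - 2n) = 1\<close> because \<open>q - 1\<close> divides the exponent.\<close>

lemma summand_smult:
  assumes "c \<noteq> 0"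
  shows "summand z (smult c a, smult c b) = summand z (a, b)"
proof -
  let ?c = "\<iota> (fls_const c)"
  have c0: "?c \<noteq> 0"
    using assms by simp
  have "?c ^ (k - n) = ?c ^ n * ?c ^ (k - 2 * n)"
    using k_gt by (simp flip: power_add)
  then have c: "?c ^ (k - n) = ?c ^ n"
    using \<iota>_const_power_card_minus_1[OF assms weight_dvd] by simp
  have "summand z (smult c a, smult c b)
      = (?c ^ (k - n) * emb \<iota> a ^ (k - n)) / (?c * (emb \<iota> a * z + emb \<iota> b)) ^ n"
    by (simp add: summand_def emb_smult power_mult_distrib algebra_simps)
  also have "\<dots> = summand z (a, b)"
    using c0 by (simp add: c summand_def power_mult_distrib)
  finally show ?thesis .
qed

text \<open>Every orbit of the nonzero constants on nonzero polynomials contains one monic element,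
  and \<open>q - 1 = -1\<close> in \<open>\<complex>\<^sub>\<infinity>\<close>.\<close>

lemma sum_rectangle_eq_monic:
  "sum (summand z) (below D \<times> below E) = - (\<Sum>a\<in>A_plus \<inter> below D. \<Sum>b\<in>below E. summand z (a, b))"
proof -
  define \<Phi> where "\<Phi> a = (\<Sum>b\<in>below E. summand z (a, b))" for a
  have \<Phi>_smult: "\<Phi> (smult c a) = \<Phi> a" if "c \<noteq> 0" for c a
  proof -
    have "\<Phi> (smult c a) = (\<Sum>b\<in>below E. summand z (smult c a, smult c b))"
      unfolding \<Phi>_def
      by (rule sum.reindex_bij_witness[of _ "smult c" "smult (inverse c)"])
        (use that in \<open>auto intro: below_smult\<close>)
    then show ?thesis
      using that by (simp add: summand_smult \<Phi>_def)
  qed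
  have "k - n > 0"
    using k_gt by simp
  then have \<Phi>_0: "\<Phi> 0 = 0"
    by (simp add: \<Phi>_def summand_def power_0_left)
  have "sum (summand z) (below D \<times> below E) = (\<Sum>a\<in>below D. \<Phi> a)"
    by (simp add: \<Phi>_def sum.cartesian_product)
  also have "\<dots> = (\<Sum>a\<in>below D - {0}. \<Phi> a)"
    using \<Phi>_0 by (intro sum.mono_neutral_right) auto
  also have "\<dots> = (\<Sum>(c, a)\<in>(UNIV - {0}) \<times> (A_plus \<inter> below D). \<Phi> (smult c a))"
    by (rule sum.reindex_bij_witness[of _ "\<lambda>(c, a). smult c a"
          "\<lambda>a. (lead_coeff a, smult (inverse (lead_coeff a)) a)"])
      (auto simp: A_plus_def intro: below_smult)
  also have "\<dots> = (\<Sum>(c, a)\<in>(UNIV - {0 :: 'a}) \<times> (A_plus \<inter> below D). \<Phi> a)"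
  proof (intro sum.cong refl)
    fix x :: "'a \<times> 'a poly"
    assume "x \<in> (UNIV - {0}) \<times> (A_plus \<inter> below D)"
    then obtain c a where "x = (c, a)" and "c \<noteq> 0"
      by auto
    then show "(case x of (c, a) \<Rightarrow> \<Phi> (smult c a)) = (case x of (c, a) \<Rightarrow> \<Phi> a)"
      using \<Phi>_smult[of c a] by simp
  qed
  also have "\<dots> = of_nat (CARD('a) - 1) * (\<Sum>a\<in>A_plus \<inter> below D. \<Phi> a)"
    by (subst sum.cartesian_product[symmetric]) simp
  also have "of_nat (CARD('a) - 1) = (-1 :: 'c)"
    using of_nat_card_eq_0 card_finite_field_ge_2[where 'a = 'a] by (simp add: of_nat_diff)
  finally show ?thesis
    by (simp add: \<Phi>_def)
qed

text \<open>The rectangles \<open>below D \<times> below E\<close> with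
  \<open>E \<ge> max J D\<close> are stable and contain a given box once \<open>D\<close> is large.
  Letting \<open>E\<close> grow first produces the inner Goss sums, and the error bound persists in
  the limit.\<close>

lemma infsum_f_summand:
  assumes z: "z \<in> Omega \<iota>"
  shows "(\<Sum>\<^sub>\<infinity>a\<in>A_plus. f_summand \<iota> \<pi> k n z a) = - total z / \<pi> ^ n"
    and "(\<lambda>D. \<Sum>a\<in>A_plus \<inter> below D. f_summand \<iota> \<pi> k n z a) \<longlonglongrightarrow> - total z / \<pi> ^ n"
proof -
  let ?f = "f_summand \<iota> \<pi> k n z"
  let ?I = "\<Sum>\<^sub>\<infinity>a\<in>A_plus. ?f a"
  have "(?f has_sum ?I) A_plus"
    using f_summand_summable[OF z] by (rule has_sum_infsum)
  then have lim1: "(\<lambda>D. \<Sum>a\<in>A_plus \<inter> below D. ?f a) \<longlonglongrightarrow> ?I"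
    unfolding has_sum_def
    by (rule filterlim_compose)
      (intro filterlim_exhaustion, auto intro: eventually_mono[OF eventually_in_below])
  obtain N where N: "z \<in> Omega_affinoid \<iota> N"
    using Omega_in_affinoid[OF z] .
  show lim2: "(\<lambda>D. \<Sum>a\<in>A_plus \<inter> below D. ?f a) \<longlonglongrightarrow> - total z / \<pi> ^ n"
    unfolding tendsto_vabs_iff
  proof (intro allI impI)
    fix \<epsilon> :: real
    assume \<epsilon>: "\<epsilon> > 0"
    then have "\<epsilon> / 2 * vabs \<pi> ^ n > 0"
      using period_nonzero by simp
    then obtain R where R: "\<And>U. stable J U \<Longrightarrow> deg_box R \<subseteq> U \<Longrightarrow>
        vabs (sum (summand z) U - total z) \<le> \<epsilon> / 2 * vabs \<pi> ^ n"
      using vabs_sum_diff_total_le N by blast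
    show "\<forall>\<^sub>F D in sequentially. vabs ((\<Sum>a\<in>A_plus \<inter> below D. ?f a) - - total z / \<pi> ^ n) < \<epsilon>"
    proof (rule eventually_sequentiallyI[of R])
      fix D
      assume D: "D \<ge> R"
      have "vabs ((\<Sum>a\<in>A_plus \<inter> below D. ?f a) - - total z / \<pi> ^ n) \<le> \<epsilon> / 2"
      proof (rule vabs_lim_le)
        show "(\<lambda>E. (\<Sum>a\<in>A_plus \<inter> below D. (\<Sum>b\<in>below E. summand z (a, b)) / \<pi> ^ n) - - total z / \<pi> ^ n)
            \<longlonglongrightarrow> (\<Sum>a\<in>A_plus \<inter> below D. ?f a) - - total z / \<pi> ^ n"
          by (intro tendsto_diff tendsto_sum f_summand_limit z tendsto_const) (auto simp: A_plus_def)
        show "\<forall>\<^sub>F E in sequentially. vabs ((\<Sum>a\<in>A_plus \<inter> below D.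
            (\<Sum>b\<in>below E. summand z (a, b)) / \<pi> ^ n) - - total z / \<pi> ^ n) \<le> \<epsilon> / 2"
        proof (rule eventually_sequentiallyI[of "max J D"])
          fix E
          assume E: "E \<ge> max J D"
          have "(\<Sum>a\<in>A_plus \<inter> below D. (\<Sum>b\<in>below E. summand z (a, b)) / \<pi> ^ n) - - total z / \<pi> ^ n
              = - (sum (summand z) (below D \<times> below E) - total z) / \<pi> ^ n"
            unfolding sum_rectangle_eq_monic by (simp add: sum_divide_distrib[symmetric] add_divide_distrib)
          also have "vabs \<dots> = vabs (sum (summand z) (below D \<times> below E) - total z) / vabs \<pi> ^ n"
            by (simp only: vabs_divide vabs_minus vabs_power)
          also have "\<dots> \<le> \<epsilon> / 2"
          proof -
            have "deg_box R \<subseteq> below D \<times> below E"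
              using D E below_mono[of R D] below_mono[of R E] by (auto simp: deg_box_def)
            then show ?thesis
              using R[of "below D \<times> below E"] E stable_times[of J E "below D"] period_nonzero
              by (simp add: divide_le_eq)
          qed
          finally show "vabs ((\<Sum>a\<in>A_plus \<inter> below D.
            (\<Sum>b\<in>below E. summand z (a, b)) / \<pi> ^ n) - - total z / \<pi> ^ n) \<le> \<epsilon> / 2" .
        qed
      qed simp
      then show "vabs ((\<Sum>a\<in>A_plus \<inter> below D. ?f a) - - total z / \<pi> ^ n) < \<epsilon>"
        using \<epsilon> by linarith
    qed
  qed
  show "?I = - total z / \<pi> ^ n"
    by (rule LIMSEQ_unique[OF lim1 lim2])
qed

end

section \<open>Rigid analyticity\<close>

lemma sum_rational_functions:
  fixes f :: "'i \<Rightarrow> 'c::field \<Rightarrow> 'c"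
  assumes "\<And>i. i \<in> I \<Longrightarrow> \<exists>P Q. \<forall>z\<in>S. poly Q z \<noteq> 0 \<and> f i z = poly P z / poly Q z"
  shows "\<exists>P Q. \<forall>z\<in>S. poly Q z \<noteq> 0 \<and> (\<Sum>i\<in>I. f i z) = poly P z / poly Q z"
  using assms
proof (induction I rule: infinite_finite_induct)
  case (insert i I)
  obtain P Q where 1: "\<forall>z\<in>S. poly Q z \<noteq> 0 \<and> (\<Sum>i\<in>I. f i z) = poly P z / poly Q z"
    using insert by blast
  obtain P' Q' where 2: "\<forall>z\<in>S. poly Q' z \<noteq> 0 \<and> f i z = poly P' z / poly Q' z"
    using insert by blast
  have "\<forall>z\<in>S. poly (Q' * Q) z \<noteq> 0 \<and>
      (\<Sum>i\<in>insert i I. f i z) = poly (P' * Q + P * Q') z / poly (Q' * Q) z"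
    using 1 2 insert.hyps by (auto simp: add_frac_eq)
  then show ?case
    by blast
next
  case (infinite I)
  then have "\<forall>z\<in>S. poly 1 z \<noteq> 0 \<and> (\<Sum>i\<in>I. f i z) = poly 0 z / poly 1 z"
    by simp
  then show ?case
    by blast
next
  case empty
  then have "\<forall>z\<in>S. poly 1 z \<noteq> 0 \<and> (\<Sum>i\<in>{}. f i z) = poly 0 z / poly 1 z"
    by simp
  then show ?case
    by blast
qed

context double_series
begin

text \<open>The box sums are rational functions without poles on \<open>Omega \<iota>\<close> and
  approximate \<open>total\<close> uniformly on each affinoid. The constant \<open>C\<close> is
  there to absorb \<open>- 1 / \<pi> ^ n\<close>.\<close>

lemma rigid_analytic_total: "rigid_analytic \<iota> (\<lambda>z. C * total z)"
  unfolding rigid_analytic_def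
proof (intro allI impI)
  fix N and \<epsilon> :: real
  assume \<epsilon>: "\<epsilon> > 0"
  \<comment> \<open>The added 1 allows division by \<open>B\<close> when
    \<open>C = 0\<close>.\<close>
  define B where "B = vabs C + 1"
  define \<delta> where "\<delta> = \<epsilon> / (2 * B)"
  have C: "B > 0"
    unfolding B_def using vabs_nonneg[of C] by linarith
  have \<delta>: "\<delta> > 0"
    using \<epsilon> C by (simp add: \<delta>_def)
  obtain R where R: "\<And>z U. z \<in> Omega_affinoid \<iota> N \<Longrightarrow> stable J U \<Longrightarrow> deg_box R \<subseteq> U \<Longrightarrow>
      vabs (sum (summand z) U - total z) \<le> \<delta>"
    using vabs_sum_diff_total_le[OF \<delta>] by blast
  let ?D = "max R J"
  have "\<exists>P Q. \<forall>z\<in>Omega_affinoid \<iota> N. poly Q z \<noteq> 0 \<and> summand z v = poly P z / poly Q z" for v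
  proof (cases "v = (0, 0)")
    case True
    \<comment> \<open>The pair \<open>(0, 0)\<close> has the zero polynomial as linear form and is
      therefore represented by \<open>0 / 1\<close>.\<close>
    have "k - n > 0"
      using k_gt by simp
    then have "\<forall>z\<in>Omega_affinoid \<iota> N. poly 1 z \<noteq> 0 \<and> summand z v = poly 0 z / poly 1 z"
      by (simp add: True summand_def)
    then show ?thesis
      by blast
  next
    case False
    obtain a b where v: "v = (a, b)"
      by (cases v)
    have "\<forall>z\<in>Omega_affinoid \<iota> N. poly ([:emb \<iota> b, emb \<iota> a:] ^ n) z \<noteq> 0 \<and>
        summand z v = poly [:emb \<iota> a ^ (k - n):] z / poly ([:emb \<iota> b, emb \<iota> a:] ^ n) z"
      using linear_form_nonzero[OF affinoid_in_Omega, of _ N a b] False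
      by (auto simp: v summand_def add.commute mult.commute)
    then show ?thesis
      by blast
  qed
  then have "\<exists>P Q. \<forall>z\<in>Omega_affinoid \<iota> N. poly Q z \<noteq> 0 \<and>
      sum (summand z) (deg_box ?D) = poly P z / poly Q z"
    by (rule sum_rational_functions)
  then obtain P Q where PQ: "\<And>z. z \<in> Omega_affinoid \<iota> N \<Longrightarrow>
      poly Q z \<noteq> 0 \<and> sum (summand z) (deg_box ?D) = poly P z / poly Q z"
    by blast
  have "poly Q z \<noteq> 0 \<and> vabs (C * total z - poly (smult C P) z / poly Q z) < \<epsilon>"
    if z: "z \<in> Omega_affinoid \<iota> N" for z
  proof
    have "C * total z - poly (smult C P) z / poly Q z = C * (total z - sum (summand z) (deg_box ?D))"
      using PQ[OF z] by (simp add: right_diff_distrib)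
    also have "vabs \<dots> = vabs C * vabs (sum (summand z) (deg_box ?D) - total z)"
      by (simp add: vabs_mult vabs_minus_commute)
    also have "\<dots> \<le> vabs C * \<delta>"
      by (intro mult_left_mono R z stable_deg_box deg_box_mono) auto
    also have "\<dots> \<le> B * \<delta>"
      using \<delta> by (intro mult_right_mono) (auto simp: B_def)
    also have "\<dots> = \<epsilon> / 2"
      using C by (simp add: \<delta>_def)
    finally show "vabs (C * total z - poly (smult C P) z / poly Q z) < \<epsilon>"
      using \<epsilon> by linarith
  qed (use PQ[OF z] in simp)
  then show "\<exists>P Q. \<forall>z\<in>Omega_affinoid \<iota> N. poly Q z \<noteq> 0 \<and> vabs (C * total z - poly P z / poly Q z) < \<epsilon>"
    by blast
qed

end

section \<open>The functional equation\<close>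

context double_series
begin

text \<open>Needed for exhaustions that are not boxes, namely the images of boxes under a
  matrix.\<close>

lemma total_limit_along:
  assumes z: "z \<in> Omega \<iota>" and "eventually (\<lambda>D. stable J (U D)) F"
    and "\<And>R. eventually (\<lambda>D. deg_box R \<subseteq> U D) F"
  shows "((\<lambda>D. sum (summand z) (U D)) \<longlongrightarrow> total z) F"
  unfolding tendsto_vabs_iff
proof (intro allI impI)
  fix \<epsilon> :: real
  assume \<epsilon>: "\<epsilon> > 0"
  obtain N where "z \<in> Omega_affinoid \<iota> N"
    using Omega_in_affinoid[OF z] .
  then obtain R where R: "\<And>U. stable J U \<Longrightarrow> deg_box R \<subseteq> U \<Longrightarrow> vabs (sum (summand z) U - total z) \<le> \<epsilon> / 2"
    using vabs_sum_diff_total_le[of "\<epsilon> / 2"] \<epsilon> by (metis half_gt_zero)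
  from assms(2) assms(3)[of R] show "\<forall>\<^sub>F D in F. vabs (sum (summand z) (U D) - total z) < \<epsilon>"
  proof eventually_elim
    case (elim D)
    then show ?case
      using R[of "U D"] \<epsilon> by linarith
  qed
qed

text \<open>The coefficients may depend on \<open>a\<close> in any way, because a coset fixes
  \<open>a\<close>; only the degree in \<open>b\<close> counts, and up to \<open>k - 2n\<close> the
  power sums over \<open>below J\<close> vanish.\<close>

lemma sum_polynomial_stable_eq_0:
  assumes "stable J U" and "\<And>i. i \<in> I \<Longrightarrow> e i \<le> k - 2 * n"
  shows "(\<Sum>(a, b)\<in>U. \<Sum>i\<in>I. c a i * (emb \<iota> a * z + emb \<iota> b) ^ e i) = (0 :: 'c)"
proof -
  have "(\<Sum>(a, b)\<in>U. \<Sum>i\<in>I. c a i * (emb \<iota> a * z + emb \<iota> b) ^ e i) \<in> {0}"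
  proof (rule sum_stable_in_below[OF assms(1)])
    fix a b
    have "(\<Sum>b'\<in>below J. \<Sum>i\<in>I. c a i * (emb \<iota> a * z + emb \<iota> (b + b')) ^ e i)
        = (\<Sum>i\<in>I. c a i * (\<Sum>b'\<in>below J. (emb \<iota> a * z + emb \<iota> b + emb \<iota> b') ^ e i))"
      unfolding sum_distrib_left by (subst sum.swap) (simp add: emb_add add.assoc)
    also have "\<dots> = 0"
    proof (intro sum.neutral ballI)
      fix i
      assume "i \<in> I"
      then have "(\<Sum>b'\<in>below J. (emb \<iota> a * z + emb \<iota> b + emb \<iota> b') ^ e i) = 0"
        using J_less_card_power assms(2) by (intro sum_below_power_eq_0) fastforce
      then show "c a i * (\<Sum>b'\<in>below J. (emb \<iota> a * z + emb \<iota> b + emb \<iota> b') ^ e i) = 0"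
        by simp
    qed
    finally show "(\<Sum>b'\<in>below J. case (a, b + b') of (a, b) \<Rightarrow>
        \<Sum>i\<in>I. c a i * (emb \<iota> a * z + emb \<iota> b) ^ e i) \<in> {0}"
      by simp
  qed auto
  then show ?thesis
    by simp
qed

end

locale modular_double_series = double_series \<iota> q \<pi> k n
  for \<iota> :: "'a::{finite,field} fls \<Rightarrow> 'c::{nonarch_field,complete_space}" and q :: real
    and \<pi> :: 'c and k n :: nat +
  fixes p s :: nat
  assumes prime_p: "prime p" and CHAR_p: "CHAR('c) = p"
    and p_power_dvd: "p ^ s dvd k - n" and n_le: "n \<le> p ^ s"
begin

text \<open>Write \<open>k - n = P m\<close> with \<open>P = p\<^sup>s \<ge> n\<close>. In
  \<open>(x + c y)\<^sup>k\<^sup>-\<^sup>n = (x\<^sup>P + c\<^sup>P y\<^sup>P)\<^sup>m\<close> all terms except \<open>x\<^sup>k\<^sup>-\<^sup>n\<close> are divisible by \<open>y\<^sup>P\<close>,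
  hence by \<open>y\<^sup>n\<close>.\<close>

lemma power_divide_expansion:
  fixes x y c :: 'c
  defines "P \<equiv> p ^ s" and "m \<equiv> (k - n) div p ^ s"
  assumes "y \<noteq> 0 \<or> x = 0"
  shows "(x + c * y) ^ (k - n) / y ^ n = x ^ (k - n) / y ^ n
    + (\<Sum>i=1..m. of_nat (m choose i) * (c ^ P) ^ i * (x ^ P) ^ (m - i) * y ^ (P * i - n))"
proof -
  have kn: "k - n = P * m"
    using p_power_dvd by (simp add: P_def m_def)
  show ?thesis
  proof (cases "y = 0")
    \<comment> \<open>This case is for the pair \<open>(0, 0)\<close>. The two quotients agree and
      every term of the sum vanishes: for \<open>i < m\<close> through a positive power of
      \<open>x\<close>, for \<open>i = m\<close> through \<open>y ^ (k - 2n)\<close>.\<close>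
    case True
    then have x: "x = 0"
      using assms(3) by simp
    have "P > 0"
      using prime_p by (simp add: P_def prime_gt_0_nat)
    have "(x ^ P) ^ (m - i) * y ^ (P * i - n) = 0" if "i \<in> {1..m}" for i
    proof (cases "i = m")
      case True
      then have "P * i - n > 0"
        using kn k_gt by simp
      then show ?thesis
        using \<open>y = 0\<close> by simp
    next
      case False
      then show ?thesis
        using that \<open>P > 0\<close> by (simp add: x power_0_left)
    qed
    then have "(\<Sum>i=1..m. of_nat (m choose i) * (c ^ P) ^ i * (x ^ P) ^ (m - i) * y ^ (P * i - n)) = 0"
      by (intro sum.neutral ballI) (simp add: mult.assoc)
    then show ?thesis
      using True x by simp
  next
    case False
    have "(x + c * y) ^ (k - n) = (x ^ P + (c * y) ^ P) ^ m"
      using freshmans_dream'[of P s x "c * y"] prime_p CHAR_p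
      by (simp add: kn P_def power_mult)
    also have "\<dots> = ((c * y) ^ P + x ^ P) ^ m"
      by (simp add: add.commute)
    also have "\<dots> = (\<Sum>i\<le>m. of_nat (m choose i) * ((c * y) ^ P) ^ i * (x ^ P) ^ (m - i))"
      by (rule binomial_ring)
    also have "{..m} = insert 0 {1..m}"
      by auto
    also have "(\<Sum>i\<in>insert 0 {1..m}. of_nat (m choose i) * ((c * y) ^ P) ^ i * (x ^ P) ^ (m - i))
        = x ^ (k - n) + (\<Sum>i=1..m. of_nat (m choose i) * ((c * y) ^ P) ^ i * (x ^ P) ^ (m - i))"
      by (simp add: kn power_mult)
    finally have eq: "(x + c * y) ^ (k - n) / y ^ n = x ^ (k - n) / y ^ n
        + (\<Sum>i=1..m. of_nat (m choose i) * ((c * y) ^ P) ^ i * (x ^ P) ^ (m - i) / y ^ n)"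
      by (simp add: add_divide_distrib sum_divide_distrib)
    have "of_nat (m choose i) * ((c * y) ^ P) ^ i * (x ^ P) ^ (m - i) / y ^ n
        = of_nat (m choose i) * (c ^ P) ^ i * (x ^ P) ^ (m - i) * y ^ (P * i - n)"
      if "i \<in> {1..m}" for i
    proof -
      \<comment> \<open>This makes \<open>P * i - n\<close> a genuine difference; here
        \<open>n \<le> p ^ s\<close> keeps the remainder free of poles.\<close>
      have "n \<le> P * 1"
        using n_le by (simp add: P_def)
      also have "\<dots> \<le> P * i"
        using that by (intro mult_left_mono) auto
      finally have "y ^ (P * i - n) = (y ^ P) ^ i / y ^ n"
        using False by (simp add: power_diff power_mult)
      then show ?thesis
        by (simp add: power_mult_distrib mult_ac)
    qed
    then show ?thesis
      unfolding eq by (intro arg_cong2[where f = "(+)"] sum.cong refl)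
  qed
qed

text \<open>\<open>g\<close> is the action of the matrix on row vectors, chosen so that
  \<open>aw + b = (a'z + b') / j\<close>. The denominator yields \<open>j ^ n\<close>; the
  numerator, expanded in \<open>Y = a'z + b'\<close>, yields \<open>j ^ (k - n)\<close> and a
  remainder \<open>r\<close>, polynomial in \<open>Y\<close> of degree at most
  \<open>k - 2n\<close>. Images of boxes under \<open>g\<close> form a stable exhaustion, on which
  \<open>r\<close> sums to 0.\<close>

lemma total_moebius:
  assumes z: "z \<in> Omega \<iota>" and u: "(\<alpha> * \<delta> - \<beta> * \<gamma>) * u' = 1"
  shows "total ((emb \<iota> \<alpha> * z + emb \<iota> \<beta>) / (emb \<iota> \<gamma> * z + emb \<iota> \<delta>))
    = emb \<iota> u' ^ (k - n) * (emb \<iota> \<gamma> * z + emb \<iota> \<delta>) ^ k * total z"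
proof -
  define j where "j = emb \<iota> \<gamma> * z + emb \<iota> \<delta>"
  define w where "w = (emb \<iota> \<alpha> * z + emb \<iota> \<beta>) / j"
  define g where "g = (\<lambda>(a, b). (a * \<alpha> + b * \<gamma>, a * \<beta> + b * \<delta>))"
  define P where "P = p ^ s"
  define m where "m = (k - n) div p ^ s"
  define r where "r = (\<lambda>(a, b). \<Sum>i=1..m. (of_nat (m choose i) * ((- emb \<iota> \<gamma>) ^ P) ^ i *
    ((emb \<iota> a * j) ^ P) ^ (m - i)) * (emb \<iota> a * z + emb \<iota> b) ^ (P * i - n))"
  have "(\<gamma>, \<delta>) \<noteq> (0, 0)"
    using u by auto
  then have j: "j \<noteq> 0"
    unfolding j_def by (intro linear_form_nonzero z)
  have g_inv: "a = u' * (a' * \<delta> - b' * \<gamma>)" "b = u' * (b' * \<alpha> - a' * \<beta>)"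
    if "g (a, b) = (a', b')" for a b a' b'
  proof -
    have a': "a' = a * \<alpha> + b * \<gamma>" and b': "b' = a * \<beta> + b * \<delta>"
      using that by (auto simp: g_def)
    have "u' * (a' * \<delta> - b' * \<gamma>) = ((\<alpha> * \<delta> - \<beta> * \<gamma>) * u') * a"
      unfolding a' b' by (simp add: algebra_simps)
    then show "a = u' * (a' * \<delta> - b' * \<gamma>)"
      using u by simp
    have "u' * (b' * \<alpha> - a' * \<beta>) = ((\<alpha> * \<delta> - \<beta> * \<gamma>) * u') * b"
      unfolding a' b' by (simp add: algebra_simps)
    then show "b = u' * (b' * \<alpha> - a' * \<beta>)"
      using u by simp
  qed
  have g_surj: "g (u' * (a' * \<delta> - b' * \<gamma>), u' * (b' * \<alpha> - a' * \<beta>)) = (a', b')" for a' b'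
  proof -
    have "u' * (a' * \<delta> - b' * \<gamma>) * \<alpha> + u' * (b' * \<alpha> - a' * \<beta>) * \<gamma> = ((\<alpha> * \<delta> - \<beta> * \<gamma>) * u') * a'"
      by (simp add: algebra_simps)
    moreover have "u' * (a' * \<delta> - b' * \<gamma>) * \<beta> + u' * (b' * \<alpha> - a' * \<beta>) * \<delta> = ((\<alpha> * \<delta> - \<beta> * \<gamma>) * u') * b'"
      by (simp add: algebra_simps)
    ultimately show ?thesis
      using u by (simp add: g_def)
  qed
  have inj: "inj_on g S" for S
    by (rule inj_onI) (metis g_inv surj_pair)
  have summand_w: "summand w v = emb \<iota> u' ^ (k - n) * j ^ n * (j ^ (k - n) * summand z (g v) + r (g v))" for v
  proof -
    obtain a b where v: "v = (a, b)"
      by (cases v)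
    obtain a' b' where g: "g (a, b) = (a', b')"
      by (cases "g (a, b)")
    define Y where "Y = emb \<iota> a' * z + emb \<iota> b'"
    have a': "a' = a * \<alpha> + b * \<gamma>" and b': "b' = a * \<beta> + b * \<delta>"
      using g by (auto simp: g_def)
    have "emb \<iota> a * w + emb \<iota> b = (emb \<iota> a * (emb \<iota> \<alpha> * z + emb \<iota> \<beta>) + emb \<iota> b * j) / j"
      using j by (simp add: w_def field_simps)
    also have "emb \<iota> a * (emb \<iota> \<alpha> * z + emb \<iota> \<beta>) + emb \<iota> b * j = Y"
      by (simp add: Y_def a' b' j_def emb_add emb_mult algebra_simps)
    finally have lin: "emb \<iota> a * w + emb \<iota> b = Y / j" .
    have "emb \<iota> a = emb \<iota> (u' * (a' * \<delta> - b' * \<gamma>))"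
      using g_inv(1)[OF g] by (rule arg_cong)
    also have "\<dots> = emb \<iota> u' * (emb \<iota> a' * emb \<iota> \<delta> - emb \<iota> b' * emb \<iota> \<gamma>)"
      by (simp only: emb_mult emb_diff)
    \<comment> \<open>Insert \<open>\<delta> = j - \<gamma>z\<close> and
      \<open>b' = Y - a'z\<close>; the products with \<open>z\<close> cancel. The result has the
      shape \<open>x + c * y\<close> of \<open>power_divide_expansion\<close>, with
      \<open>x = a'j\<close>, \<open>y = Y\<close> and \<open>c = -\<gamma>\<close>.\<close>
    also have "emb \<iota> a' * emb \<iota> \<delta> - emb \<iota> b' * emb \<iota> \<gamma> = emb \<iota> a' * j + (- emb \<iota> \<gamma>) * Y"
      by (simp add: Y_def j_def algebra_simps)
    finally have a: "emb \<iota> a = emb \<iota> u' * (emb \<iota> a' * j + (- emb \<iota> \<gamma>) * Y)" .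
    have Y: "Y \<noteq> 0 \<or> emb \<iota> a' * j = 0"
      using linear_form_nonzero[OF z, of a' b'] by (auto simp: Y_def)
    have "summand w v = emb \<iota> u' ^ (k - n) * j ^ n * ((emb \<iota> a' * j + (- emb \<iota> \<gamma>) * Y) ^ (k - n) / Y ^ n)"
      unfolding v summand_def prod.case lin unfolding a by (simp add: power_mult_distrib power_divide)
    also have "(emb \<iota> a' * j + (- emb \<iota> \<gamma>) * Y) ^ (k - n) / Y ^ n
        = (emb \<iota> a' * j) ^ (k - n) / Y ^ n + r (a', b')"
      unfolding r_def prod.case P_def m_def Y_def[symmetric]
      using power_divide_expansion[OF Y, of "- emb \<iota> \<gamma>"] by (simp only:)
    also have "(emb \<iota> a' * j) ^ (k - n) / Y ^ n = j ^ (k - n) * summand z (a', b')"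
      by (simp add: summand_def Y_def power_mult_distrib)
    finally show ?thesis
      by (simp add: v g)
  qed
  \<comment> \<open>A common degree bound for the entries and \<open>u'\<close>. The inverse of
    \<open>g\<close> raises degrees by at most \<open>E\<close> through the entries and
    \<open>E\<close> through \<open>u'\<close>.\<close>
  define E where "E = Suc (Max (degree ` {\<alpha>, \<beta>, \<gamma>, \<delta>, u'}))"
  have E: "x \<in> below (Suc E)" if "x \<in> {\<alpha>, \<beta>, \<gamma>, \<delta>, u'}" for x
    using Max_ge[of "degree ` {\<alpha>, \<beta>, \<gamma>, \<delta>, u'}" "degree x"] that by (auto simp: below_def E_def)
  have sub: "deg_box R \<subseteq> g ` deg_box D" if "D \<ge> R + E + E" for R D
  proof
    fix v :: "'a poly \<times> 'a poly"
    assume "v \<in> deg_box R"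
    then obtain a' b' where v: "v = (a', b')" and ab: "a' \<in> below R" "b' \<in> below R"
      by (auto simp: deg_box_def)
    have "u' * (x * c - y * d) \<in> below (R + E + E)"
      if "x \<in> below R" "y \<in> below R" "c \<in> {\<alpha>, \<beta>, \<gamma>, \<delta>, u'}" "d \<in> {\<alpha>, \<beta>, \<gamma>, \<delta>, u'}" for x y c d
    proof -
      have "x * c - y * d \<in> below (R + E)"
        using that E by (intro below_diff below_mult) auto
      then show ?thesis
        using E[of u'] below_mult by (subst mult.commute) blast
    qed
    then have "(u' * (a' * \<delta> - b' * \<gamma>), u' * (b' * \<alpha> - a' * \<beta>)) \<in> deg_box (R + E + E)"
      unfolding deg_box_def using ab by (intro SigmaI) auto
    then show "v \<in> g ` deg_box D"
      using deg_box_mono[OF that] g_surj[of a' b'] v by (metis imageI subsetD)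
  qed
  have stable: "stable J (g ` deg_box D)" if "D \<ge> J + E + E" for D
    unfolding stable_def
  proof (intro conjI ballI)
    fix v :: "'a poly \<times> 'a poly" and b' :: "'a poly"
    assume "v \<in> g ` deg_box D" "b' \<in> below J"
    then have "v \<in> g ` deg_box D" "(0, b') \<in> g ` deg_box D"
      using sub[OF that] by (auto simp: deg_box_def)
    then obtain x y where xy: "x \<in> deg_box D" "y \<in> deg_box D" "v = g x" "(0, b') = g y"
      by (elim imageE)
    \<comment> \<open>Stability becomes closure under addition, since \<open>g\<close> is additive
      and the translations \<open>(0, b')\<close> are themselves images of points of the
      box.\<close>
    have "g (x + y) = g x + g y"
      by (simp add: g_def split_beta plus_prod_def algebra_simps)
    moreover have "x + y \<in> deg_box D"
      using xy(1,2) by (auto simp: deg_box_def plus_prod_def intro: below_add)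
    ultimately show "v + (0, b') \<in> g ` deg_box D"
      using xy(3,4) by (metis imageI)
  qed simp
  have "(\<lambda>D. emb \<iota> u' ^ (k - n) * j ^ k * sum (summand z) (g ` deg_box D))
      \<longlonglongrightarrow> emb \<iota> u' ^ (k - n) * j ^ k * total z"
  proof (intro tendsto_mult tendsto_const total_limit_along z)
    show "eventually (\<lambda>D. stable J (g ` deg_box D)) sequentially"
      using stable by (rule eventually_sequentiallyI)
    show "eventually (\<lambda>D. deg_box R \<subseteq> g ` deg_box D) sequentially" for R
      using sub by (rule eventually_sequentiallyI)
  qed
  moreover have "\<forall>\<^sub>F D in sequentially. emb \<iota> u' ^ (k - n) * j ^ k * sum (summand z) (g ` deg_box D)
      = sum (summand w) (deg_box D)"
  proof (rule eventually_sequentiallyI[of "J + E + E"])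
    fix D
    assume D: "D \<ge> J + E + E"
    have r0: "sum r (g ` deg_box D) = 0"
      unfolding r_def
    proof (rule sum_polynomial_stable_eq_0[OF stable[OF D]])
      fix i
      assume "i \<in> {1..m}"
      then have "P * i \<le> P * m"
        by simp
      also have "P * m = k - n"
        using p_power_dvd by (simp add: P_def m_def)
      finally show "P * i - n \<le> k - 2 * n"
        by simp
    qed
    have "sum (summand w) (deg_box D) = (\<Sum>v\<in>deg_box D.
        emb \<iota> u' ^ (k - n) * j ^ n * (j ^ (k - n) * summand z (g v) + r (g v)))"
      by (rule sum.cong[OF refl summand_w])
    also have "\<dots> = (\<Sum>v\<in>g ` deg_box D.
        emb \<iota> u' ^ (k - n) * j ^ n * (j ^ (k - n) * summand z v + r v))"
      unfolding sum.reindex[OF inj] comp_def ..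
    also have "\<dots> = emb \<iota> u' ^ (k - n) * j ^ n *
        (j ^ (k - n) * sum (summand z) (g ` deg_box D) + sum r (g ` deg_box D))"
      by (simp only: sum_distrib_left[symmetric] sum.distrib)
    finally have "sum (summand w) (deg_box D)
        = emb \<iota> u' ^ (k - n) * (j ^ n * j ^ (k - n)) * sum (summand z) (g ` deg_box D)"
      by (simp only: r0 add_0_right mult.assoc)
    moreover have "j ^ n * j ^ (k - n) = j ^ k"
      using k_gt by (simp flip: power_add)
    ultimately show "emb \<iota> u' ^ (k - n) * j ^ k * sum (summand z) (g ` deg_box D)
        = sum (summand w) (deg_box D)"
      by simp
  qed
  ultimately have "(\<lambda>D. sum (summand w) (deg_box D)) \<longlonglongrightarrow> emb \<iota> u' ^ (k - n) * j ^ k * total z"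
    by (rule Lim_transform_eventually)
  then have "total w = emb \<iota> u' ^ (k - n) * j ^ k * total z"
    unfolding total_def[of w] by (rule limI)
  then show ?thesis
    by (simp add: w_def j_def)
qed

end

text \<open>Units of \<open>A\<close> are nonzero constants, whose powers depend only on the
  exponent modulo \<open>q - 1\<close>; so the determinant factor is given by the type.\<close>

lemma (in C_infinity) emb_unit_power:
  fixes m :: int
  assumes "u * u' = 1" and "[m = int i] (mod (int CARD('a) - 1))"
  shows "emb \<iota> u' ^ i = emb \<iota> u powi (- m)"
proof -
  have "is_unit u"
    using assms(1) by (metis dvdI)
  then obtain c where c: "u = [:c:]" "c dvd 1"
    by (auto simp: is_unit_poly_iff)
  then have c0: "c \<noteq> 0"
    by auto
  have nz: "emb \<iota> u \<noteq> 0"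
    using c c0 by simp
  have "emb \<iota> u * emb \<iota> u' = 1"
    using assms(1) by (metis emb_1 emb_mult)
  then have inv: "emb \<iota> u' = inverse (emb \<iota> u)"
    by (simp add: inverse_unique)
  obtain l where l: "m = int i + (int CARD('a) - 1) * l"
    using assms(2) by (metis cong_iff_lin cong_sym)
  have "emb \<iota> u ^ (CARD('a) - 1) = 1"
    unfolding c(1) emb_const by (rule \<iota>_const_power_card_minus_1[OF c0]) simp
  moreover have "int CARD('a) - 1 = int (CARD('a) - 1)"
    using card_finite_field_ge_2[where 'a = 'a] by (simp add: of_nat_diff)
  ultimately have "emb \<iota> u powi ((int CARD('a) - 1) * l) = 1"
    by (simp only: power_int_mult power_int_of_nat power_int_1_left)
  then have "emb \<iota> u powi m = emb \<iota> u ^ i"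
    using nz by (simp add: l power_int_add)
  then show ?thesis
    by (simp add: inv power_int_minus power_inverse)
qed

section \<open>The expansion at infinity\<close>

context period_scale
begin

text \<open>The \<open>a\<close>-torsion points of the Drinfeld module uniformised by
  \<open>\<Lambda>\<close>, when \<open>r\<close> runs through the residues modulo
  \<open>a\<close>.\<close>

definition torsion :: "'a poly \<Rightarrow> 'a poly \<Rightarrow> 'c" where
  "torsion a r = lattice_exp \<Lambda> (\<pi> * (emb \<iota> r / emb \<iota> a))"

lemma vabs_torsion:
  assumes "a \<noteq> 0" and "r \<in> below (degree a)"
  shows "vabs (torsion a r) = vabs \<pi> * vabs (emb \<iota> r) / vabs (emb \<iota> a)"
    and "vabs (torsion a r) \<le> vabs \<pi>"
proof -
  have lt: "vabs (emb \<iota> r) < vabs (emb \<iota> a)"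
    using assms by (simp add: in_below_iff vabs_emb)
  moreover have pos: "vabs (emb \<iota> a) > 0" "vabs \<pi> > 0"
    using assms period_nonzero by simp_all
  ultimately have "vabs \<pi> * vabs (emb \<iota> r) < vabs \<pi> * vabs (emb \<iota> a)"
    by (intro mult_strict_left_mono)
  then have "vabs (\<pi> * (emb \<iota> r / emb \<iota> a)) < vabs \<pi>"
    using pos(1) by (simp add: vabs_mult vabs_divide pos_divide_less_eq)
  then show "vabs (torsion a r) = vabs \<pi> * vabs (emb \<iota> r) / vabs (emb \<iota> a)"
    and "vabs (torsion a r) \<le> vabs \<pi>"
    unfolding torsion_def by (simp_all add: vabs_lattice_exp_small vabs_mult vabs_divide)
qed

lemma torsion_diff: "torsion a r - torsion a r' = torsion a (r - r')"
  by (simp add: torsion_def lattice_exp_diff[symmetric] emb_diff diff_divide_distrib right_diff_distrib)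

text \<open>The torsion points form a group. It has \<open>q ^ degree a\<close> elements, because
  \<open>lattice_exp\<close> preserves absolute values on the disc containing all
  \<open>\<pi>r/a\<close> and so separates the residues.\<close>

lemma sum_torsion_power_eq_0:
  assumes "a \<noteq> 0" and "i + 1 < CARD('a) ^ degree a"
  shows "(\<Sum>r\<in>below (degree a). torsion a r ^ i) = 0"
proof -
  let ?W = "torsion a ` below (degree a)"
  have inj: "inj_on (torsion a) (below (degree a))"
  proof (rule inj_onI)
    fix r r'
    assume r: "r \<in> below (degree a)" "r' \<in> below (degree a)" and eq: "torsion a r = torsion a r'"
    have "vabs (torsion a (r - r')) = 0"
      using torsion_diff[of a r r'] eq by simp
    then have "emb \<iota> (r - r') = 0"
      unfolding vabs_torsion(1)[OF assms(1) below_diff[OF r]] using assms(1) period_nonzero by simp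
    then show "r = r'"
      by simp
  qed
  have "fin_subgroup ?W"
    unfolding fin_subgroup_def
  proof (intro conjI ballI)
    have "torsion a 0 \<in> ?W"
      by simp
    then show "0 \<in> ?W"
      by (simp add: torsion_def)
    fix x y
    assume "x \<in> ?W" "y \<in> ?W"
    then show "x - y \<in> ?W"
      by (auto simp: torsion_diff intro: below_diff)
  qed simp
  moreover have "card ?W = CARD('a) ^ degree a"
    using inj by (simp add: card_image card_below)
  ultimately have "(\<Sum>w\<in>?W. (0 + w) ^ i) = 0"
    using assms(2) by (intro subgroup_sum_power_eq_0) auto
  then show ?thesis
    using inj by (simp add: sum.reindex)
qed

lemma translated_in_Omega:
  assumes "z \<in> Omega \<iota>"
  shows "z + emb \<iota> r / emb \<iota> a \<in> Omega \<iota>"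
proof -
  obtain x where x: "emb \<iota> r / emb \<iota> a = \<iota> x"
    by (metis emb_def \<iota>_divide)
  show ?thesis
    unfolding x by (rule Omega_add[OF assms])
qed

lemma t_par_translated:
  assumes "z \<in> Omega \<iota>"
  shows "t_par \<iota> \<pi> (z + emb \<iota> r / emb \<iota> a) = t_par \<iota> \<pi> z / (1 + t_par \<iota> \<pi> z * torsion a r)"
proof -
  have eq: "lattice_exp \<Lambda> (\<pi> * (z + emb \<iota> r / emb \<iota> a)) = lattice_exp \<Lambda> (\<pi> * z) + torsion a r"
    by (simp add: torsion_def distrib_left lattice_exp_add)
  have "1 / (x + y) = 1 / x / (1 + 1 / x * y)" if "x \<noteq> 0" for x y :: 'c
  proof -
    have "x + y = x * (1 + 1 / x * y)"
      using that by (simp add: distrib_left)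
    then show ?thesis
      by (metis divide_divide_eq_left)
  qed
  then show ?thesis
    unfolding t_par_def eq using lattice_exp_nonzero[OF assms] .
qed

text \<open>Division with remainder. Injectivity is a degree comparison, and surjectivity follows
  from counting \<open>q ^ degree a * q ^ E\<close> pairs.\<close>

lemma sum_below_division:
  fixes a :: "'a poly" and f :: "'a poly \<Rightarrow> 'c"
  assumes "a \<noteq> 0"
  shows "(\<Sum>b\<in>below (degree a + E). f b) = (\<Sum>r\<in>below (degree a). \<Sum>b\<in>below E. f (a * b + r))"
proof -
  let ?g = "\<lambda>(r, b). a * b + r" and ?S = "below (degree a) \<times> below E"
  have inj: "inj_on ?g ?S"
  proof (rule inj_onI, clarify)
    fix r b r' b' :: "'a poly"
    assume r: "r \<in> below (degree a)" "r' \<in> below (degree a)" and eq: "a * b + r = a * b' + r'"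
    have "a * (b - b') = r' - r"
      using eq by (simp add: algebra_simps)
    then have "a * (b - b') \<in> below (degree a)"
      using below_diff[OF r(2,1)] by simp
    have "b = b'"
    proof (rule ccontr)
      assume "b \<noteq> b'"
      then have "degree (a * (b - b')) = degree a + degree (b - b')"
        using assms by (intro degree_mult_eq) auto
      then show False
        using \<open>a * (b - b') \<in> below (degree a)\<close> \<open>b \<noteq> b'\<close> assms by (auto simp: below_def)
    qed
    then show "r = r' \<and> b = b'"
      using eq by simp
  qed
  have "?g ` ?S \<subseteq> below (degree a + E)"
  proof clarify
    fix r b :: "'a poly"
    assume "r \<in> below (degree a)" "b \<in> below E"
    then have "b * a \<in> below (E + degree a)" and "r \<in> below (E + degree a)"
      using below_mult[of b E a "degree a"] below_Suc_degree below_mono[of "degree a" "E + degree a"]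
      by auto
    then show "a * b + r \<in> below (degree a + E)"
      using below_add by (simp add: mult.commute add.commute)
  qed
  moreover have "card (?g ` ?S) = card (below (degree a + E) :: 'a poly set)"
    using inj by (simp add: card_image card_cartesian_product card_below power_add)
  ultimately have "?g ` ?S = below (degree a + E)"
    by (intro card_subset_eq) auto
  then have "(\<Sum>b\<in>below (degree a + E). f b) = (\<Sum>v\<in>?S. f (?g v))"
    using inj by (simp add: sum.reindex[symmetric, unfolded comp_def] flip: sum.reindex)
  then show ?thesis
    by (simp add: sum.cartesian_product split_beta)
qed

text \<open>Sorting \<open>b = a b' + r\<close> by its residue gives
  \<open>az + b = a (z + r/a + b')\<close>, so the Goss sum at \<open>az\<close> splits into Goss
  sums at the points \<open>z + r/a\<close>.\<close>

lemma goss_poly_t_scaled: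
  assumes z: "z \<in> Omega \<iota>" and az: "emb \<iota> a * z \<in> Omega \<iota>" and a: "a \<noteq> 0" and n: "n \<ge> 1"
  shows "poly (goss_poly \<iota> \<pi> n) (t_par \<iota> \<pi> (emb \<iota> a * z))
    = (\<Sum>r\<in>below (degree a). poly (goss_poly \<iota> \<pi> n)
        (t_par \<iota> \<pi> z / (1 + t_par \<iota> \<pi> z * torsion a r))) / emb \<iota> a ^ n"
proof (rule LIMSEQ_unique)
  let ?G = "poly (goss_poly \<iota> \<pi> n)"
  let ?S = "\<lambda>z D. \<Sum>b\<in>below D. 1 / (\<pi> * z + \<pi> * emb \<iota> b) ^ n"
  show "(\<lambda>E. ?S (emb \<iota> a * z) (E + degree a)) \<longlonglongrightarrow> ?G (t_par \<iota> \<pi> (emb \<iota> a * z))"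
    using goss_poly_limit[OF az n] by (rule LIMSEQ_ignore_initial_segment)
  have "(\<lambda>E. (\<Sum>r\<in>below (degree a). ?S (z + emb \<iota> r / emb \<iota> a) E) / emb \<iota> a ^ n)
      \<longlonglongrightarrow> (\<Sum>r\<in>below (degree a). ?G (t_par \<iota> \<pi> (z + emb \<iota> r / emb \<iota> a))) / emb \<iota> a ^ n"
    using a by (intro tendsto_nonarch_divide tendsto_sum tendsto_const goss_poly_limit translated_in_Omega z n) simp
  moreover have "?S (emb \<iota> a * z) (E + degree a)
      = (\<Sum>r\<in>below (degree a). ?S (z + emb \<iota> r / emb \<iota> a) E) / emb \<iota> a ^ n" for E
  proof -
    have "\<pi> * (emb \<iota> a * z) + \<pi> * emb \<iota> (a * b + r)
        = (\<pi> * (z + emb \<iota> r / emb \<iota> a) + \<pi> * emb \<iota> b) * emb \<iota> a" for r b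
      using a by (simp add: emb_add emb_mult field_simps)
    then show ?thesis
      by (simp add: sum_below_division[OF a] add.commute[of E] sum_divide_distrib power_mult_distrib)
  qed
  ultimately show "(\<lambda>E. ?S (emb \<iota> a * z) (E + degree a)) \<longlonglongrightarrow> (\<Sum>r\<in>below (degree a).
      ?G (t_par \<iota> \<pi> z / (1 + t_par \<iota> \<pi> z * torsion a r))) / emb \<iota> a ^ n"
    by (simp add: t_par_translated[OF z])
qed

end

text \<open>Truncates the power series of \<open>(t / (1 + tu)) ^ l\<close> in \<open>t\<close>
  below degree \<open>M\<close>. The error bound is independent of \<open>l\<close> and of
  \<open>u\<close>, so it passes unchanged to sums over Goss coefficients and torsion
  points.\<close>

lemma neg_binom_shifted_expansion:
  fixes t u :: "'c::nonarch_field"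
  assumes "vabs u \<le> B" and "B \<ge> 1" and "vabs t * B < 1"
  shows "vabs ((\<Sum>m<M. if l \<le> m then of_int (neg_binom l (m - l)) * u ^ (m - l) * t ^ m else 0)
    - (t / (1 + t * u)) ^ l) \<le> (vabs t * B) ^ M"
proof -
  have "vabs t * vabs u \<le> vabs t * B"
    using assms(1) by (intro mult_left_mono) auto
  then have tu_le: "vabs (t * u) \<le> vabs t * B"
    by (simp add: vabs_mult)
  then have tu: "vabs (t * u) < 1"
    using assms(3) by linarith
  have "vabs t * 1 \<le> vabs t * B"
    using assms(2) by (intro mult_left_mono) auto
  then have t_le: "vabs t \<le> vabs t * B"
    by simp
  let ?f = "\<lambda>m. if l \<le> m then of_int (neg_binom l (m - l)) * u ^ (m - l) * t ^ m else 0"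
  show ?thesis
  proof (cases "l < M")
    case True
    define L where "L = M - l - 1"
    have M: "M = l + Suc L"
      using True by (simp add: L_def)
    have "(\<Sum>m<M. ?f m) = (\<Sum>m\<in>{l..<M}. ?f m)"
      by (intro sum.mono_neutral_right) auto
    also have "\<dots> = (\<Sum>i\<le>L. ?f (i + l))"
      by (rule sum.reindex_bij_witness[of _ "\<lambda>i. i + l" "\<lambda>m. m - l"]) (auto simp: M)
    also have "\<dots> = t ^ l * (\<Sum>i\<le>L. of_int (neg_binom l i) * (t * u) ^ i)"
      unfolding sum_distrib_left by (intro sum.cong refl) (simp add: power_add power_mult_distrib mult_ac)
    finally have "(\<Sum>m<M. ?f m) - (t / (1 + t * u)) ^ l
        = t ^ l * ((\<Sum>i\<le>L. of_int (neg_binom l i) * (t * u) ^ i) - 1 / (1 + t * u) ^ l)"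
      by (simp add: right_diff_distrib power_divide)
    then have "vabs ((\<Sum>m<M. ?f m) - (t / (1 + t * u)) ^ l)
        = vabs t ^ l * vabs ((\<Sum>i\<le>L. of_int (neg_binom l i) * (t * u) ^ i) - 1 / (1 + t * u) ^ l)"
      by (simp only: vabs_mult vabs_power)
    also have "\<dots> \<le> (vabs t * B) ^ l * (vabs t * B) ^ Suc L"
    proof (rule mult_mono)
      show "vabs t ^ l \<le> (vabs t * B) ^ l"
        using t_le by (intro power_mono) auto
      have "vabs ((\<Sum>i\<le>L. of_int (neg_binom l i) * (t * u) ^ i) - 1 / (1 + t * u) ^ l) \<le> vabs (t * u) ^ Suc L"
        by (rule neg_binom_expansion[OF tu])
      also have "\<dots> \<le> (vabs t * B) ^ Suc L"
        using tu_le by (intro power_mono) auto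
      finally show "vabs ((\<Sum>i\<le>L. of_int (neg_binom l i) * (t * u) ^ i) - 1 / (1 + t * u) ^ l)
        \<le> (vabs t * B) ^ Suc L" .
    qed (use assms in auto)
    also have "\<dots> = (vabs t * B) ^ M"
      by (simp only: M power_add)
    finally show ?thesis .
  next
    \<comment> \<open>Nothing is left of the truncation, and the function itself is small because
      \<open>l \<ge> M\<close>.\<close>
    case False
    then have "(\<Sum>m<M. ?f m) = 0"
      by (intro sum.neutral) auto
    moreover have "vabs (1 + t * u) = 1"
      using vabs_add_eq_left[of "t * u" 1] tu by simp
    ultimately have "vabs ((\<Sum>m<M. ?f m) - (t / (1 + t * u)) ^ l) = vabs t ^ l"
      by (simp add: vabs_power vabs_divide)
    also have "\<dots> \<le> (vabs t * B) ^ l"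
      using t_le by (intro power_mono) auto
    also have "\<dots> \<le> (vabs t * B) ^ M"
      using False assms by (intro power_decreasing) auto
    finally show ?thesis .
  qed
qed

context twisted_double_series
begin

definition summand_coeff :: "'a poly \<Rightarrow> nat \<Rightarrow> 'c" where
  "summand_coeff a m = emb \<iota> a ^ (k - n) / emb \<iota> a ^ n *
    (\<Sum>l=1..degree (goss_poly \<iota> \<pi> n). coeff (goss_poly \<iota> \<pi> n) l *
      (\<Sum>r\<in>below (degree a). if l \<le> m then of_int (neg_binom l (m - l)) * torsion a r ^ (m - l) else 0))"

text \<open>Polynomials \<open>a\<close> with \<open>degree a \<ge> m\<close> are left out because
  they contribute nothing to \<open>t ^ m\<close>; this keeps the sum finite.\<close>

definition total_coeff :: "nat \<Rightarrow> 'c" where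
  "total_coeff m = (\<Sum>a\<in>A_plus \<inter> below m. summand_coeff a m)"

text \<open>With \<open>l \<ge> 1\<close> the power sums have exponent
  \<open>m - l < degree a\<close>, too small for a group of \<open>q ^ degree a\<close> torsion
  points. The absent constant term of the Goss polynomial excludes \<open>l = 0\<close>.\<close>

lemma summand_coeff_eq_0:
  assumes "a \<noteq> 0" and "m \<le> degree a"
  shows "summand_coeff a m = 0"
proof -
  have "(\<Sum>r\<in>below (degree a). if l \<le> m then of_int (neg_binom l (m - l)) * torsion a r ^ (m - l) else 0)
      = (0 :: 'c)" if "l \<ge> 1" for l
  proof (cases "l \<le> m")
    case True
    have "degree a < 2 ^ degree a"
      by (rule less_exp)
    also have "\<dots> \<le> CARD('a) ^ degree a"
      by (intro power_mono card_finite_field_ge_2) auto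
    finally have "m - l + 1 < CARD('a) ^ degree a"
      using True that assms(2) by linarith
    then have "(\<Sum>r\<in>below (degree a). torsion a r ^ (m - l)) = 0"
      by (rule sum_torsion_power_eq_0[OF assms(1)])
    then show ?thesis
      using True by (simp flip: sum_distrib_left)
  qed simp
  then show ?thesis
    by (simp add: summand_coeff_def)
qed

text \<open>The error depends on \<open>a\<close> only through
  \<open>vabs (emb \<iota> a) ^ (k - n)\<close>: torsion points are bounded by \<open>B\<close> for
  all \<open>a\<close> at once, and division by \<open>a ^ n\<close> does not enlarge it.\<close>

lemma f_summand_expansion:
  assumes z: "z \<in> Omega \<iota>" and a: "a \<noteq> 0" and B: "B \<ge> 1" "B \<ge> vabs \<pi>"
    and t: "vabs (t_par \<iota> \<pi> z) * B < 1"
    and G: "G \<ge> 0" "\<And>l. vabs (coeff (goss_poly \<iota> \<pi> n) l) \<le> G"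
  shows "vabs ((\<Sum>m<M. summand_coeff a m * t_par \<iota> \<pi> z ^ m) - f_summand \<iota> \<pi> k n z a)
    \<le> vabs (emb \<iota> a) ^ (k - n) * (G * (vabs (t_par \<iota> \<pi> z) * B) ^ M)"
proof -
  define t where "t = t_par \<iota> \<pi> z"
  define g where "g = goss_poly \<iota> \<pi> n"
  define A where "A = emb \<iota> a ^ (k - n) / emb \<iota> a ^ n"
  let ?h = "\<lambda>l r m. if l \<le> m then of_int (neg_binom l (m - l)) * torsion a r ^ (m - l) * t ^ m else 0"
  have "coeff g 0 = 0"
    unfolding g_def using goss_poly_spec(1)[OF z] n_pos by simp
  have poly_g: "poly g x = (\<Sum>l=1..degree g. coeff g l * x ^ l)" for x
  proof -
    have "{..degree g} = insert 0 {1..degree g}"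
      by auto
    then show ?thesis
      using \<open>coeff g 0 = 0\<close> by (simp add: poly_altdef)
  qed
  have "f_summand \<iota> \<pi> k n z a = A * (\<Sum>r\<in>below (degree a). poly g (t / (1 + t * torsion a r)))"
    unfolding f_summand_def A_def g_def t_def
    using goss_poly_t_scaled[OF z scaled_in_Omega[OF z a] a] n_pos by simp
  also have "\<dots> = A * (\<Sum>l=1..degree g. coeff g l * (\<Sum>r\<in>below (degree a). (t / (1 + t * torsion a r)) ^ l))"
    unfolding poly_g sum_distrib_left by (subst sum.swap) simp
  finally have f: "f_summand \<iota> \<pi> k n z a
      = A * (\<Sum>l=1..degree g. coeff g l * (\<Sum>r\<in>below (degree a). (t / (1 + t * torsion a r)) ^ l))" .
  have sc: "summand_coeff a m * t ^ m = A * (\<Sum>l=1..degree g. coeff g l * (\<Sum>r\<in>below (degree a). ?h l r m))" for m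
    unfolding summand_coeff_def g_def[symmetric] A_def[symmetric] mult.assoc sum_distrib_right
    by (intro arg_cong2[where f = "(*)"] sum.cong refl) simp
  have "(\<Sum>m<M. summand_coeff a m * t ^ m)
      = A * (\<Sum>l=1..degree g. coeff g l * (\<Sum>r\<in>below (degree a). \<Sum>m<M. ?h l r m))"
    unfolding sc sum_distrib_left[symmetric]
    by (subst sum.swap, unfold sum_distrib_left[symmetric], subst sum.swap) (rule refl)
  then have "(\<Sum>m<M. summand_coeff a m * t ^ m) - f_summand \<iota> \<pi> k n z a
      = A * (\<Sum>l=1..degree g. coeff g l *
          (\<Sum>r\<in>below (degree a). (\<Sum>m<M. ?h l r m) - (t / (1 + t * torsion a r)) ^ l))"
    unfolding f by (simp only: right_diff_distrib sum_subtractf)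
  also have "vabs \<dots> \<le> vabs (emb \<iota> a) ^ (k - n) * (G * (vabs t * B) ^ M)"
    unfolding vabs_mult
  proof (rule mult_mono)
    have "vabs (emb \<iota> a) ^ n \<ge> 1"
      using vabs_emb_ge_1[OF a] by (rule one_le_power)
    then have "vabs (emb \<iota> a) ^ (k - n) / vabs (emb \<iota> a) ^ n \<le> vabs (emb \<iota> a) ^ (k - n) / 1"
      by (intro frac_le) auto
    then show "vabs A \<le> vabs (emb \<iota> a) ^ (k - n)"
      by (simp add: A_def vabs_divide vabs_power)
    show "vabs (\<Sum>l=1..degree g. coeff g l *
        (\<Sum>r\<in>below (degree a). (\<Sum>m<M. ?h l r m) - (t / (1 + t * torsion a r)) ^ l))
        \<le> G * (vabs t * B) ^ M"
    proof (rule vabs_sum_le)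
      fix l
      have "vabs (\<Sum>r\<in>below (degree a). (\<Sum>m<M. ?h l r m) - (t / (1 + t * torsion a r)) ^ l)
          \<le> (vabs t * B) ^ M"
      proof (rule vabs_sum_le)
        fix r :: "'a poly"
        assume "r \<in> below (degree a)"
        then have "vabs (torsion a r) \<le> B"
          using vabs_torsion(2)[OF a] B(2) by fastforce
        then show "vabs ((\<Sum>m<M. ?h l r m) - (t / (1 + t * torsion a r)) ^ l) \<le> (vabs t * B) ^ M"
          using B(1) assms(5) unfolding t_def by (rule neg_binom_shifted_expansion)
      qed (use B in simp)
      then show "vabs (coeff g l * (\<Sum>r\<in>below (degree a). (\<Sum>m<M. ?h l r m) - (t / (1 + t * torsion a r)) ^ l))
          \<le> G * (vabs t * B) ^ M"
        unfolding vabs_mult using G B by (intro mult_mono) (auto simp: g_def)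
    qed (use G B in simp)
  qed (use G B in auto)
  finally show ?thesis
    by (simp add: t_def)
qed

lemma total_t_expansion: "has_t_expansion \<iota> \<pi> (\<lambda>z. - total z / \<pi> ^ n) total_coeff"
proof -
  define B where "B = max 1 (vabs \<pi>)"
  define G where "G = Max (insert 0 ((\<lambda>l. vabs (coeff (goss_poly \<iota> \<pi> n) l)) ` {..degree (goss_poly \<iota> \<pi> n)}))"
  \<comment> \<open>\<open>q ^ (k - n)\<close> offsets the growth of \<open>a ^ (k - n)\<close> per
    degree, \<open>B\<close> bounds the torsion points, and \<open>vabs \<pi>\<close> comes from
    \<open>vabs t \<le> 1 / (vabs \<pi> * imag_abs \<iota> z)\<close>. Together they force
    \<open>\<theta> < 1\<close>.\<close>
  define R where "R = q ^ (k - n) * B / vabs \<pi>"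
  have G0: "G \<ge> 0"
    unfolding G_def by (intro Max_ge) auto
  have G: "vabs (coeff (goss_poly \<iota> \<pi> n) l) \<le> G" for l
  proof (cases "l \<le> degree (goss_poly \<iota> \<pi> n)")
    case True
    then show ?thesis
      unfolding G_def by (intro Max_ge) auto
  qed (use G0 in \<open>simp add: coeff_eq_0\<close>)
  have B: "B \<ge> 1" "B \<ge> vabs \<pi>"
    by (simp_all add: B_def)
  have "(\<lambda>m. total_coeff m * t_par \<iota> \<pi> z ^ m) sums (- total z / \<pi> ^ n)"
    if z: "z \<in> Omega \<iota>" and R: "imag_abs \<iota> z > R" for z
  proof -
    define t where "t = t_par \<iota> \<pi> z"
    define \<theta> where "\<theta> = q ^ (k - n) * (vabs t * B)"
    have pos: "vabs \<pi> > 0"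
      using period_nonzero by simp
    have "q ^ (k - n) * B < vabs \<pi> * imag_abs \<iota> z"
      using R pos by (simp add: R_def field_simps)
    moreover have "vabs t \<le> 1 / (vabs \<pi> * imag_abs \<iota> z)"
      unfolding t_def by (rule vabs_t_par_le[OF z])
    moreover have qB: "q ^ (k - n) * B > 0"
      using B by simp
    ultimately have "vabs t * (vabs \<pi> * imag_abs \<iota> z) \<le> 1" "vabs \<pi> * imag_abs \<iota> z > q ^ (k - n) * B"
      by (simp_all add: field_simps)
    have t_pos: "vabs t > 0"
      unfolding t_def t_par_def using lattice_exp_nonzero[OF z] by simp
    have "vabs t * (q ^ (k - n) * B) < vabs t * (vabs \<pi> * imag_abs \<iota> z)"
      using t_pos \<open>vabs \<pi> * imag_abs \<iota> z > q ^ (k - n) * B\<close> by (intro mult_strict_left_mono)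
    also have "\<dots> \<le> 1"
      by fact
    finally have \<theta>: "\<theta> < 1" "\<theta> \<ge> 0"
      using B by (simp_all add: \<theta>_def mult_ac)
    have "1 * (vabs t * B) \<le> \<theta>"
      unfolding \<theta>_def using q_ge_2 B by (intro mult_right_mono one_le_power) auto
    with \<theta>(1) have tB: "vabs t * B < 1"
      by linarith
    \<comment> \<open>One index \<open>M\<close> truncates both the power series and the sum over
      \<open>a\<close>: for \<open>m < M\<close> the range in \<open>total_coeff m\<close> may be
      enlarged to \<open>below M\<close> at no cost. Then
      \<open>vabs (emb \<iota> a) < q ^ M\<close>, and the error is a power of \<theta>.\<close>
    have le: "vabs ((\<Sum>m<M. total_coeff m * t ^ m) - (\<Sum>a\<in>A_plus \<inter> below M. f_summand \<iota> \<pi> k n z a))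
        \<le> G * \<theta> ^ M" for M
    proof -
      have nz: "a \<noteq> 0" if "a \<in> A_plus" for a :: "'a poly"
        using that by (auto simp: A_plus_def)
      have "total_coeff m = (\<Sum>a\<in>A_plus \<inter> below M. summand_coeff a m)" if "m < M" for m
        unfolding total_coeff_def
      proof (rule sum.mono_neutral_left)
        show "A_plus \<inter> below m \<subseteq> A_plus \<inter> below M"
          using below_mono[of m M] that by auto
        show "\<forall>a\<in>A_plus \<inter> below M - A_plus \<inter> below m. summand_coeff a m = 0"
          using nz by (auto simp: below_def intro!: summand_coeff_eq_0)
      qed simp
      then have "(\<Sum>m<M. total_coeff m * t ^ m)
          = (\<Sum>m<M. (\<Sum>a\<in>A_plus \<inter> below M. summand_coeff a m) * t ^ m)"
        by simp
      also have "\<dots> = (\<Sum>a\<in>A_plus \<inter> below M. \<Sum>m<M. summand_coeff a m * t ^ m)"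
        unfolding sum_distrib_right by (rule sum.swap)
      finally have "(\<Sum>m<M. total_coeff m * t ^ m) - (\<Sum>a\<in>A_plus \<inter> below M. f_summand \<iota> \<pi> k n z a)
          = (\<Sum>a\<in>A_plus \<inter> below M. (\<Sum>m<M. summand_coeff a m * t ^ m) - f_summand \<iota> \<pi> k n z a)"
        by (simp add: sum_subtractf)
      also have "vabs \<dots> \<le> G * \<theta> ^ M"
      proof (rule vabs_sum_le)
        fix a :: "'a poly"
        assume a: "a \<in> A_plus \<inter> below M"
        have "vabs (emb \<iota> a) ^ (k - n) \<le> (q ^ M) ^ (k - n)"
          using a by (intro power_mono) (auto simp: in_below_iff)
        then have "vabs (emb \<iota> a) ^ (k - n) * (G * (vabs t * B) ^ M) \<le> (q ^ M) ^ (k - n) * (G * (vabs t * B) ^ M)"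
          using G0 B by (intro mult_right_mono) auto
        also have "\<dots> = G * \<theta> ^ M"
          by (simp add: \<theta>_def power_mult_distrib mult.commute flip: power_mult)
        finally show "vabs ((\<Sum>m<M. summand_coeff a m * t ^ m) - f_summand \<iota> \<pi> k n z a) \<le> G * \<theta> ^ M"
          using f_summand_expansion[OF z nz B tB[unfolded t_def] G0 G, of a M] a by (simp add: t_def)
      qed (use G0 \<theta> in simp)
      finally show ?thesis .
    qed
    have "(\<lambda>M. G * \<theta> ^ M) \<longlonglongrightarrow> G * 0"
      using \<theta> by (intro tendsto_mult tendsto_const LIMSEQ_power_zero) auto
    then have "(\<lambda>M. G * \<theta> ^ M) \<longlonglongrightarrow> 0"
      by simp
    then have "(\<lambda>M. vabs ((\<Sum>m<M. total_coeff m * t ^ m)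
        - (\<Sum>a\<in>A_plus \<inter> below M. f_summand \<iota> \<pi> k n z a) - 0)) \<longlonglongrightarrow> 0"
      by (rule tendsto_sandwich[OF always_eventually always_eventually tendsto_const, rotated 2])
        (use le in simp_all)
    then have "(\<lambda>M. (\<Sum>m<M. total_coeff m * t ^ m)
        - (\<Sum>a\<in>A_plus \<inter> below M. f_summand \<iota> \<pi> k n z a)) \<longlonglongrightarrow> 0"
      unfolding tendsto_vabs_diff_0_iff .
    from tendsto_add[OF this infsum_f_summand(2)[OF z]] show ?thesis
      by (simp add: sums_def t_def)
  qed
  then show ?thesis
    unfolding has_t_expansion_def by blast
qed

lemma total_coeff_0: "total_coeff 0 = 0"
proof -
  have "A_plus \<inter> below 0 = ({} :: 'a poly set)"
    by (auto simp: A_plus_def below_def)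
  then show ?thesis
    by (simp add: total_coeff_def)
qed

end

theorem theorem1p3:
  fixes p e k n :: nat and m :: int
    and \<iota> :: "'a::{finite,field} fls \<Rightarrow> 'c::{nonarch_field,complete_space}"
    and \<pi> :: 'c
  assumes "prime p" and "CARD('a) = p ^ e"
    and "is_C_infinity \<iota>" and "carlitz_period \<iota> \<pi>"
    and "k > 0" and "n > 0"
    and "k > 2 * n" and "(CARD('a) - 1) dvd (k - 2 * n)"
    and "n \<le> p ^ multiplicity p (k - n)"
    and "[m = int n] (mod (int CARD('a) - 1))"
  shows "(\<forall>z \<in> Omega \<iota>. imag_abs \<iota> z > 1 \<longrightarrow> f_summand \<iota> \<pi> k n z summable_on A_plus) \<and>
    (\<exists>F \<in> cusp_forms \<iota> \<pi> k m. \<forall>z \<in> Omega \<iota>. imag_abs \<iota> z > 1 \<longrightarrow>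
       F z = (\<Sum>\<^sub>\<infinity>a\<in>A_plus. f_summand \<iota> \<pi> k n z a))"
proof -
  interpret C_infinity \<iota> "real CARD('a)"
    by unfold_locales (use assms in auto)
  interpret twisted_double_series \<iota> "real CARD('a)" \<pi> k n
    by unfold_locales (use assms in \<open>auto simp: carlitz_period_def\<close>)
  interpret modular_double_series \<iota> "real CARD('a)" \<pi> k n p "multiplicity p (k - n)"
    by unfold_locales (use assms CHAR_eq[of p e] in \<open>auto simp: multiplicity_dvd\<close>)
  define F where "F = (\<lambda>z. - total z / \<pi> ^ n)"
  have "rigid_analytic \<iota> F"
    unfolding F_def using rigid_analytic_total[of "- 1 / \<pi> ^ n"] by simp
  moreover have "F ((emb \<iota> (M$1$1) * z + emb \<iota> (M$1$2)) / (emb \<iota> (M$2$1) * z + emb \<iota> (M$2$2)))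
      = emb \<iota> (det M) powi (- m) * (emb \<iota> (M$2$1) * z + emb \<iota> (M$2$2)) ^ k * F z"
    if inv: "invertible M" and z: "z \<in> Omega \<iota>" for M :: "'a poly ^ 2 ^ 2" and z
  proof -
    obtain M' :: "'a poly ^ 2 ^ 2" where "M ** M' = mat 1"
      using inv unfolding invertible_def by blast
    then have unit': "det M * det M' = 1"
      using det_mul[of M M'] by simp
    then have unit: "(M$1$1 * M$2$2 - M$1$2 * M$2$1) * det M' = 1"
      by (simp add: det_2)
    \<comment> \<open>The transformation law produces the determinant to the power
      \<open>-(k - n)\<close>; it has type \<open>n\<close> because \<open>k - n\<close> and
      \<open>n\<close> differ by a multiple of \<open>q - 1\<close>.\<close>
    have "int (k - n) = int n + int (k - 2 * n)"
      using assms(7) by simp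
    moreover have "int CARD('a) - 1 = int (CARD('a) - 1)"
      using card_finite_field_ge_2[where 'a = 'a] by (simp add: of_nat_diff)
    then have "int CARD('a) - 1 dvd int (k - 2 * n)"
      using assms(8) by (simp only: int_dvd_int_iff)
    ultimately have "[int (k - n) = int n] (mod (int CARD('a) - 1))"
      by (simp add: cong_iff_dvd_diff)
    then have "[m = int (k - n)] (mod (int CARD('a) - 1))"
      by (rule cong_trans[OF assms(10) cong_sym])
    then have "emb \<iota> (det M') ^ (k - n) = emb \<iota> (det M) powi (- m)"
      by (rule emb_unit_power[OF unit'])
    then show ?thesis
      unfolding F_def total_moebius[OF z unit] by simp
  qed
  moreover have "has_t_expansion \<iota> \<pi> F total_coeff"
    using total_t_expansion unfolding F_def .
  ultimately have "F \<in> cusp_forms \<iota> \<pi> k m"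
    unfolding cusp_forms_def modular_forms_def mem_Collect_eq using total_coeff_0
    by (intro conjI allI impI ballI exI[of _ total_coeff])
  then show ?thesis
    using f_summand_summable infsum_f_summand(1) unfolding F_def by (intro conjI ballI impI bexI) simp_all
qed

end
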